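(* Let $d,D\in\mathbb{N}_{+}$ and $s\in\mathbb{N}$ with $d\geq\max\{s+10,11\}$, and let $\delta>0$. There exists a constant $c\in(0,1]$ depending only on $s$, and a constant $p_{0}$ depending only on $\delta,d,D$, such that the following holds for every prime $p\ge p_{0}$. Let $M\colon\mathbb{F}_{p}^{d}\to\mathbb{F}_{p}$ be a non-degenerate quadratic form and let $P\subseteq\mathbb{F}_{p}^{d}$ be a proper homogeneous generalized arithmetic progression of rank $D$ with $|P|>\delta p^{d}$. If $\xi\colon P\to\mathrm{HP}_{d}(s)$ satisfies $$\xi(h_{1})+\xi(h_{2})-\xi(h_{3})-\xi(h_{4})\in J^{M}_{h_{1},h_{2},h_{3}}\quad\text{for all }h_{1},h_{2},h_{3},h_{4}\in P\text{ with }h_{1}+h_{2}=h_{3}+h_{4},$$ then there is a locally linear map $T\colon P(c)\to\mathrm{HP}_{d}(s)$ such that $\xi(h)-T(h)\in J^{M}_{h}$ for all $h\in P(c)$.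
   Context: $\mathrm{HP}_{d}(s)$ is the set of homogeneous degree-$s$ polynomials in $\mathbb{F}_{p}[x_{1},\dots,x_{d}]$ together with $0$. A quadratic form is $M(n)=(nA)\cdot n+n\cdot u+v$ with $A$ symmetric over $\mathbb{F}_{p}$ (row vectors), non-degenerate if $\det A\ne 0$; $J^{M}_{h_{1},\dots,h_{k}}$ is the ideal of $\mathbb{F}_{p}[x_{1},\dots,x_{d}]$ generated by $n\mapsto(nA)\cdot n$ and $n\mapsto(h_{i}A)\cdot n$, $n=(x_{1},\dots,x_{d})$. A homogeneous generalized arithmetic progression of rank $D$ is a set $P=\{\ell_{1}v_{1}+\dots+\ell_{D}v_{D}\colon \ell_{i}\in\mathbb{Z}\cap(-L_{i},L_{i})\}$ with $v_{i}\in\mathbb{F}_{p}^{d}$, $L_{i}>0$; it is proper if all these sums are distinct. For $0<c\le1$, $P(c)=\{\ell_{1}v_{1}+\dots+\ell_{D}v_{D}\colon \ell_{i}\in\mathbb{Z}\cap(-cL_{i},cL_{i})\}$. A map $T\colon P(c)\to\mathrm{HP}_{d}(s)$ is locally linear if there are $f_{0},\dots,f_{D}\in\mathrm{HP}_{d}(s)$ with $T(\ell_{1}v_{1}+\dots+\ell_{D}v_{D})=f_{0}+\ell_{1}f_{1}+\dots+\ell_{D}f_{D}$ for all admissible $\ell_{i}$. *)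

theory Defs
  imports Complex_Main "HOL-Library.Poly_Mapping" "HOL-Combinatorics.Permutations"
    "HOL-Computational_Algebra.Primes"
begin

text \<open>Polynomials in variables x_0, x_1, ... with integer coefficients; F_p[x_1..x_d]
  is represented as polynomials in variables x_0..x_(d-1) taken modulo p.\<close>
type_synonym mpoly = "(nat \<Rightarrow>\<^sub>0 nat) \<Rightarrow>\<^sub>0 int"

definition Var :: "nat \<Rightarrow> mpoly" where
  "Var i = Poly_Mapping.single (Poly_Mapping.single i 1) 1"

definition vars_in :: "nat \<Rightarrow> mpoly \<Rightarrow> bool" where
  "vars_in d f \<longleftrightarrow> (\<forall>m::nat \<Rightarrow>\<^sub>0 nat. m \<in> Poly_Mapping.keys f \<longrightarrow> Poly_Mapping.keys m \<subseteq> {..<d})"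

definition congp :: "nat \<Rightarrow> mpoly \<Rightarrow> mpoly \<Rightarrow> bool" where
  "congp p f g \<longleftrightarrow> (\<forall>m. int p dvd Poly_Mapping.lookup (f - g) m)"

definition mdeg :: "(nat \<Rightarrow>\<^sub>0 nat) \<Rightarrow> nat" where
  "mdeg m = (\<Sum>i\<in>Poly_Mapping.keys m. Poly_Mapping.lookup m i)"

definition HP :: "nat \<Rightarrow> nat \<Rightarrow> nat \<Rightarrow> mpoly \<Rightarrow> bool" where
  "HP p d s f \<longleftrightarrow> (\<forall>m::nat \<Rightarrow>\<^sub>0 nat. m \<in> Poly_Mapping.keys f \<longrightarrow> \<not> int p dvd Poly_Mapping.lookup f m \<longrightarrow> Poly_Mapping.keys m \<subseteq> {..<d} \<and> mdeg m = s)"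

inductive_set zideal :: "nat \<Rightarrow> mpoly set \<Rightarrow> mpoly set" for d G where
  zero: "0 \<in> zideal d G"
| step: "g \<in> G \<Longrightarrow> vars_in d a \<Longrightarrow> f \<in> zideal d G \<Longrightarrow> a * g + f \<in> zideal d G"

definition Fvec :: "nat \<Rightarrow> nat \<Rightarrow> (nat \<Rightarrow> int) set" where
  "Fvec p d = {v. (\<forall>i<d. 0 \<le> v i \<and> v i < int p) \<and> (\<forall>i\<ge>d. v i = 0)}"

definition vadd :: "nat \<Rightarrow> nat \<Rightarrow> (nat \<Rightarrow> int) \<Rightarrow> (nat \<Rightarrow> int) \<Rightarrow> (nat \<Rightarrow> int)" where
  "vadd p d x y = (\<lambda>i. if i < d then (x i + y i) mod int p else 0)"

definition Qform :: "nat \<Rightarrow> (nat \<Rightarrow> nat \<Rightarrow> int) \<Rightarrow> mpoly" where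
  "Qform d A = (\<Sum>i<d. \<Sum>j<d. of_int (A i j) * Var i * Var j)"

definition Lform :: "nat \<Rightarrow> (nat \<Rightarrow> nat \<Rightarrow> int) \<Rightarrow> (nat \<Rightarrow> int) \<Rightarrow> mpoly" where
  "Lform d A h = (\<Sum>j<d. of_int (\<Sum>i<d. h i * A i j) * Var j)"

definition Jmem :: "nat \<Rightarrow> nat \<Rightarrow> (nat \<Rightarrow> nat \<Rightarrow> int) \<Rightarrow> (nat \<Rightarrow> int) set \<Rightarrow> mpoly \<Rightarrow> bool" where
  "Jmem p d A H f \<longleftrightarrow> (\<exists>g \<in> zideal d (insert (Qform d A) (Lform d A ` H)). congp p f g)"

definition det_int :: "nat \<Rightarrow> (nat \<Rightarrow> nat \<Rightarrow> int) \<Rightarrow> int" where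
  "det_int d A = (\<Sum>\<pi> \<in> {\<pi>. \<pi> permutes {..<d}}. sign \<pi> * (\<Prod>i<d. A i (\<pi> i)))"

definition nondeg_sym :: "nat \<Rightarrow> nat \<Rightarrow> (nat \<Rightarrow> nat \<Rightarrow> int) \<Rightarrow> bool" where
  "nondeg_sym p d A \<longleftrightarrow> (\<forall>i<d. \<forall>j<d. 0 \<le> A i j \<and> A i j < int p \<and> A i j = A j i)
     \<and> \<not> int p dvd det_int d A"

definition box :: "nat \<Rightarrow> (nat \<Rightarrow> real) \<Rightarrow> real \<Rightarrow> (nat \<Rightarrow> int) set" where
  "box D L c = {l. (\<forall>j<D. of_int \<bar>l j\<bar> < c * L j) \<and> (\<forall>j\<ge>D. l j = 0)}"

text \<open>The point l_1 v_1 + ... + l_D v_D of F_p^d (vs j = v_(j+1)).\<close>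
definition gp :: "nat \<Rightarrow> nat \<Rightarrow> nat \<Rightarrow> (nat \<Rightarrow> nat \<Rightarrow> int) \<Rightarrow> (nat \<Rightarrow> int) \<Rightarrow> (nat \<Rightarrow> int)" where
  "gp p d D vs l = (\<lambda>i. if i < d then (\<Sum>j<D. l j * vs j i) mod int p else 0)"

definition GAP :: "nat \<Rightarrow> nat \<Rightarrow> nat \<Rightarrow> (nat \<Rightarrow> nat \<Rightarrow> int) \<Rightarrow> (nat \<Rightarrow> real) \<Rightarrow> real \<Rightarrow> (nat \<Rightarrow> int) set" where
  "GAP p d D vs L c = gp p d D vs ` box D L c"

end

theory Submission
  imports Defs "HOL-Library.Function_Algebras" "HOL-Computational_Algebra.Polynomial"
    "Jordan_Normal_Form.Determinant"
begin

text \<open>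
  Subtracting \<open>\<xi> 0\<close>, the hypothesis with \<open>h\<^sub>3 = 0\<close> says that \<open>X = \<xi> - \<xi> 0\<close> satisfies
  \<open>X (a + b) \<equiv> X a + X b\<close> modulo \<open>J\<^sub>a\<^sub>,\<^sub>b\<close>. Write \<open>L\<^sub>h\<close> for the linear form of \<open>h\<close>.
  The main device is that a polynomial of degree \<open>s\<close> lying in \<open>J\<^sub>u\<^sub>,\<^sub>w\<close> for more than \<open>s\<close> vectors \<open>w\<close>
  in general position lies in \<open>J\<^sub>u\<close>, because modulo \<open>J\<^sub>u\<close> it is divisible by the product of the \<open>L\<^sub>w\<close>.

  Fix \<open>s + 5\<close> independent base vectors in a small dilate of \<open>P\<close>, which exist as \<open>P\<close> is dense.
  The Chinese remainder theorem gives \<open>T\<close> with \<open>T h - T h' \<equiv> X (h - h')\<close> modulo \<open>J\<^bsub>h - h'\<^esub>\<close>, first on the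
  base and then everywhere. Such a \<open>T\<close> need not be additive: for \<open>s = 2\<close> and \<open>X = 0\<close>, \<open>h \<mapsto> L\<^sub>h\<^sup>2\<close> is one.
  However, \<open>F c = T (b + c) - T b - T c\<close> satisfies \<open>F c \<equiv> F c'\<close> modulo \<open>J\<^bsub>c - c'\<^esub>\<close>, so Newton interpolation
  makes it the degree \<open>s\<close> part of a polynomial in \<open>L\<^sub>c\<close>. Hence \<open>T (n b)\<close> is a polynomial in \<open>n\<close>, and a fixed
  combination of the dilates \<open>T (2\<^sup>i h)\<close> retains precisely its linear term. The resulting map is
  homogeneous on multiples, so its additive defect at \<open>(a, b)\<close> lies in \<open>J\<^bsub>a - k b\<^esub>\<close> for \<open>0 \<le> k \<le> s\<close>
  and therefore vanishes.

  That \<open>L\<^sub>w\<close> is a nonzerodivisor modulo \<open>J\<^sub>u\<^sub>,\<^sub>v\<close> follows from two facts: linear forms generate prime ideals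
  (eliminate variables), and a non-degenerate quadratic form is not in an ideal generated by three
  linear forms.
\<close>

section \<open>Ideals and polynomial sequences\<close>

text \<open>Congruence modulo an ideal \<open>K\<close> is written \<open>f - g \<in> K\<close>
  throughout, so that one notation serves the abstract ring and the polynomial ring.\<close>

definition is_ideal :: "'a::comm_ring_1 set \<Rightarrow> bool" where
  "is_ideal K \<longleftrightarrow> 0 \<in> K \<and> (\<forall>f\<in>K. \<forall>g\<in>K. f + g \<in> K) \<and> (\<forall>f\<in>K. \<forall>a. a * f \<in> K)"

lemma is_idealI:
  "\<lbrakk>0 \<in> K; \<And>f g. f \<in> K \<Longrightarrow> g \<in> K \<Longrightarrow> f + g \<in> K; \<And>a f. f \<in> K \<Longrightarrow> a * f \<in> K\<rbrakk> \<Longrightarrow> is_ideal K"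
  by (auto simp: is_ideal_def)

lemma is_ideal_0: "is_ideal K \<Longrightarrow> 0 \<in> K"
  by (auto simp: is_ideal_def)

lemma is_ideal_add: "is_ideal K \<Longrightarrow> f \<in> K \<Longrightarrow> g \<in> K \<Longrightarrow> f + g \<in> K"
  by (auto simp: is_ideal_def)

lemma is_ideal_mult: "is_ideal K \<Longrightarrow> f \<in> K \<Longrightarrow> a * f \<in> K"
  by (auto simp: is_ideal_def)

lemma is_ideal_mult2: "is_ideal K \<Longrightarrow> f \<in> K \<Longrightarrow> f * a \<in> K"
  by (metis is_ideal_mult mult.commute)

lemma is_ideal_uminus: "is_ideal K \<Longrightarrow> f \<in> K \<Longrightarrow> - f \<in> K"
  using is_ideal_mult[of K f "-1"] by simp

lemma is_ideal_diff: "is_ideal K \<Longrightarrow> f \<in> K \<Longrightarrow> g \<in> K \<Longrightarrow> f - g \<in> K"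
  using is_ideal_add[of K f "-g"] is_ideal_uminus by auto

lemma is_ideal_sum: "is_ideal K \<Longrightarrow> (\<And>i. i \<in> S \<Longrightarrow> f i \<in> K) \<Longrightarrow> sum f S \<in> K"
  by (induction S rule: infinite_finite_induct) (auto simp: is_ideal_0 is_ideal_add)

lemmas is_ideal_closed = is_ideal_0 is_ideal_add is_ideal_mult is_ideal_mult2
  is_ideal_uminus is_ideal_diff is_ideal_sum

lemma is_ideal_diff_trans:
  assumes "is_ideal K" "f - g \<in> K" "g - h \<in> K" shows "f - h \<in> K"
  using is_ideal_add[OF assms] by simp

lemma is_ideal_mult_cong:
  assumes "is_ideal K" "a - a' \<in> K" "b - b' \<in> K" shows "a * b - a' * b' \<in> K"
proof -
  have "a * b - a' * b' = b * (a - a') + a' * (b - b')" by (simp add: algebra_simps)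
  then show ?thesis using assms is_ideal_add is_ideal_mult by metis
qed

lemma is_ideal_poly_cong:
  "is_ideal K \<Longrightarrow> a - b \<in> K \<Longrightarrow> poly q a - poly q b \<in> K"
proof (induction q)
  case 0 then show ?case by (simp add: is_ideal_0)
next
  case (pCons c q)
  then have "a * poly q a - b * poly q b \<in> K" by (intro is_ideal_mult_cong)
  then show ?case by (simp add: algebra_simps)
qed

lemma is_ideal_power_cong: "is_ideal K \<Longrightarrow> a - b \<in> K \<Longrightarrow> a ^ n - b ^ n \<in> K"
  by (induction n) (auto simp: is_ideal_0 intro: is_ideal_mult_cong)

lemma is_ideal_prod_cong:
  "is_ideal K \<Longrightarrow> (\<And>i. i \<in> S \<Longrightarrow> f i - g i \<in> K) \<Longrightarrow> prod f S - prod g S \<in> K"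
  by (induction S rule: infinite_finite_induct) (auto simp: is_ideal_0 intro: is_ideal_mult_cong)

text \<open>Discrete summation: the top term of the differences is cancelled by subtracting a
  multiple of \<open>n ^ Suc N\<close>, whose difference has leading term
  \<open>Suc N * n ^ N\<close>; this is where inverses modulo \<open>K\<close> are used. The
  constant term is absent because \<open>t 0 \<in> K\<close>.\<close>

lemma polynomial_sequence_of_differences:
  fixes t e :: "nat \<Rightarrow> 'a::comm_ring_1"
  assumes "is_ideal K" and "t 0 \<in> K"
    and "\<And>n. n < M \<Longrightarrow> t (Suc n) - t n - (\<Sum>k<N. of_nat n ^ k * e k) \<in> K"
    and "\<And>k. 0 < k \<Longrightarrow> k \<le> N \<Longrightarrow> \<exists>u. of_nat k * u - 1 \<in> K"
  shows "\<exists>e'. \<forall>n\<le>M. t n - (\<Sum>k=1..N. of_nat n ^ k * e' k) \<in> K"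
  using assms(2-4)
proof (induction N arbitrary: t e)
  case 0
  have "t n \<in> K" if "n \<le> M" for n
    using that
  proof (induction n)
    case (Suc n)
    then show ?case using 0(2)[of n] is_ideal_add[OF assms(1), of "t (Suc n) - t n" "t n"] by simp
  qed (use 0 in simp)
  then show ?case by simp
next
  case (Suc N)
  obtain u where u: "of_nat (Suc N) * u - 1 \<in> K" using Suc.prems(3)[of "Suc N"] by auto
  define t' where "t' n = t n - of_nat n ^ Suc N * (u * e N)" for n
  \<comment> \<open>By the binomial theorem these are the coefficients of the differences of
    \<open>t'\<close>, now of degree below \<open>N\<close>.\<close>
  define e1 where "e1 k = e k - of_nat (Suc N choose k) * (u * e N)" for k
  have "\<exists>e'. \<forall>n\<le>M. t' n - (\<Sum>k=1..N. of_nat n ^ k * e' k) \<in> K"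
  proof (rule Suc.IH)
    show "t' 0 \<in> K" using Suc.prems(1) by (simp add: t'_def)
    fix n assume n: "n < M"
    have "(of_nat (Suc n) :: 'a) ^ Suc N = (\<Sum>k\<le>Suc N. of_nat (Suc N choose k) * of_nat n ^ k)"
      using binomial_ring[of "of_nat n :: 'a" 1 "Suc N"] by (simp add: add.commute)
    also have "\<dots> = (\<Sum>k<N. of_nat (Suc N choose k) * of_nat n ^ k) + of_nat (Suc N) * of_nat n ^ N
        + of_nat n ^ Suc N"
      unfolding lessThan_Suc_atMost[symmetric] by (simp del: of_nat_Suc One_nat_def)
    finally have pow: "(of_nat (Suc n) :: 'a) ^ Suc N - of_nat n ^ Suc N
      = (\<Sum>k<N. of_nat (Suc N choose k) * of_nat n ^ k) + of_nat (Suc N) * of_nat n ^ N" by simp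
    have "t' (Suc n) - t' n - (\<Sum>k<N. of_nat n ^ k * e1 k)
      = t (Suc n) - t n - ((of_nat (Suc n)) ^ Suc N - of_nat n ^ Suc N) * (u * e N)
        - (\<Sum>k<N. of_nat n ^ k * e1 k)"
      by (simp add: t'_def algebra_simps)
    also have "\<dots> = (t (Suc n) - t n - (\<Sum>k<Suc N. of_nat n ^ k * e k))
      - (of_nat n ^ N * e N) * (of_nat (Suc N) * u - 1)"
      unfolding pow by (simp add: e1_def sum_subtractf sum_distrib_right right_diff_distrib
          left_diff_distrib distrib_right mult_ac del: of_nat_Suc)
        (simp add: sum_distrib_left distrib_left mult_ac del: of_nat_Suc)
    also have "\<dots> \<in> K"
      by (rule is_ideal_diff[OF assms(1) Suc.prems(2)[OF n] is_ideal_mult[OF assms(1) u]])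
    finally show "t' (Suc n) - t' n - (\<Sum>k<N. of_nat n ^ k * e1 k) \<in> K" .
  qed (use Suc.prems(3) in auto)
  then obtain e' where e': "\<And>n. n \<le> M \<Longrightarrow> t' n - (\<Sum>k=1..N. of_nat n ^ k * e' k) \<in> K" by blast
  have eq: "t n - (\<Sum>k=1..Suc N. of_nat n ^ k * (e'(Suc N := u * e N)) k)
    = t' n - (\<Sum>k=1..N. of_nat n ^ k * e' k)" for n
  proof -
    have "(\<Sum>k=1..N. of_nat n ^ k * (e'(Suc N := u * e N)) k) = (\<Sum>k=1..N. of_nat n ^ k * e' k)"
      by (intro sum.cong) auto
    then show ?thesis by (simp add: t'_def)
  qed
  then have "\<forall>n\<le>M. t n - (\<Sum>k=1..Suc N. of_nat n ^ k * (e'(Suc N := u * e N)) k) \<in> K"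
    unfolding eq using e' by blast
  then show ?case by blast
qed

text \<open>A functional on sequences that sees only the linear term of \<open>\<Sum>k\<le>N. n^k e\<^sub>k\<close>:
  it samples at powers of two, with the coefficients of \<open>\<Prod>m=2..N. (x - 2^m)\<close>.\<close>
lemma linear_part_weights:
  fixes p :: int
  assumes "prime p" "2 ^ N < p" "0 < N"
  obtains \<mu> :: "nat \<Rightarrow> int" where
    "\<And>k. 2 \<le> k \<Longrightarrow> k \<le> N \<Longrightarrow> (\<Sum>i<N. \<mu> i * (2 ^ i) ^ k) = 0"
    "p dvd (\<Sum>i<N. \<mu> i * 2 ^ i) - 1"
proof -
  define P :: "int poly" where "P = (\<Prod>m=2..N. [:- (2 ^ m), 1:])"
  have "degree P \<le> (\<Sum>m=2..N. degree [:- (2 ^ m :: int), 1:])"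
    unfolding P_def using degree_prod_sum_le[of "{2..N}" "\<lambda>m. [:- (2 ^ m :: int), 1:]"] by (simp add: o_def)
  also have "\<dots> < N" using assms(3) by simp
  finally have deg: "degree P < N" .
  have eval: "poly P x = (\<Sum>i<N. coeff P i * x ^ i)" for x
    unfolding poly_altdef using deg
    by (intro sum.mono_neutral_left) (auto simp: coeff_eq_0)
  \<comment> \<open>Each factor \<open>2 - 2 ^ m\<close> is nonzero and of absolute value below
    \<open>p\<close>, so \<open>poly P 2\<close> is a unit modulo \<open>p\<close>.\<close>
  have "\<not> p dvd poly P 2"
  proof
    assume "p dvd poly P 2"
    then have "p dvd (\<Prod>m=2..N. 2 - 2 ^ m)" by (simp add: P_def poly_prod)
    then obtain m where m: "2 \<le> m" "m \<le> N" "p dvd 2 - 2 ^ m"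
      using assms(1) by (auto simp: prime_dvd_prod_iff)
    have "(4::int) \<le> 2 ^ m" using power_increasing[of 2 m "2::int"] m by simp
    moreover have "(2::int) ^ m \<le> 2 ^ N" using m by (intro power_increasing) auto
    moreover have "p dvd 2 ^ m - 2" using m(3) by (simp add: dvd_diff_commute)
    then have "2 ^ m - 2 \<le> (0::int) \<or> p \<le> 2 ^ m - 2" using zdvd_imp_le[of p "2 ^ m - 2"] by linarith
    ultimately show False using assms(2) by linarith
  qed
  then have "coprime p (poly P 2)" using assms(1) by (simp add: prime_imp_coprime)
  then obtain a b where ab: "a * p + b * poly P 2 = 1"
    by (metis bezout_int coprime_imp_gcd_eq_1)
  show ?thesis
  \<comment> \<open>Weighting the samples at \<open>2 ^ i\<close> by \<open>coeff P i\<close> turns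
    the \<open>k\<close>-th power into \<open>poly P (2 ^ k)\<close>: this is 0 for \<open>k\<close>
    from 2 to \<open>N\<close> and a unit for \<open>k = 1\<close>, which \<open>b\<close>
    normalises.\<close>
  proof (rule that[of "\<lambda>i. b * coeff P i"])
    fix k assume k: "2 \<le> k" "k \<le> N"
    have "(\<Sum>i<N. b * coeff P i * (2 ^ i) ^ k) = b * poly P (2 ^ k)"
      by (simp add: eval sum_distrib_left mult.assoc power_mult[symmetric] mult.commute[of _ k])
    also have "poly P (2 ^ k) = 0" using k by (auto simp: P_def poly_prod)
    finally show "(\<Sum>i<N. b * coeff P i * (2 ^ i) ^ k) = 0" by simp
  next
    have "(\<Sum>i<N. b * coeff P i * 2 ^ i) - 1 = p * (- a)"
      using ab by (simp add: eval sum_distrib_left mult.assoc algebra_simps)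
    then show "p dvd (\<Sum>i<N. b * coeff P i * 2 ^ i) - 1" by simp
  qed
qed

section \<open>Families of linear forms modulo an ideal\<close>

text \<open>\<open>I\<close> plays the role of the ideal generated by \<open>p\<close> and the quadratic form, \<open>Lam\<close> sends a
  vector \<open>h\<close> to the linear form with coefficients \<open>h A\<close>, \<open>Z\<close> is the group of vectors that vanish
  modulo \<open>p\<close>, and \<open>hc n\<close> extracts the homogeneous component of degree \<open>n\<close>.\<close>
locale linear_forms = Modules.module sc
  for sc :: "int \<Rightarrow> 'v::ab_group_add \<Rightarrow> 'v" (infixr "*s" 75) +
  fixes p :: int and I :: "'a::comm_ring_1 set" and Lam :: "'v \<Rightarrow> 'a" and Z :: "'v set"
    and hc :: "nat \<Rightarrow> 'a \<Rightarrow> 'a"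
  assumes prime_p: "prime p"
    and ideal_I: "is_ideal I"
    and p_in_I: "of_int p \<in> I"
    and Lam_add: "Lam (u + v) = Lam u + Lam v"
    and Z_add: "u \<in> Z \<Longrightarrow> v \<in> Z \<Longrightarrow> u + v \<in> Z"
    and Z_scale: "u \<in> Z \<Longrightarrow> k *s u \<in> Z"
    and Z_p: "p *s u \<in> Z"
    and hc_add: "hc n (f + g) = hc n f + hc n g"
    and hc_hc: "hc n (hc n f) = hc n f"
    and hc_I: "f \<in> I \<Longrightarrow> hc n f \<in> I"
    and hc_Lam_0: "hc 0 (Lam u * f) = 0"
    and hc_Lam_Suc: "hc (Suc n) (Lam u * f) = Lam u * hc n f"
begin

lemma Lam_0 [simp]: "Lam 0 = 0"
  using Lam_add[of 0 0] by simp

lemma Lam_uminus: "Lam (- u) = - Lam u"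
  using Lam_add[of u "-u"] by (simp add: eq_neg_iff_add_eq_0 add.commute)

lemma Lam_diff: "Lam (u - v) = Lam u - Lam v"
  using Lam_add[of u "-v"] by (simp add: Lam_uminus)

lemma Lam_scale_nat: "Lam (int n *s u) = of_nat n * Lam u"
  by (induction n) (auto simp: scale_left_distrib Lam_add algebra_simps)

lemma Lam_scale: "Lam (n *s u) = of_int n * Lam u"
proof (cases "n \<ge> 0")
  case True
  then show ?thesis using Lam_scale_nat[of "nat n" u] by simp
next
  case False
  then have "n *s u = - (int (nat (- n)) *s u)" by (simp flip: scale_minus_left)
  then show ?thesis using False by (simp only: Lam_uminus Lam_scale_nat) simp
qed

lemma hc_0 [simp]: "hc n 0 = 0"
  using hc_add[of n 0 0] by simp

lemma hc_uminus: "hc n (- f) = - hc n f"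
  using hc_add[of n f "-f"] by (simp add: eq_neg_iff_add_eq_0 add.commute)

lemma hc_diff: "hc n (f - g) = hc n f - hc n g"
  using hc_add[of n f "-g"] by (simp add: hc_uminus)

lemma hc_sum: "hc n (sum f S) = (\<Sum>i\<in>S. hc n (f i))"
  by (induction S rule: infinite_finite_induct) (auto simp: hc_add)

lemma hc_of_nat: "hc n (of_nat k * f) = of_nat k * hc n f"
  by (induction k) (auto simp: hc_add algebra_simps)

lemma hc_of_int: "hc n (of_int k * f) = of_int k * hc n f"
proof (cases "k \<ge> 0")
  case True
  then show ?thesis using hc_of_nat[of n "nat k" f] by simp
next
  case False
  then show ?thesis using hc_of_nat[of n "nat (-k)" f] by (simp add: hc_uminus)
qed

section \<open>Ideals generated by lists of linear forms\<close>

text \<open>The ideal generated by \<open>I\<close> and the forms of the list. A list lets one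
  generator at a time be split off; by \<open>J_mono\<close> only the generated ideal
  matters.\<close>

primrec J :: "'v list \<Rightarrow> 'a set" where
  "J [] = I"
| "J (u # us) = {Lam u * a + g | a g. g \<in> J us}"

lemma ideal_J [intro, simp]: "is_ideal (J us)"
proof (induction us)
  case Nil then show ?case by (simp add: ideal_I)
next
  case (Cons u us)
  show ?case
  proof (rule is_idealI)
    have "0 = Lam u * 0 + 0" by simp
    then show "0 \<in> J (u # us)" using is_ideal_0[OF Cons] unfolding J.simps by blast
  next
    fix f g assume "f \<in> J (u # us)" "g \<in> J (u # us)"
    then obtain a b a' b' where "f = Lam u * a + b" "g = Lam u * a' + b'" "b \<in> J us" "b' \<in> J us"
      by auto
    then have "f + g = Lam u * (a + a') + (b + b')" "b + b' \<in> J us"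
      using is_ideal_add[OF Cons] by (auto simp: algebra_simps)
    then show "f + g \<in> J (u # us)" by auto
  next
    fix c f assume "f \<in> J (u # us)"
    then obtain a b where "f = Lam u * a + b" "b \<in> J us"
      by auto
    then have "c * f = Lam u * (c * a) + (c * b)" "c * b \<in> J us"
      using is_ideal_mult[OF Cons] by (auto simp: algebra_simps)
    then show "c * f \<in> J (u # us)" by auto
  qed
qed

lemmas J_closed = is_ideal_closed[OF ideal_J]

declare J.simps(2) [simp del]

lemma J_ConsI: "g \<in> J us \<Longrightarrow> f = Lam u * a + g \<Longrightarrow> f \<in> J (u # us)"
  by (auto simp: J.simps(2))

lemma J_ConsE:
  assumes "f \<in> J (u # us)" obtains a g where "f = Lam u * a + g" "g \<in> J us"
  using assms by (auto simp: J.simps(2))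

lemma J_tail: "f \<in> J us \<Longrightarrow> f \<in> J (u # us)"
  by (erule J_ConsI[where a = 0]) simp

lemma I_subset_J: "f \<in> I \<Longrightarrow> f \<in> J us"
  by (induction us) (auto intro: J_tail)

lemma Lam_in_J: "u \<in> set us \<Longrightarrow> Lam u \<in> J us"
proof (induction us)
  case (Cons v us)
  have "Lam v \<in> J (v # us)" by (rule J_ConsI[OF is_ideal_0[OF ideal_J], where a = 1]) simp
  then show ?case using Cons by (auto intro: J_tail)
qed simp

lemma Lam_mult_in_J: "Lam u * f \<in> J (u # us)"
  by (rule is_ideal_mult2[OF ideal_J], rule Lam_in_J) simp

lemma J_least:
  assumes "is_ideal K" "I \<subseteq> K" "\<And>u. u \<in> set us \<Longrightarrow> Lam u \<in> K" "f \<in> J us"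
  shows "f \<in> K"
  using assms(3,4)
proof (induction us arbitrary: f)
  case Nil then show ?case using assms(2) by auto
next
  case (Cons u us)
  then obtain a g where "f = Lam u * a + g" "g \<in> J us" by (auto elim: J_ConsE)
  moreover have "Lam u \<in> K" "g \<in> K" using Cons \<open>g \<in> J us\<close> by auto
  ultimately show ?case using assms(1) by (auto intro!: is_ideal_closed)
qed

lemma J_mono: "f \<in> J us \<Longrightarrow> (\<And>u. u \<in> set us \<Longrightarrow> Lam u \<in> J vs) \<Longrightarrow> f \<in> J vs"
  by (rule J_least[of "J vs" us]) (auto intro: I_subset_J)

lemma J_swap: "f \<in> J [u, v] \<Longrightarrow> f \<in> J [v, u]"
  by (rule J_mono) (auto intro: Lam_in_J)

lemma hc_J: "f \<in> J us \<Longrightarrow> hc n f \<in> J us"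
proof (induction us arbitrary: f)
  case Nil then show ?case by (simp add: hc_I)
next
  case (Cons u us)
  then obtain a g where "f = Lam u * a + g" "g \<in> J us" by (auto elim: J_ConsE)
  then have "hc n f = Lam u * (case n of 0 \<Rightarrow> 0 | Suc m \<Rightarrow> hc m a) + hc n g" "hc n g \<in> J us"
    using Cons.IH by (cases n; simp add: hc_add hc_Lam_0 hc_Lam_Suc)+
  then show ?case by (auto intro: J_ConsI)
qed

text \<open>Every factor \<open>Lam (w i)\<close> shifts degrees up by one.\<close>

lemma hc_prod_Lam:
  "finite S \<Longrightarrow> n < card S \<Longrightarrow> hc n ((\<Prod>i\<in>S. Lam (w i)) * q) = 0"
proof (induction arbitrary: n rule: finite_induct)
  case (insert i S)
  then show ?case
    by (cases n) (auto simp: hc_Lam_0 hc_Lam_Suc mult.assoc)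
qed simp

section \<open>Nonzerodivisors, intersections and Chinese remainders\<close>

definition nzd :: "'v \<Rightarrow> 'v list \<Rightarrow> bool" where
  "nzd w us \<longleftrightarrow> (\<forall>f. Lam w * f \<in> J us \<longrightarrow> f \<in> J us)"

lemma nzd_prod:
  assumes "finite S" "\<And>i. i \<in> S \<Longrightarrow> nzd (w i) us" "(\<Prod>i\<in>S. Lam (w i)) * f \<in> J us"
  shows "f \<in> J us"
  using assms
proof (induction arbitrary: f rule: finite_induct)
  case (insert i S)
  then have "Lam (w i) * ((\<Prod>i\<in>S. Lam (w i)) * f) \<in> J us" by (simp add: mult.assoc)
  then show ?case using insert unfolding nzd_def by blast
qed simp

text \<open>Inductively, \<open>f\<close> is a multiple of the product over \<open>S\<close> modulo
  \<open>J us\<close>. As \<open>f\<close> also lies in \<open>J (w k # us)\<close>, the earlier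
  factors can be cancelled there, so the cofactor lies in \<open>J (w k # us)\<close> and yields the
  new factor.\<close>

lemma inter_J:
  assumes "finite S" "\<And>i. i \<in> S \<Longrightarrow> f \<in> J (w i # us)"
    and "\<And>i j. i \<in> S \<Longrightarrow> j \<in> S \<Longrightarrow> i \<noteq> j \<Longrightarrow> nzd (w j) (w i # us)"
  shows "\<exists>q. f - (\<Prod>i\<in>S. Lam (w i)) * q \<in> J us"
  using assms
proof (induction rule: finite_induct)
  case empty
  show ?case by (rule exI[of _ f]) (simp add: J_closed)
next
  case (insert k S)
  have "\<exists>q. f - (\<Prod>i\<in>S. Lam (w i)) * q \<in> J us"
    by (intro insert.IH) (use insert.prems in auto)
  then obtain q where q: "f - (\<Prod>i\<in>S. Lam (w i)) * q \<in> J us" ..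
  have "f - (f - (\<Prod>i\<in>S. Lam (w i)) * q) \<in> J (w k # us)"
    by (rule is_ideal_diff) (use insert q in \<open>auto intro: J_tail\<close>)
  then have "(\<Prod>i\<in>S. Lam (w i)) * q \<in> J (w k # us)" by simp
  then have "q \<in> J (w k # us)"
    by (rule nzd_prod[rotated 2]) (use insert in auto)
  then obtain a g where a: "q = Lam (w k) * a + g" "g \<in> J us" by (rule J_ConsE)
  have "f - (\<Prod>i\<in>insert k S. Lam (w i)) * a
      = (f - (\<Prod>i\<in>S. Lam (w i)) * q) + (\<Prod>i\<in>S. Lam (w i)) * g"
    using insert.hyps by (simp add: a algebra_simps)
  also have "\<dots> \<in> J us" by (intro is_ideal_add is_ideal_mult ideal_J q a)
  finally show ?case by blast
qed

text \<open>The degree \<open>n\<close> is smaller than the number of forms, so the multiple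
  supplied by \<open>inter_J\<close> contributes nothing in degree \<open>n\<close>.\<close>

lemma inter_J_hc:
  assumes "finite S" "\<And>i. i \<in> S \<Longrightarrow> f \<in> J (w i # us)"
    and "\<And>i j. i \<in> S \<Longrightarrow> j \<in> S \<Longrightarrow> i \<noteq> j \<Longrightarrow> nzd (w j) (w i # us)"
    and "n < card S"
  shows "hc n f \<in> J us"
proof -
  obtain q where "f - (\<Prod>i\<in>S. Lam (w i)) * q \<in> J us"
    using inter_J[of S f w us] assms(1-3) by blast
  then have "hc n (f - (\<Prod>i\<in>S. Lam (w i)) * q) \<in> J us" by (rule hc_J)
  then show ?thesis using assms by (simp add: hc_diff hc_prod_Lam)
qed

text \<open>One congruence is added at a time. The correction is a multiple of the product of the
  earlier forms, so earlier congruences survive; it exists because the discrepancy lies in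
  \<open>J [w i, w m]\<close> for every earlier \<open>i\<close>.\<close>

lemma chinese_remainder_J:
  assumes "finite S"
    and "\<And>i j. i \<in> S \<Longrightarrow> j \<in> S \<Longrightarrow> t i - t j \<in> J [w i, w j]"
    and "\<And>i j k. i \<in> S \<Longrightarrow> j \<in> S \<Longrightarrow> k \<in> S \<Longrightarrow> i \<noteq> j \<Longrightarrow> i \<noteq> k \<Longrightarrow> j \<noteq> k \<Longrightarrow> nzd (w k) [w j, w i]"
  obtains G where "\<And>i. i \<in> S \<Longrightarrow> G - t i \<in> J [w i]"
proof -
  have "\<exists>G. \<forall>i\<in>S. G - t i \<in> J [w i]"
    using assms(1-3)
  proof (induction rule: finite_induct)
    case (insert m S)
    have "\<exists>G. \<forall>i\<in>S. G - t i \<in> J [w i]" by (rule insert.IH) (use insert.prems in simp_all)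
    then obtain G where G: "\<And>i. i \<in> S \<Longrightarrow> G - t i \<in> J [w i]" by blast
    have mem: "t m - G \<in> J [w i, w m]" if "i \<in> S" for i
    proof -
      have "t m - t i \<in> J [w i, w m]" by (rule J_swap) (use insert that in auto)
      moreover have "G - t i \<in> J [w i, w m]"
        by (rule J_mono[OF G[OF that]]) (auto intro: Lam_in_J)
      ultimately have "(t m - t i) - (G - t i) \<in> J [w i, w m]" by (rule is_ideal_diff[OF ideal_J])
      then show ?thesis by simp
    qed
    have "\<exists>q. (t m - G) - (\<Prod>i\<in>S. Lam (w i)) * q \<in> J [w m]"
    proof (rule inter_J)
      show "nzd (w j) [w i, w m]" if "i \<in> S" "j \<in> S" "i \<noteq> j" for i j
        using that insert.hyps by (intro insert.prems) auto
    qed (use insert.hyps mem in auto)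
    then obtain q where q: "(t m - G) - (\<Prod>i\<in>S. Lam (w i)) * q \<in> J [w m]" by auto
    define G' where "G' = G + (\<Prod>i\<in>S. Lam (w i)) * q"
    have "G' - t m \<in> J [w m]"
      using is_ideal_uminus[OF ideal_J q] by (simp add: G'_def algebra_simps)
    moreover have "G' - t i \<in> J [w i]" if "i \<in> S" for i
    proof -
      have "(\<Prod>i\<in>S. Lam (w i)) * q = Lam (w i) * ((\<Prod>i\<in>S - {i}. Lam (w i)) * q)"
        using that insert.hyps by (simp add: prod.remove mult.assoc)
      then have "(\<Prod>i\<in>S. Lam (w i)) * q \<in> J [w i]" using Lam_mult_in_J by simp
      then have "(G - t i) + (\<Prod>i\<in>S. Lam (w i)) * q \<in> J [w i]" using G[OF that] by (rule_tac is_ideal_add[OF ideal_J])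
      then show ?thesis by (simp add: G'_def algebra_simps)
    qed
    ultimately show ?case by auto
  qed simp
  then show ?thesis using that by blast
qed

section \<open>Linear algebra modulo \<open>p\<close>\<close>

text \<open>Modulo \<open>Z\<close> the vectors form a vector space over the field with
  \<open>p\<close> elements; these sets are the preimages of its subspaces.\<close>

definition subgroup_over_Z :: "'v set \<Rightarrow> bool" where
  "subgroup_over_Z U \<longleftrightarrow> Z \<subseteq> U \<and> (\<forall>u\<in>U. \<forall>v\<in>U. u + v \<in> U) \<and> (\<forall>u\<in>U. \<forall>n. n *s u \<in> U)"

definition adjoin :: "'v set \<Rightarrow> 'v \<Rightarrow> 'v set" where
  "adjoin U u = {v. \<exists>k. v - k *s u \<in> U}"

lemma Z_0: "0 \<in> Z"
  using Z_scale[OF Z_p, of 0] by simp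

lemma Z_dvd: 
  assumes "p dvd k" shows "k *s u \<in> Z"
proof -
  from assms obtain m where "k = p * m" by (elim dvdE)
  then have "k *s u = p *s (m *s u)" by simp
  then show ?thesis using Z_p by metis
qed

lemma subgroup_Z [simp]: "subgroup_over_Z Z"
  by (auto simp: subgroup_over_Z_def Z_add Z_scale)

lemma subgroup_over_Z_closed:
  assumes "subgroup_over_Z U"
  shows "u \<in> U \<Longrightarrow> v \<in> U \<Longrightarrow> u + v \<in> U" "u \<in> U \<Longrightarrow> n *s u \<in> U" "u \<in> Z \<Longrightarrow> u \<in> U" "0 \<in> U"
  using assms Z_0 by (auto simp: subgroup_over_Z_def)

lemma subgroup_over_Z_diff:
  assumes "subgroup_over_Z U" "u \<in> U" "v \<in> U" shows "u - v \<in> U"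
  using subgroup_over_Z_closed(1)[OF assms(1,2) subgroup_over_Z_closed(2)[OF assms(1,3), of "-1"]]
  by simp

lemma adjoin_iff: "v \<in> adjoin U u \<longleftrightarrow> (\<exists>k. v - k *s u \<in> U)"
  by (simp add: adjoin_def)

lemma subgroup_adjoin [simp]:
  assumes U: "subgroup_over_Z U" shows "subgroup_over_Z (adjoin U u)"
  unfolding subgroup_over_Z_def
proof (intro conjI ballI allI subsetI)
  fix x assume "x \<in> Z"
  then show "x \<in> adjoin U u"
    unfolding adjoin_iff using subgroup_over_Z_closed(3)[OF U] by (intro exI[of _ 0]) simp
next
  fix x y assume "x \<in> adjoin U u" "y \<in> adjoin U u"
  then obtain k l where "x - k *s u \<in> U" "y - l *s u \<in> U" by (auto simp: adjoin_iff)
  from subgroup_over_Z_closed(1)[OF U this] show "x + y \<in> adjoin U u"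
    unfolding adjoin_iff by (intro exI[of _ "k + l"]) (simp add: algebra_simps)
next
  fix x n assume "x \<in> adjoin U u"
  then obtain k where "x - k *s u \<in> U" by (auto simp: adjoin_iff)
  from subgroup_over_Z_closed(2)[OF U this, of n] show "n *s x \<in> adjoin U u"
    unfolding adjoin_iff by (intro exI[of _ "n * k"]) (simp add: algebra_simps)
qed

lemma self_in_adjoin:
  assumes U: "subgroup_over_Z U" shows "u \<in> adjoin U u"
  unfolding adjoin_iff using subgroup_over_Z_closed(4)[OF U] by (intro exI[of _ 1]) simp

lemma base_in_adjoin: "x \<in> U \<Longrightarrow> x \<in> adjoin U u"
  unfolding adjoin_iff by (intro exI[of _ 0]) simp

text \<open>A scalar prime to \<open>p\<close> is inverted by Bezout, and multiples of
  \<open>p *s u\<close> lie in \<open>Z\<close>.\<close>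

lemma subgroup_cancel:
  assumes U: "subgroup_over_Z U" and "k *s u \<in> U" "\<not> p dvd k"
  shows "u \<in> U"
proof -
  have "coprime p k" using assms prime_p by (simp add: prime_imp_coprime)
  then obtain a b where "a * p + b * k = 1" by (metis bezout_int coprime_imp_gcd_eq_1)
  then have "u = a *s (p *s u) + b *s (k *s u)" by (simp flip: scale_left_distrib)
  also have "\<dots> \<in> U" by (intro subgroup_over_Z_closed[OF U] Z_p assms)
  finally show ?thesis .
qed

text \<open>Linear independence in the quotient by \<open>U\<close>; integer coefficients count only
  modulo \<open>p\<close>.\<close>

definition indep :: "'v set \<Rightarrow> 'v set \<Rightarrow> bool" where
  "indep S U \<longleftrightarrow> finite S \<and> (\<forall>c. (\<Sum>v\<in>S. c v *s v) \<in> U \<longrightarrow> (\<forall>v\<in>S. p dvd c v))"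

lemma indepD: "indep S U \<Longrightarrow> (\<Sum>v\<in>S. c v *s v) \<in> U \<Longrightarrow> v \<in> S \<Longrightarrow> p dvd c v"
  by (auto simp: indep_def)

lemma indep_subset:
  assumes "indep S U" "T \<subseteq> S" shows "indep T U"
  unfolding indep_def
proof (intro conjI allI impI ballI)
  have S: "finite S" using assms by (auto simp: indep_def)
  then show "finite T" using assms finite_subset by blast
  fix c v assume c: "(\<Sum>v\<in>T. c v *s v) \<in> U" and v: "v \<in> T"
  have "(\<Sum>v\<in>S. (if v \<in> T then c v else 0) *s v) = (\<Sum>v\<in>T. c v *s v)"
    using S assms(2) by (intro sum.mono_neutral_cong_right) auto
  then have "p dvd (if v \<in> T then c v else 0)"
    using assms c v by (intro indepD[OF assms(1), of "\<lambda>v. if v \<in> T then c v else 0"]) auto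
  then show "p dvd c v" using v by simp
qed

lemma indep_insertD:
  assumes "indep (insert t S) U" "t \<notin> S" shows "indep S (adjoin U t)"
  unfolding indep_def
proof (intro conjI allI impI ballI)
  show S: "finite S" using assms by (auto simp: indep_def)
  fix c v assume "(\<Sum>v\<in>S. c v *s v) \<in> adjoin U t" and v: "v \<in> S"
  then obtain k where k: "(\<Sum>v\<in>S. c v *s v) - k *s t \<in> U" by (auto simp: adjoin_iff)
  have "(\<Sum>v\<in>insert t S. (c(t := - k)) v *s v) = (\<Sum>v\<in>S. c v *s v) - k *s t"
    using S assms(2) by (simp add: algebra_simps) (intro sum.cong, auto)
  then have "p dvd (c(t := - k)) v"
    using k v by (intro indepD[OF assms(1)]) auto
  moreover have "v \<noteq> t" using assms(2) v by auto
  ultimately show "p dvd c v" by simp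
qed

text \<open>Steinitz exchange: enlarging \<open>U\<close> by one vector costs at most one element of
  \<open>S\<close>, namely one with nonzero coefficient in a relation that involves
  \<open>u\<close>.\<close>

lemma indep_exchange:
  assumes U: "subgroup_over_Z U" and S: "indep S U"
  obtains t where "indep (S - {t}) (adjoin U u)"
proof (cases "indep S (adjoin U u)")
  case True
  then show ?thesis using that indep_subset by blast
next
  case False
  have fin: "finite S" using S by (simp add: indep_def)
  then obtain c t k where c: "(\<Sum>v\<in>S. c v *s v) - k *s u \<in> U" and t: "t \<in> S" "\<not> p dvd c t"
    using False unfolding indep_def adjoin_iff by auto
  have k: "\<not> p dvd k"
  proof
    assume "p dvd k"
    then have "k *s u \<in> U" by (rule subgroup_over_Z_closed(3)[OF U Z_dvd])
    from subgroup_over_Z_closed(1)[OF U c this] have "(\<Sum>v\<in>S. c v *s v) \<in> U" by simp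
    then show False using indepD[OF S _ t(1)] t(2) by blast
  qed
  have "indep (S - {t}) (adjoin U u)"
    unfolding indep_def
  proof (intro conjI allI impI ballI)
    show "finite (S - {t})" using fin by simp
    fix c' v assume "(\<Sum>v\<in>S - {t}. c' v *s v) \<in> adjoin U u" and v: "v \<in> S - {t}"
    then obtain k' where k': "(\<Sum>v\<in>S - {t}. c' v *s v) - k' *s u \<in> U" by (auto simp: adjoin_iff)
    have c'_sum: "(\<Sum>v\<in>S. (c'(t := 0)) v *s v) = (\<Sum>v\<in>S - {t}. c' v *s v)"
      using fin by (intro sum.mono_neutral_cong_right) auto
    \<comment> \<open>Combining the two relations eliminates \<open>u\<close>. The relation for
      \<open>c'\<close> has coefficient 0 at \<open>t\<close>, so comparing coefficients at
      \<open>t\<close> first gives \<open>p dvd k'\<close>.\<close>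
    have "(\<Sum>v\<in>S. (k * (c'(t := 0)) v - k' * c v) *s v)
      = k *s (\<Sum>v\<in>S. (c'(t := 0)) v *s v) - k' *s (\<Sum>v\<in>S. c v *s v)"
      by (simp add: scale_left_diff_distrib sum_subtractf scale_sum_right del: fun_upd_apply)
    also have "\<dots> = k *s ((\<Sum>v\<in>S - {t}. c' v *s v) - k' *s u) - k' *s ((\<Sum>v\<in>S. c v *s v) - k *s u)"
      unfolding c'_sum by (simp add: scale_right_diff_distrib mult.commute)
    also have "\<dots> \<in> U"
      
      by (rule subgroup_over_Z_diff[OF U subgroup_over_Z_closed(2)[OF U k'] subgroup_over_Z_closed(2)[OF U c]])
    finally have *: "p dvd k * (c'(t := 0)) v - k' * c v" if "v \<in> S" for v
      using that by (rule indepD[OF S])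
    from *[OF t(1)] have "p dvd k'" using t prime_p by (simp add: prime_dvd_mult_iff)
    then have "p dvd k' * c v" by simp
    moreover have "p dvd k * c' v - k' * c v" using *[of v] v by simp
    ultimately have "p dvd (k * c' v - k' * c v) + k' * c v" by (intro dvd_add)
    then have "p dvd k * c' v" by simp
    then show "p dvd c' v" using k prime_p by (simp add: prime_dvd_mult_iff)
  qed
  then show ?thesis using that by blast
qed

lemma indep_pair:
  assumes "indep S U" "v \<in> S" "w \<in> S" "v \<noteq> w" "a *s v + b *s w \<in> U"
  shows "p dvd a \<and> p dvd b"
proof -
  have ind: "indep {v, w} U" using assms by (intro indep_subset[OF assms(1)]) auto
  have "(\<Sum>x\<in>{v, w}. (if x = v then a else b) *s x) \<in> U" using assms by simp
  from indepD[OF ind this, of v] indepD[OF ind this, of w] show ?thesis using assms(4) by simp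
qed

lemma indep_triple:
  assumes "indep S U" "u \<in> S" "v \<in> S" "w \<in> S" "u \<noteq> v" "u \<noteq> w" "v \<noteq> w"
    and "a *s u + b *s v + c *s w \<in> U"
  shows "p dvd a \<and> p dvd b \<and> p dvd c"
proof -
  have ind: "indep {u, v, w} U" using assms by (intro indep_subset[OF assms(1)]) auto
  have "(\<Sum>x\<in>{u, v, w}. (if x = u then a else if x = v then b else c) *s x) \<in> U"
    using assms by (simp add: add.assoc)
  from indepD[OF ind this, of u] indepD[OF ind this, of v] indepD[OF ind this, of w]
  show ?thesis using assms(5-7) by simp
qed

end

text \<open>Independence of two or three vectors has to make the last form regular modulo the ideal
  of the others, which is what intersections and Chinese remainders consume.\<close>

locale regular_linear_forms = linear_forms sc p I Lam Z hc
  for sc :: "int \<Rightarrow> 'v::ab_group_add \<Rightarrow> 'v" (infixr "*s" 75)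
    and p and I :: "'a::comm_ring_1 set" and Lam Z hc +
  assumes nzd_one: "\<lbrakk>\<And>a b. a *s u + b *s w \<in> Z \<Longrightarrow> p dvd a \<and> p dvd b\<rbrakk> \<Longrightarrow> nzd w [u]"
    and nzd_two: "\<lbrakk>\<And>a b c. a *s u + b *s v + c *s w \<in> Z \<Longrightarrow> p dvd a \<and> p dvd b \<and> p dvd c\<rbrakk>
      \<Longrightarrow> nzd w [u, v]"
begin

text \<open>A relation between differences \<open>h - i\<close> is a relation between the points
  \<open>i\<close> modulo \<open>h\<close>.\<close>

lemma nzd_shift_one:
  assumes "indep S (adjoin Z h)" "i \<in> S" "j \<in> S" "i \<noteq> j"
  shows "nzd (h - j) [h - i]"
proof (rule nzd_one)
  fix a b assume *: "a *s (h - i) + b *s (h - j) \<in> Z"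
  have "((-a) *s i + (-b) *s j) - (-(a + b)) *s h = a *s (h - i) + b *s (h - j)"
    by (simp add: algebra_simps)
  with * have "(-a) *s i + (-b) *s j \<in> adjoin Z h" unfolding adjoin_iff by metis
  from indep_pair[OF assms this] show "p dvd a \<and> p dvd b" by simp
qed

lemma nzd_shift_two:
  assumes "indep S (adjoin Z h)" "i \<in> S" "j \<in> S" "k \<in> S" "i \<noteq> j" "i \<noteq> k" "j \<noteq> k"
  shows "nzd (h - k) [h - j, h - i]"
proof (rule nzd_two)
  fix a b c assume *: "a *s (h - j) + b *s (h - i) + c *s (h - k) \<in> Z"
  have "((-b) *s i + (-a) *s j + (-c) *s k) - (-(a + b + c)) *s h
    = a *s (h - j) + b *s (h - i) + c *s (h - k)"
    by (simp add: algebra_simps)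
  with * have "(-b) *s i + (-a) *s j + (-c) *s k \<in> adjoin Z h" unfolding adjoin_iff by metis
  from indep_triple[OF assms this] show "p dvd a \<and> p dvd b \<and> p dvd c" by simp
qed

text \<open>Modulo \<open>h\<close> and \<open>h'\<close> a relation involves only \<open>i\<close>
  and \<open>j\<close>, which kills \<open>a\<close> and \<open>c\<close>; what remains is a
  multiple of \<open>h - h'\<close>, a vector outside \<open>Z\<close>.\<close>

lemma nzd_shift_mod:
  assumes "indep S (adjoin (adjoin Z h) h')" "i \<in> S" "j \<in> S" "i \<noteq> j" "h - h' \<notin> Z"
  shows "nzd (h - j) [h - i, h - h']"
proof (rule nzd_two)
  fix a b c assume *: "a *s (h - i) + b *s (h - h') + c *s (h - j) \<in> Z"
  have "((-a) *s i + (-c) *s j) - b *s h' - (-(a + b + c)) *s h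
    = a *s (h - i) + b *s (h - h') + c *s (h - j)"
    by (simp add: algebra_simps)
  with * have "(-a) *s i + (-c) *s j \<in> adjoin (adjoin Z h) h'" unfolding adjoin_iff by metis
  from indep_pair[OF assms(1-4) this] have ac: "p dvd a" "p dvd c" by simp_all
  have "a *s (h - i) + b *s (h - h') + c *s (h - j) - a *s (h - i) - c *s (h - j) \<in> Z"
    
    by (rule subgroup_over_Z_diff[OF subgroup_Z subgroup_over_Z_diff[OF subgroup_Z * Z_dvd[OF ac(1)]] Z_dvd[OF ac(2)]])
  then have "b *s (h - h') \<in> Z" by simp
  then have "p dvd b" using subgroup_cancel[OF subgroup_Z] assms(5) by blast
  with ac show "p dvd a \<and> p dvd b \<and> p dvd c" by simp
qed

text \<open>The two vectors are independent because the determinant of their coefficients,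
  \<open>k - l\<close> up to sign, is prime to \<open>p\<close>.\<close>

lemma nzd_line:
  assumes "indep {a, b} Z" "a \<noteq> b" "\<not> p dvd k - l"
  shows "nzd (a - l *s b) [a - k *s b]"
proof (rule nzd_one)
  fix x y assume "x *s (a - k *s b) + y *s (a - l *s b) \<in> Z"
  also have "x *s (a - k *s b) + y *s (a - l *s b) = (x + y) *s a + (- (x * k + y * l)) *s b"
    by (simp add: algebra_simps)
  finally have "p dvd x + y \<and> p dvd - (x * k + y * l)"
    using assms by (intro indep_pair[OF assms(1)]) auto
  then have *: "p dvd x + y" "p dvd x * k + y * l" unfolding dvd_minus_iff by blast+
  have "x * (k - l) = (x * k + y * l) - l * (x + y)" by (simp add: algebra_simps)
  with * have "p dvd x * (k - l)" by (metis dvd_diff dvd_mult)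
  with assms(3) prime_p have "p dvd x" by (simp add: prime_dvd_mult_iff)
  with * show "p dvd x \<and> p dvd y" by (simp add: dvd_add_right_iff)
qed

end

section \<open>Additive cocycles\<close>

text \<open>\<open>B m\<close> is the \<open>m\<close>-th dilate of a small progression, and
  \<open>B (4 * q)\<close> the full one, where properness and the cocycle identity hold. Of the
  \<open>s + 5\<close> base vectors at most four are discarded in any one argument, leaving the
  \<open>s + 1\<close> that degree \<open>s\<close> demands. The size of \<open>q\<close> leaves
  room for multiplying vectors of \<open>B (4 * (s + 2))\<close> by \<open>2 ^ i\<close> with
  \<open>i < s + 5\<close>.\<close>

locale cocycle = regular_linear_forms sc p I Lam Z hc
  for sc :: "int \<Rightarrow> 'v::ab_group_add \<Rightarrow> 'v" (infixr "*s" 75)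
    and p and I :: "'a::comm_ring_1 set" and Lam Z hc +
  fixes B :: "nat \<Rightarrow> 'v set" and q s :: nat and X :: "'v \<Rightarrow> 'a" and E :: "'v set"
  assumes B_0: "0 \<in> B m"
    and B_add: "u \<in> B m \<Longrightarrow> v \<in> B n \<Longrightarrow> u + v \<in> B (m + n)"
    and B_uminus: "u \<in> B m \<Longrightarrow> - u \<in> B m"
    and B_mono: "m \<le> n \<Longrightarrow> B m \<subseteq> B n"
    and B_proper: "u \<in> B (4 * q) \<Longrightarrow> u \<in> Z \<Longrightarrow> u = 0"
    and X_0: "X 0 = 0"
    and X_hc: "hc s (X u) = X u"
    and X_add: "\<lbrakk>u \<in> B (4 * q); v \<in> B (4 * q); u + v \<in> B (4 * q)\<rbrakk>
      \<Longrightarrow> X (u + v) - X u - X v \<in> J [u, v]"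
    and E_B: "E \<subseteq> B 1"
    and E_indep: "indep E Z"
    and card_E: "card E = s + 5"
    and q_def: "q = 4 * (s + 2) * 2 ^ (s + 5)"
    and p_large: "2 ^ (s + 5) < p"
begin

lemma B_diff: "u \<in> B m \<Longrightarrow> v \<in> B n \<Longrightarrow> u - v \<in> B (m + n)"
  using B_add[OF _ B_uminus] by fastforce

lemma B_scale: "u \<in> B m \<Longrightarrow> int n *s u \<in> B (n * m)"
proof (induction n)
  case (Suc n)
  then show ?case using B_add[of u m "int n *s u" "n * m"] by (simp add: scale_left_distrib)
qed (simp add: B_0)

lemma B_le: "u \<in> B m \<Longrightarrow> m \<le> n \<Longrightarrow> u \<in> B n"
  using B_mono by blast

lemma Lam_diff_in_J: "Lam u \<in> J vs \<Longrightarrow> Lam v \<in> J vs \<Longrightarrow> Lam (u - v) \<in> J vs"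
  unfolding Lam_diff by (rule J_closed)

lemma J_mono_single: "f \<in> J [u] \<Longrightarrow> Lam u \<in> J vs \<Longrightarrow> f \<in> J vs"
  by (rule J_mono) auto

lemma J_mono_pair: "f \<in> J [u, v] \<Longrightarrow> Lam u \<in> J vs \<Longrightarrow> Lam v \<in> J vs \<Longrightarrow> f \<in> J vs"
  by (rule J_mono) auto

lemma X_uminus:
  assumes "u \<in> B (4 * q)" shows "X (- u) + X u \<in> J [u]"
proof -
  have "X (u + - u) - X u - X (- u) \<in> J [u, -u]"
    using assms by (intro X_add B_uminus) (auto simp: B_0)
  then have "X (u + - u) - X u - X (- u) \<in> J [u]"
    by (rule J_mono_pair) (auto simp: Lam_uminus intro!: Lam_in_J is_ideal_uminus[OF ideal_J])
  from is_ideal_uminus[OF ideal_J this] show ?thesis by (simp add: X_0 algebra_simps)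
qed

text \<open>Repeated addition of \<open>u\<close>: each ideal \<open>J [int n *s u, u]\<close> that
  occurs lies in \<open>J [u]\<close>.\<close>

lemma X_scale:
  assumes "u \<in> B m" "n * m \<le> 4 * q" shows "X (int n *s u) - of_nat n * X u \<in> J [u]"
  using assms(2)
proof (induction n)
  case 0
  then show ?case by (simp add: X_0 is_ideal_0 del: J.simps)
next
  case (Suc n)
  have eq: "int (Suc n) *s u = int n *s u + u" by (simp add: scale_left_distrib)
  have "X (int n *s u + u) - X (int n *s u) - X u \<in> J [int n *s u, u]"
  proof (rule X_add)
    show "int n *s u \<in> B (4 * q)" using B_scale[OF assms(1), of n] Suc.prems by (auto elim: B_le)
    show "u \<in> B (4 * q)" using assms(1) Suc.prems by (auto elim: B_le)
    show "int n *s u + u \<in> B (4 * q)"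
      using B_scale[OF assms(1), of "Suc n"] Suc.prems unfolding eq by (auto elim: B_le)
  qed
  then have "X (int n *s u + u) - X (int n *s u) - X u \<in> J [u]"
    by (rule J_mono_pair) (auto simp: Lam_scale intro!: Lam_in_J is_ideal_mult[OF ideal_J])
  from is_ideal_add[OF ideal_J this Suc.IH] Suc.prems show ?case
    unfolding eq by (simp add: algebra_simps)
qed

section \<open>Maps with prescribed increments\<close>

text \<open>\<open>T\<close> acts as a discrete primitive of \<open>X\<close>, its increment from
  \<open>h'\<close> to \<open>h\<close> being prescribed only modulo the ideal of
  \<open>h - h'\<close>.\<close>

definition compatible :: "('v \<Rightarrow> 'a) \<Rightarrow> 'v \<Rightarrow> 'v \<Rightarrow> bool" where
  "compatible T h h' \<longleftrightarrow> T h - T h' - X (h - h') \<in> J [h - h']"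

lemma compatible_refl [simp]: "compatible T h h"
  by (simp add: compatible_def X_0 is_ideal_0 del: J.simps)

lemma compatible_sym:
  assumes "compatible T h h'" "h - h' \<in> B (4 * q)" shows "compatible T h' h"
proof -
  have "T h - T h' - X (h - h') \<in> J [h' - h]"
    using assms(1) unfolding compatible_def
    by (rule J_mono_single) (use Lam_in_J[of "h' - h" "[h' - h]"] in \<open>auto simp: Lam_diff dest: is_ideal_uminus[OF ideal_J]\<close>)
  moreover have "X (h - h') + X (h' - h) \<in> J [h' - h]"
    using X_uminus[of "h' - h"] B_uminus[OF assms(2)] by simp
  ultimately have "(T h - T h' - X (h - h')) + (X (h - h') + X (h' - h)) \<in> J [h' - h]"
    by (rule is_ideal_add[OF ideal_J])
  from is_ideal_uminus[OF ideal_J this] show ?thesis by (simp add: compatible_def algebra_simps)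
qed

lemma X_diff_chain:
  assumes "h - i \<in> B (4 * q)" "i - j \<in> B (4 * q)" "h - j \<in> B (4 * q)"
    and "Lam (h - i) \<in> J us" "Lam (i - j) \<in> J us"
  shows "X (h - j) - X (h - i) - X (i - j) \<in> J us"
proof (rule J_mono_pair)
  show "X (h - j) - X (h - i) - X (i - j) \<in> J [h - i, i - j]"
    using X_add[of "h - i" "i - j"] assms by simp
qed fact+

text \<open>The value at \<open>h\<close> is prescribed modulo each \<open>J [h - i]\<close>. Two
  prescriptions agree modulo \<open>J [h - i, h - j]\<close>, an ideal containing
  \<open>Lam (i - j)\<close>, by compatibility on \<open>S\<close> and the cocycle identity; Chinese
  remainders solve the system.\<close>

lemma extend_compatible:
  assumes "S \<subseteq> B (2 * q)" "h \<in> B (2 * q)" "indep S (adjoin Z h)"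
    and T: "\<And>i j. i \<in> S \<Longrightarrow> j \<in> S \<Longrightarrow> compatible T i j" "\<And>i. i \<in> S \<Longrightarrow> hc s (T i) = T i"
  obtains G where "hc s G = G" "\<And>i. i \<in> S \<Longrightarrow> G - T i - X (h - i) \<in> J [h - i]"
proof -
  have B4: "u - v \<in> B (4 * q)" if "u \<in> B (2 * q)" "v \<in> B (2 * q)" for u v
    using B_diff[OF that] by simp
  have "(T i + X (h - i)) - (T j + X (h - j)) \<in> J [h - i, h - j]" if ij: "i \<in> S" "j \<in> S" for i j
  proof -
    have Lam: "Lam (h - i) \<in> J [h - i, h - j]" "Lam (h - j) \<in> J [h - i, h - j]"
      by (auto intro: Lam_in_J)
    have "Lam ((h - j) - (h - i)) \<in> J [h - i, h - j]" by (intro Lam_diff_in_J Lam)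
    then have Lam': "Lam (i - j) \<in> J [h - i, h - j]" by simp
    have "T i - T j - X (i - j) \<in> J [h - i, h - j]"
      using T(1)[OF ij] Lam' unfolding compatible_def by (rule J_mono_single)
    moreover have "X (h - j) - X (h - i) - X (i - j) \<in> J [h - i, h - j]"
      using assms(1,2) ij by (intro X_diff_chain B4 Lam Lam') auto
    ultimately have "(T i - T j - X (i - j)) - (X (h - j) - X (h - i) - X (i - j)) \<in> J [h - i, h - j]"
      by (rule is_ideal_diff[OF ideal_J])
    then show ?thesis by (simp add: algebra_simps)
  qed
  then obtain G where G: "\<And>i. i \<in> S \<Longrightarrow> G - (T i + X (h - i)) \<in> J [h - i]"
    using chinese_remainder_J[of S "\<lambda>i. T i + X (h - i)" "\<lambda>i. h - i"] nzd_shift_two[OF assms(3)]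
      assms(3) unfolding indep_def by blast
  show ?thesis
  \<comment> \<open>The data are homogeneous of degree \<open>s\<close>, so the degree
    \<open>s\<close> component of a solution is again a solution.\<close>
  proof (rule that[of "hc s G"])
    fix i assume "i \<in> S"
    then have "hc s (G - (T i + X (h - i))) \<in> J [h - i]" using G by (intro hc_J)
    then show "hc s G - T i - X (h - i) \<in> J [h - i]"
      using \<open>i \<in> S\<close> by (simp add: hc_diff hc_add X_hc T(2) algebra_simps del: J.simps)
  qed (simp add: hc_hc)
qed

lemma q_pos: "0 < q"
  by (simp add: q_def)

lemma E_finite: "finite E"
  using E_indep by (simp add: indep_def)

lemma E_B_le: "v \<in> E \<Longrightarrow> 1 \<le> m \<Longrightarrow> v \<in> B m"
  using E_B B_mono[of 1 m] by auto

text \<open>Base vectors are added one at a time; those already treated stay independent modulo the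
  new one.\<close>

lemma compatible_on_E:
  obtains T where "\<And>i j. i \<in> E \<Longrightarrow> j \<in> E \<Longrightarrow> compatible T i j" "\<And>i. i \<in> E \<Longrightarrow> hc s (T i) = T i"
proof -
  have "\<exists>T. (\<forall>i\<in>S. \<forall>j\<in>S. compatible T i j) \<and> (\<forall>i\<in>S. hc s (T i) = T i)" if "finite S" "S \<subseteq> E" for S
    using that
  proof (induction rule: finite_induct)
    case (insert m S)
    then obtain T where T: "\<And>i j. i \<in> S \<Longrightarrow> j \<in> S \<Longrightarrow> compatible T i j" "\<And>i. i \<in> S \<Longrightarrow> hc s (T i) = T i"
      by (meson insert_subset)
    have B2: "v \<in> B (2 * q)" if "v \<in> E" for v using E_B_le[OF that] q_pos by simp
    have "indep S (adjoin Z m)"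
      using indep_subset[OF E_indep insert.prems] insert.hyps(2) by (rule indep_insertD)
    then obtain G where G: "hc s G = G" "\<And>i. i \<in> S \<Longrightarrow> G - T i - X (m - i) \<in> J [m - i]"
      using extend_compatible[of S m T] T insert.prems B2 by blast
    define T' where "T' = T(m := G)"
    have T'_m: "compatible T' m i" if "i \<in> S" for i
      using G(2)[OF that] that insert.hyps unfolding compatible_def T'_def by (auto simp del: J.simps)
    have T'_m': "compatible T' i m" if "i \<in> S" for i
      using T'_m[OF that] B_diff[OF B2[of m] B2[of i]] insert.prems that by (intro compatible_sym[of T' m i]) auto
    have "compatible T' i j" if "i \<in> S" "j \<in> S" for i j
      using T(1)[OF that] that insert.hyps unfolding compatible_def T'_def by (auto simp del: J.simps)
    then have "\<forall>i\<in>insert m S. \<forall>j\<in>insert m S. compatible T' i j" using T'_m T'_m' by auto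
    moreover have "\<forall>i\<in>insert m S. hc s (T' i) = T' i" using T(2) G(1) by (auto simp: T'_def)
    ultimately show ?case by blast
  qed simp
  from this[OF E_finite] show ?thesis using that by blast
qed

lemma card_remove: "finite S \<Longrightarrow> n + 1 \<le> card S \<Longrightarrow> n \<le> card (S - {t})"
  by (cases "t \<in> S") auto

text \<open>Each \<open>h\<close> gets its value from base vectors that are independent modulo
  \<open>h\<close>. For a pair, the error lies in \<open>J [h - i, h - h']\<close> for all base
  vectors \<open>i\<close> serving both; more than \<open>s\<close> of them remain, so the degree
  \<open>s\<close> component lies in \<open>J [h - h']\<close>.\<close>

lemma compatible_exists:
  obtains T where "T 0 = 0" "\<And>h. hc s (T h) = T h"
    "\<And>h h'. h \<in> B (2 * q) \<Longrightarrow> h' \<in> B (2 * q) \<Longrightarrow> compatible T h h'"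
proof -
  obtain Tb where Tb: "\<And>i j. i \<in> E \<Longrightarrow> j \<in> E \<Longrightarrow> compatible Tb i j" "\<And>i. i \<in> E \<Longrightarrow> hc s (Tb i) = Tb i"
    using compatible_on_E by blast
  have B2: "v \<in> B (2 * q)" if "v \<in> E" for v using E_B_le[OF that] q_pos by simp
  have B4: "u - v \<in> B (4 * q)" if "u \<in> B (2 * q)" "v \<in> B (2 * q)" for u v
    using B_diff[OF that] by simp
  \<comment> \<open>The dropped base vector \<open>t\<close> depends on \<open>h\<close>; outside
    \<open>B (2 * q)\<close> the value 0 is a placeholder.\<close>
  have "\<exists>G t. hc s G = G \<and> (h \<in> B (2 * q) \<longrightarrow> (\<forall>i\<in>E - {t}. G - Tb i - X (h - i) \<in> J [h - i]))" for h
  proof (cases "h \<in> B (2 * q)")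
    case True
    obtain t where "indep (E - {t}) (adjoin Z h)" using indep_exchange[OF subgroup_Z E_indep] .
    then obtain G where "hc s G = G" "\<And>i. i \<in> E - {t} \<Longrightarrow> G - Tb i - X (h - i) \<in> J [h - i]"
      using extend_compatible[of "E - {t}" h Tb] Tb B2 True by blast
    then show ?thesis by blast
  next
    case False
    then show ?thesis by (intro exI[of _ 0]) simp
  qed
  then obtain T t where T: "\<And>h. hc s (T h) = T h"
    "\<And>h i. h \<in> B (2 * q) \<Longrightarrow> i \<in> E - {t h} \<Longrightarrow> T h - Tb i - X (h - i) \<in> J [h - i]"
    by metis
  have comp: "compatible T h h'" if h: "h \<in> B (2 * q)" "h' \<in> B (2 * q)" for h h'
  \<comment> \<open>Properness turns \<open>h - h' \<in> Z\<close> into equality; otherwise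
    \<open>h - h'\<close> extends the independent differences.\<close>
  proof (cases "h - h' \<in> Z")
    case True
    then have "h - h' = 0" using B_proper B4 h by blast
    then show ?thesis by simp
  next
    case False
    \<comment> \<open>The first two removals make both values available at the remaining base
      vectors, the other two make these independent modulo \<open>h\<close> and
      \<open>h'\<close>.\<close>
    have "indep (E - {t h} - {t h'}) Z" using E_indep by (rule indep_subset) auto
    then obtain t1 where t1: "indep (E - {t h} - {t h'} - {t1}) (adjoin Z h)"
      by (rule indep_exchange[OF subgroup_Z])
    obtain t2 where t2: "indep (E - {t h} - {t h'} - {t1} - {t2}) (adjoin (adjoin Z h) h')"
      using indep_exchange[OF _ t1, of h'] by auto
    define S where "S = E - {t h} - {t h'} - {t1} - {t2}"
    have "s + 1 \<le> card S" unfolding S_def by (intro card_remove finite_Diff E_finite) (simp add: card_E)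
    have "hc s (T h - T h' - X (h - h')) \<in> J [h - h']"
    proof (rule inter_J_hc[where S = S and w = "\<lambda>i. h - i"])
      show "finite S" by (simp add: S_def E_finite)
      show "s < card S" using \<open>s + 1 \<le> card S\<close> by simp
      show "nzd (h - j) [h - i, h - h']" if "i \<in> S" "j \<in> S" "i \<noteq> j" for i j
        using t2 that False by (intro nzd_shift_mod[of S]) (auto simp: S_def)
      fix i assume i: "i \<in> S"
      have Lam: "Lam (h - i) \<in> J [h - i, h - h']" "Lam (h - h') \<in> J [h - i, h - h']"
        by (auto intro: Lam_in_J)
      have "Lam ((h - i) - (h - h')) \<in> J [h - i, h - h']" by (intro Lam_diff_in_J Lam)
      then have Lam': "Lam (h' - i) \<in> J [h - i, h - h']" by simp
      have "T h - Tb i - X (h - i) \<in> J [h - i, h - h']"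
        by (rule J_mono_single[OF T(2)]) (use i h Lam in \<open>auto simp: S_def simp del: J.simps\<close>)
      moreover have "T h' - Tb i - X (h' - i) \<in> J [h - i, h - h']"
        by (rule J_mono_single[OF T(2)]) (use i h Lam' in \<open>auto simp: S_def simp del: J.simps\<close>)
      moreover have "X (h - i) - X (h - h') - X (h' - i) \<in> J [h - i, h - h']"
        using i h B2 by (intro X_diff_chain B4 Lam Lam') (auto simp: S_def)
      ultimately have "(T h - Tb i - X (h - i)) - (T h' - Tb i - X (h' - i))
          + (X (h - i) - X (h - h') - X (h' - i)) \<in> J [h - i, h - h']"
        by (intro is_ideal_add[OF ideal_J is_ideal_diff[OF ideal_J]])
      then show "T h - T h' - X (h - h') \<in> J [h - i, h - h']" by (simp add: algebra_simps)
    qed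
    then show ?thesis by (simp add: compatible_def hc_diff T(1) X_hc del: J.simps)
  qed
  show ?thesis
  \<comment> \<open>Subtracting a constant leaves all increments unchanged.\<close>
  proof (rule that[of "\<lambda>h. T h - T 0"])
    show "compatible (\<lambda>h. T h - T 0) h h'" if "h \<in> B (2 * q)" "h' \<in> B (2 * q)" for h h'
      using comp[OF that] by (simp add: compatible_def)
  qed (simp_all add: hc_diff T(1))
qed

section \<open>Interpolation and polynomial behaviour along lines\<close>

text \<open>The nodes are the base vectors and the variable is \<open>Lam c\<close>. Divided
  differences exist because \<open>F m - F i\<close> lies in \<open>J [m - i]\<close>, which makes
  the error at \<open>m\<close> divisible by the product of the forms of \<open>m - i\<close>. At a
  general \<open>c\<close> the error lies in more than \<open>s\<close> ideals
  \<open>J [c - i]\<close>, so its degree \<open>s\<close> component lies in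
  \<open>I\<close>.\<close>

lemma newton_interpolation:
  assumes F: "\<And>c c'. c \<in> B m \<Longrightarrow> c' \<in> B m \<Longrightarrow> F c - F c' \<in> J [c - c']" and "1 \<le> m"
  obtains P where "degree P < s + 5" "\<And>c. c \<in> B m \<Longrightarrow> hc s (F c) - hc s (poly P (Lam c)) \<in> I"
proof -
  have Bm: "v \<in> B m" if "v \<in> E" for v using E_B_le that assms(2) by blast
  have "\<exists>P. (\<forall>k\<ge>card S. coeff P k = 0) \<and> (\<forall>b\<in>S. F b - poly P (Lam b) \<in> I)" if "finite S" "S \<subseteq> E" for S
    using that
  proof (induction rule: finite_induct)
    case empty
    show ?case by (rule exI[of _ 0]) simp
  next
    case (insert m S)
    then obtain P where P: "\<And>k. k \<ge> card S \<Longrightarrow> coeff P k = 0" "\<And>b. b \<in> S \<Longrightarrow> F b - poly P (Lam b) \<in> I"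
      by (meson insert_subset)
    have ind: "indep S (adjoin Z m)"
      using indep_subset[OF E_indep insert.prems] insert.hyps(2) by (rule indep_insertD)
    have "\<exists>q. (F m - poly P (Lam m)) - (\<Prod>i\<in>S. Lam (m - i)) * q \<in> J []"
    proof (rule inter_J)
      show "nzd (m - j) [m - i]" if "i \<in> S" "j \<in> S" "i \<noteq> j" for i j
        using ind that by (rule nzd_shift_one)
      fix i assume i: "i \<in> S"
      have "F m - F i \<in> J [m - i]" using F Bm i insert.prems by auto
      moreover have "F i - poly P (Lam i) \<in> J [m - i]" using P(2)[OF i] by (rule I_subset_J)
      moreover have "poly P (Lam m) - poly P (Lam i) \<in> J [m - i]"
        by (rule is_ideal_poly_cong) (auto simp flip: Lam_diff intro: Lam_in_J)
      ultimately have "(F m - F i) + (F i - poly P (Lam i)) - (poly P (Lam m) - poly P (Lam i)) \<in> J [m - i]"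
        by (rule is_ideal_diff[OF ideal_J is_ideal_add[OF ideal_J]])
      then show "F m - poly P (Lam m) \<in> J [m - i]" by simp
    qed (use insert.hyps in simp)
    then obtain q where q: "(F m - poly P (Lam m)) - (\<Prod>i\<in>S. Lam (m - i)) * q \<in> I" by auto
    \<comment> \<open>\<open>R\<close> vanishes at the earlier nodes, so adding \<open>q\<close>
      times \<open>R\<close> corrects the value at \<open>m\<close> without disturbing
      theirs.\<close>
    define R where "R = (\<Prod>i\<in>S. [:- Lam i, 1:])"
    define P' where "P' = P + smult q R"
    have poly_R: "poly R (Lam b) = (\<Prod>i\<in>S. Lam (b - i))" for b
      by (simp add: R_def poly_prod Lam_diff)
    have "degree R \<le> (\<Sum>i\<in>S. degree [:- Lam i, 1:])"
      unfolding R_def using degree_prod_sum_le[of S "\<lambda>i. [:- Lam i, 1:]"] insert.hyps by (simp add: o_def)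
    then have "degree R \<le> card S" by simp
    then have "coeff P' k = 0" if "k \<ge> card (insert m S)" for k
      using that insert.hyps P(1)[of k] by (simp add: P'_def coeff_eq_0)
    moreover have "F b - poly P' (Lam b) \<in> I" if "b \<in> insert m S" for b
    proof (cases "b = m")
      case True
      then show ?thesis using q by (simp add: P'_def poly_R algebra_simps)
    next
      case False
      then have "b \<in> S" using that by simp
      then have "(\<Prod>i\<in>S. Lam (b - i)) = 0" using insert.hyps by (intro prod_zero bexI[of _ b]) auto
      then show ?thesis using P(2)[OF \<open>b \<in> S\<close>] by (simp add: P'_def poly_R)
    qed
    ultimately show ?case by blast
  qed
  from this[OF E_finite] obtain P where P: "\<And>k. k \<ge> s + 5 \<Longrightarrow> coeff P k = 0"
    "\<And>b. b \<in> E \<Longrightarrow> F b - poly P (Lam b) \<in> I"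
    unfolding card_E by blast
  show ?thesis
  proof (rule that[of P])
    have "degree P \<le> s + 4" by (rule degree_le) (use P(1) in auto)
    then show "degree P < s + 5" by simp
    fix c assume c: "c \<in> B m"
    obtain t where t: "indep (E - {t}) (adjoin Z c)" using indep_exchange[OF subgroup_Z E_indep] .
    have "s + 1 \<le> card (E - {t})" by (intro card_remove E_finite) (simp add: card_E)
    have "hc s (F c - poly P (Lam c)) \<in> J []"
    proof (rule inter_J_hc[where S = "E - {t}" and w = "\<lambda>i. c - i"])
      show "nzd (c - j) [c - i]" if "i \<in> E - {t}" "j \<in> E - {t}" "i \<noteq> j" for i j
        using t that by (rule nzd_shift_one)
      show "s < card (E - {t})" using \<open>s + 1 \<le> card (E - {t})\<close> by simp
      fix i assume i: "i \<in> E - {t}"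
      have "F c - F i \<in> J [c - i]" using F Bm c i by auto
      moreover have "F i - poly P (Lam i) \<in> J [c - i]" using i by (intro I_subset_J P(2)) auto
      moreover have "poly P (Lam c) - poly P (Lam i) \<in> J [c - i]"
        by (rule is_ideal_poly_cong) (auto simp flip: Lam_diff intro: Lam_in_J)
      ultimately have "(F c - F i) + (F i - poly P (Lam i)) - (poly P (Lam c) - poly P (Lam i)) \<in> J [c - i]"
        by (rule is_ideal_diff[OF ideal_J is_ideal_add[OF ideal_J]])
      then show "F c - poly P (Lam c) \<in> J [c - i]" by simp
    qed (simp add: E_finite)
    then show "hc s (F c) - hc s (poly P (Lam c)) \<in> I" by (simp add: hc_diff)
  qed
qed

lemma unit_mod_I:
  assumes "0 < k" "k \<le> s + 5" shows "\<exists>u. of_nat k * u - 1 \<in> I"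
proof -
  have "k < 2 ^ (s + 5)" using less_exp[of "s + 5"] assms(2) by linarith
  then have "int k < int (2 ^ (s + 5))" by (simp only: of_nat_less_iff)
  also have "int (2 ^ (s + 5)) = 2 ^ (s + 5)" by simp
  finally have "int k < 2 ^ (s + 5)" .
  then have "int k < p" using p_large by linarith
  then have "\<not> p dvd int k" using assms(1) zdvd_not_zless[of "int k" p] by auto
  then have "coprime p (int k)" using prime_p by (simp add: prime_imp_coprime)
  then obtain a b where "a * p + b * int k = 1" by (metis bezout_int coprime_imp_gcd_eq_1)
  then have "of_int (a * p + b * int k) = (1::'a)" by simp
  then have "of_nat k * of_int b - 1 = - (of_int a * of_int p :: 'a)" by (simp add: algebra_simps)
  also have "\<dots> \<in> I" using is_ideal_uminus[OF ideal_I is_ideal_mult[OF ideal_I p_in_I]] by simp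
  finally show ?thesis by blast
qed

text \<open>Both \<open>T (b + c)\<close> and \<open>T c\<close> have increments \<open>X\<close> in
  \<open>c\<close>, so \<open>F c - F c' \<in> J [c - c']\<close> and interpolation applies. At
  \<open>c = int n *s b\<close> its variable is \<open>n\<close> times \<open>Lam b\<close>; hence
  \<open>T (int (Suc n) *s b) - T (int n *s b)\<close> is a polynomial in \<open>n\<close> modulo
  \<open>I\<close>, which is then summed.\<close>

lemma polynomial_along_line:
  assumes T: "T 0 = 0" "\<And>h. hc s (T h) = T h"
    "\<And>h h'. h \<in> B (2 * q) \<Longrightarrow> h' \<in> B (2 * q) \<Longrightarrow> compatible T h h'"
    and b: "b \<in> B r" "M * r \<le> q" "0 < M"
  obtains e where "\<And>n. n \<le> M \<Longrightarrow> T (int n *s b) - (\<Sum>k=1..s+5. of_nat n ^ k * e k) \<in> I"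
proof -
  define F where "F c = T (b + c) - T b - T c" for c
  \<comment> \<open>The bound \<open>M * r \<le> q\<close> keeps \<open>b\<close> and its multiples
    below the \<open>M\<close>-th inside \<open>B q\<close>.\<close>
  have "1 * r \<le> M * r" using b(3) by (intro mult_le_mono1) simp
  then have "r \<le> q" using b(2) by linarith
  with b(1) have bq: "b \<in> B q" by (rule B_le)
  have "F c - F c' \<in> J [c - c']" if c: "c \<in> B q" "c' \<in> B q" for c c'
  proof -
    have B2: "b + c \<in> B (2 * q)" "b + c' \<in> B (2 * q)" "c \<in> B (2 * q)" "c' \<in> B (2 * q)"
      using B_add[OF bq c(1)] B_add[OF bq c(2)] c by (auto simp: mult_2 intro: B_le)
    have "(T (b + c) - T (b + c') - X (c - c')) - (T c - T c' - X (c - c')) \<in> J [c - c']"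
      using T(3)[OF B2(1,2)] T(3)[OF B2(3,4)] unfolding compatible_def add_diff_cancel_left
      by (rule is_ideal_diff[OF ideal_J])
    then show ?thesis by (simp add: F_def algebra_simps)
  qed
  moreover have "1 \<le> q" using q_pos by simp
  ultimately obtain P where P: "degree P < s + 5" "\<And>c. c \<in> B q \<Longrightarrow> hc s (F c) - hc s (poly P (Lam c)) \<in> I"
    using newton_interpolation[of q F] by blast
  define e where "e k = hc s (coeff P k * Lam b ^ k)" for k
  have hc_F: "hc s (F c) = F c" for c by (simp add: F_def hc_diff T(2))
  have "hc s (poly P (Lam (int n *s b))) = (\<Sum>k<s + 5. of_nat n ^ k * e k)" for n
  proof -
    have "poly P (of_nat n * Lam b) = (\<Sum>k<s + 5. of_nat (n ^ k) * (coeff P k * Lam b ^ k))"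
      unfolding poly_altdef using P(1)
      by (intro sum.mono_neutral_cong_left) (auto simp: coeff_eq_0 power_mult_distrib)
    then show ?thesis by (simp add: Lam_scale_nat hc_sum hc_of_nat e_def del: of_nat_power) simp
  qed
  then have step: "T (int (Suc n) *s b) - T (int n *s b) - T b - (\<Sum>k<s + 5. of_nat n ^ k * e k) \<in> I"
    if "n < M" for n
  proof -
    have "n * r \<le> q" using that b(2) by (meson less_imp_le_nat mult_le_mono1 order_trans)
    then have "int n *s b \<in> B q" using B_scale[OF b(1), of n] by (auto intro: B_le)
    from P(2)[OF this] show ?thesis
      unfolding hc_F \<open>\<And>n. hc s (poly P (Lam (int n *s b))) = _\<close>
      by (simp add: F_def scale_left_distrib algebra_simps)
  qed
  \<comment> \<open>The constant \<open>T b\<close> in the differences joins the coefficient of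
    degree 0.\<close>
  define e1 where "e1 = e(0 := e 0 + T b)"
  have e1: "(\<Sum>k<s + 5. of_nat n ^ k * e1 k) = T b + (\<Sum>k<s + 5. of_nat n ^ k * e k)" for n
    unfolding sum.lessThan_Suc_shift by (simp add: e1_def numeral_eq_Suc sum.lessThan_Suc_shift del: sum.lessThan_Suc)
  have "\<exists>e'. \<forall>n\<le>M. T (int n *s b) - (\<Sum>k=1..s + 5. of_nat n ^ k * e' k) \<in> I"
    by (rule polynomial_sequence_of_differences[OF ideal_I, where e = e1])
      (use step unit_mod_I in \<open>auto simp: T(1) is_ideal_0[OF ideal_I] e1 diff_diff_eq add.assoc\<close>)
  then show ?thesis using that by blast
qed

section \<open>Passing to the additive part\<close>

lemma pow2_bounds:
  assumes "i < s + 5" shows "2 ^ i * 16 * (s + 2) \<le> 2 * q"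
proof -
  have "2 * 2 ^ i \<le> (2::nat) ^ (s + 5)"
    using power_increasing[of "Suc i" "s + 5" "2::nat"] assms by simp
  then have "(2 * 2 ^ i) * (8 * (s + 2)) \<le> 2 ^ (s + 5) * (8 * (s + 2))" by (rule mult_le_mono1)
  then show ?thesis unfolding q_def by (simp add: algebra_simps)
qed

text \<open>The weights of \<open>linear_part_weights\<close> combine the dilates of
  \<open>T0\<close> by \<open>2 ^ i\<close>. Increments stay \<open>X\<close>, because
  \<open>X (int (2 ^ i) *s u)\<close> is \<open>2 ^ i\<close> times \<open>X u\<close> modulo
  \<open>J [u]\<close> and the weighted sum of the \<open>2 ^ i\<close> is 1 modulo
  \<open>p\<close>. Along a line all terms of degree at least two are annihilated.\<close>

lemma homogeneous_compatible_exists: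
  obtains T where "T 0 = 0" "\<And>h. hc s (T h) = T h"
    "\<And>h h'. h \<in> B (4 * (s + 2)) \<Longrightarrow> h' \<in> B (4 * (s + 2)) \<Longrightarrow> compatible T h h'"
    "\<And>b k. b \<in> B 2 \<Longrightarrow> k \<le> s + 1 \<Longrightarrow> T (int k *s b) - of_nat k * T b \<in> I"
proof -
  obtain T0 where T0: "T0 0 = 0" "\<And>h. hc s (T0 h) = T0 h"
    "\<And>h h'. h \<in> B (2 * q) \<Longrightarrow> h' \<in> B (2 * q) \<Longrightarrow> compatible T0 h h'"
    using compatible_exists by blast
  obtain \<mu> where \<mu>: "\<And>k. 2 \<le> k \<Longrightarrow> k \<le> s + 5 \<Longrightarrow> (\<Sum>i<s + 5. \<mu> i * (2 ^ i) ^ k) = 0"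
    "p dvd (\<Sum>i<s + 5. \<mu> i * 2 ^ i) - 1"
    using linear_part_weights[OF prime_p p_large] by auto
  define T where "T h = (\<Sum>i<s + 5. of_int (\<mu> i) * T0 (int (2 ^ i) *s h))" for h
  \<comment> \<open>The factor is a multiple of \<open>p\<close>, so replacing the weighted sum by 1
    costs only an element of \<open>I\<close>.\<close>
  have one: "(of_int (\<Sum>i<s + 5. \<mu> i * 2 ^ i) - 1) * f \<in> I" for f :: 'a
  proof -
    obtain m where "(\<Sum>i<s + 5. \<mu> i * 2 ^ i) - 1 = p * m" using \<mu>(2) by (elim dvdE)
    then have "of_int ((\<Sum>i<s + 5. \<mu> i * 2 ^ i) - 1) = (of_int (p * m) :: 'a)" by simp
    then have "(of_int (\<Sum>i<s + 5. \<mu> i * 2 ^ i) - 1) * f = (of_int m * f) * (of_int p :: 'a)"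
      by (simp add: mult_ac)
    then show ?thesis using is_ideal_mult[OF ideal_I p_in_I] by simp
  qed
  show ?thesis
  proof (rule that[of T])
    show "T 0 = 0" by (simp add: T_def T0(1))
    show "hc s (T h) = T h" for h by (simp add: T_def hc_sum hc_of_int T0(2))
  next
    fix h h' assume h: "h \<in> B (4 * (s + 2))" "h' \<in> B (4 * (s + 2))"
    have u: "h - h' \<in> B (8 * (s + 2))" using B_diff[OF h] by simp
    have *: "T0 (int (2 ^ i) *s h) - T0 (int (2 ^ i) *s h') - of_nat (2 ^ i) * X (h - h') \<in> J [h - h']"
      if i: "i < s + 5" for i
    proof -
      have le: "2 ^ i * (4 * (s + 2)) \<le> 2 * q" "2 ^ i * (8 * (s + 2)) \<le> 4 * q"
        using pow2_bounds[OF i] by (simp_all add: algebra_simps)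
      have "compatible T0 (int (2 ^ i) *s h) (int (2 ^ i) *s h')"
        by (intro T0(3) B_le[OF B_scale[OF h(1)]] B_le[OF B_scale[OF h(2)]] le)
      then have "T0 (int (2 ^ i) *s h) - T0 (int (2 ^ i) *s h') - X (int (2 ^ i) *s (h - h'))
          \<in> J [int (2 ^ i) *s (h - h')]"
        unfolding compatible_def scale_right_diff_distrib .
      then have "T0 (int (2 ^ i) *s h) - T0 (int (2 ^ i) *s h') - X (int (2 ^ i) *s (h - h'))
          \<in> J [h - h']"
        by (rule J_mono_single) (auto simp: Lam_scale intro!: Lam_in_J is_ideal_mult[OF ideal_J])
      from is_ideal_add[OF ideal_J this X_scale[OF u le(2)]] show ?thesis by (simp add: algebra_simps)
    qed
    have "T h - T h' - of_int (\<Sum>i<s + 5. \<mu> i * 2 ^ i) * X (h - h')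
      = (\<Sum>i<s + 5. of_int (\<mu> i) * (T0 (int (2 ^ i) *s h) - T0 (int (2 ^ i) *s h') - of_nat (2 ^ i) * X (h - h')))"
      by (simp add: T_def right_diff_distrib sum_subtractf sum_distrib_right mult.assoc)
    also have "\<dots> \<in> J [h - h']"
      by (intro is_ideal_sum[OF ideal_J] is_ideal_mult[OF ideal_J] *) simp
    finally have "(T h - T h' - of_int (\<Sum>i<s + 5. \<mu> i * 2 ^ i) * X (h - h'))
        + (of_int (\<Sum>i<s + 5. \<mu> i * 2 ^ i) - 1) * X (h - h') \<in> J [h - h']"
      using I_subset_J[OF one] by (rule is_ideal_add[OF ideal_J])
    then show "compatible T h h'" unfolding compatible_def by (simp add: algebra_simps)
  next
    fix b k assume b: "b \<in> B 2" and k: "k \<le> s + 1"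
    \<comment> \<open>Room for all arguments \<open>2 ^ i * k\<close> with \<open>i < s + 5\<close>
      and \<open>k \<le> s + 1\<close>.\<close>
    define M where "M = (s + 1) * 2 ^ (s + 5)"
    have "M * 2 = ((s + 1) * 2) * 2 ^ (s + 5)" by (simp add: M_def)
    also have "\<dots> \<le> (4 * (s + 2)) * 2 ^ (s + 5)" by (rule mult_le_mono1) simp
    finally have "M * 2 \<le> q" by (simp add: q_def)
    moreover have "0 < M" by (simp add: M_def)
    ultimately obtain e where e: "\<And>n. n \<le> M \<Longrightarrow> T0 (int n *s b) - (\<Sum>k=1..s+5. of_nat n ^ k * e k) \<in> I"
      using polynomial_along_line[OF T0 b] by blast
    \<comment> \<open>Only the coefficient \<open>e 1\<close> survives the weights; the case
      \<open>k = 1\<close> then identifies it with \<open>T b\<close>.\<close>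
    have lin: "T (int k *s b) - of_nat k * e 1 \<in> I" if "k \<le> s + 1" for k
    proof -
      have "T (int k *s b) - (\<Sum>i<s + 5. of_int (\<mu> i) * (\<Sum>l=1..s+5. of_nat (2 ^ i * k) ^ l * e l))
        = (\<Sum>i<s + 5. of_int (\<mu> i) * (T0 (int (2 ^ i * k) *s b) - (\<Sum>l=1..s+5. of_nat (2 ^ i * k) ^ l * e l)))"
        unfolding T_def right_diff_distrib sum_subtractf by simp
      also have "\<dots> \<in> I"
      proof (intro is_ideal_sum[OF ideal_I] is_ideal_mult[OF ideal_I] e)
        fix i assume "i \<in> {..<s + 5}"
        then have "2 ^ i \<le> (2::nat) ^ (s + 5)" by (intro power_increasing) auto
        then have "2 ^ i * k \<le> 2 ^ (s + 5) * (s + 1)" using that by (intro mult_le_mono) auto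
        then show "2 ^ i * k \<le> M" by (simp add: M_def mult.commute)
      qed
      also have "(\<Sum>i<s + 5. of_int (\<mu> i) * (\<Sum>l=1..s+5. of_nat (2 ^ i * k) ^ l * e l))
        = (\<Sum>l=1..s+5. \<Sum>i<s + 5. of_int (\<mu> i) * (of_nat (2 ^ i * k) ^ l * e l))"
        unfolding sum_distrib_left by (rule sum.swap)
      also have "\<dots> = (\<Sum>l=1..s+5. of_int (\<Sum>i<s + 5. \<mu> i * (2 ^ i) ^ l) * (of_nat k ^ l * e l))"
        by (intro sum.cong refl) (simp add: sum_distrib_right sum_distrib_left power_mult_distrib mult_ac)
      also have "\<dots> = of_int (\<Sum>i<s + 5. \<mu> i * (2 ^ i) ^ 1) * (of_nat k ^ 1 * e 1)
          + (\<Sum>l=2..s+5. of_int (\<Sum>i<s + 5. \<mu> i * (2 ^ i) ^ l) * (of_nat k ^ l * e l))"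
        by (subst sum.atLeast_Suc_atMost) (simp_all add: numeral_2_eq_2)
      also have "(\<Sum>l=2..s+5. of_int (\<Sum>i<s + 5. \<mu> i * (2 ^ i) ^ l) * (of_nat k ^ l * e l)) = 0"
        by (intro sum.neutral ballI) (simp add: \<mu>(1) del: of_int_sum)
      finally have "(T (int k *s b) - of_int (\<Sum>i<s + 5. \<mu> i * 2 ^ i) * (of_nat k * e 1))
          + (of_int (\<Sum>i<s + 5. \<mu> i * 2 ^ i) - 1) * (of_nat k * e 1) \<in> I"
        using one by (intro is_ideal_add[OF ideal_I]) (simp_all del: of_int_sum)
      then show ?thesis by (simp add: algebra_simps del: of_int_sum)
    qed
    have "T b - e 1 \<in> I" using lin[of 1] by simp
    from is_ideal_diff[OF ideal_I lin[OF k] is_ideal_mult[OF ideal_I this, of "of_nat k"]]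
    show "T (int k *s b) - of_nat k * T b \<in> I" by (simp add: algebra_simps)
  qed
qed

text \<open>For independent \<open>a\<close> and \<open>b\<close>, the differences of
  \<open>a + b\<close> and \<open>int (k + 1) *s b\<close> and of \<open>a\<close> and
  \<open>int k *s b\<close> coincide. As \<open>T\<close> is homogeneous on multiples of
  \<open>b\<close>, the defect of additivity lies in the ideal of \<open>a - int k *s b\<close> for
  all \<open>k \<le> s\<close>, hence in \<open>I\<close>. The general case uses an auxiliary base
  vector.\<close>

lemma additive_exists:
  obtains T where "T 0 = 0" "\<And>h. hc s (T h) = T h"
    "\<And>h. h \<in> B 1 \<Longrightarrow> T h - X h \<in> J [h]"
    "\<And>a b. a \<in> B 1 \<Longrightarrow> b \<in> B 1 \<Longrightarrow> T (a + b) - T a - T b \<in> I"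
proof -
  obtain T where T: "T 0 = 0" "\<And>h. hc s (T h) = T h"
    "\<And>h h'. h \<in> B (4 * (s + 2)) \<Longrightarrow> h' \<in> B (4 * (s + 2)) \<Longrightarrow> compatible T h h'"
    "\<And>b k. b \<in> B 2 \<Longrightarrow> k \<le> s + 1 \<Longrightarrow> T (int k *s b) - of_nat k * T b \<in> I"
    using homogeneous_compatible_exists by blast
  have generic: "T (a + b) - T a - T b \<in> I"
    if ab: "a \<in> B 2" "b \<in> B 2" "indep {a, b} Z" "a \<noteq> b" for a b
  proof -
    have "hc s (T (a + b) - T a - T b) \<in> J []"
    proof (rule inter_J_hc[where S = "{..s}" and w = "\<lambda>k. a - int k *s b"])
      fix i j assume ij: "i \<in> {..s}" "j \<in> {..s}" "i \<noteq> j"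
      have "int (s + 5) < 2 ^ (s + 5)" using less_exp[of "s + 5"]
        by (metis of_nat_less_iff of_nat_numeral of_nat_power)
      then have "int s < p" using p_large by linarith
      then have "\<bar>int i - int j\<bar> < p" using ij by auto
      then have "\<not> p dvd int i - int j" using ij zdvd_imp_le[of p "\<bar>int i - int j\<bar>"] by auto
      then show "nzd (a - int j *s b) [a - int i *s b]" using ab by (intro nzd_line) auto
    next
      fix k assume "k \<in> {..s}"
      then have k: "k \<le> s" by simp
      have B: "a \<in> B (4 * (s + 2))" "a + b \<in> B (4 * (s + 2))"
        using B_le[OF ab(1)] B_le[OF B_add[OF ab(1,2)]] by simp_all
      have kb: "int j *s b \<in> B (4 * (s + 2))" if "j \<le> s + 1" for j
        using B_scale[OF ab(2), of j] by (rule B_le) (use that in simp)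
      have eq: "(a + b) - int (k + 1) *s b = a - int k *s b" by (simp add: scale_left_distrib)
      have "T (a + b) - T (int (k + 1) *s b) - X (a - int k *s b) \<in> J [a - int k *s b]"
        using T(3)[OF B(2) kb[of "k + 1"]] k unfolding compatible_def eq by simp
      moreover have "T a - T (int k *s b) - X (a - int k *s b) \<in> J [a - int k *s b]"
        using T(3)[OF B(1) kb[of k]] k unfolding compatible_def by simp
      ultimately have "(T (a + b) - T (int (k + 1) *s b) - X (a - int k *s b))
          - (T a - T (int k *s b) - X (a - int k *s b)) \<in> J [a - int k *s b]"
        by (rule is_ideal_diff[OF ideal_J])
      moreover have "(T (int (k + 1) *s b) - of_nat (k + 1) * T b) - (T (int k *s b) - of_nat k * T b)
          \<in> J [a - int k *s b]"
        by (intro I_subset_J is_ideal_diff[OF ideal_I] T(4) ab) (use k in auto)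
      ultimately have "((T (a + b) - T (int (k + 1) *s b) - X (a - int k *s b))
          - (T a - T (int k *s b) - X (a - int k *s b)))
          + ((T (int (k + 1) *s b) - of_nat (k + 1) * T b) - (T (int k *s b) - of_nat k * T b))
          \<in> J [a - int k *s b]"
        by (rule is_ideal_add[OF ideal_J])
      then show "T (a + b) - T a - T b \<in> J [a - int k *s b]" by (simp add: algebra_simps)
    qed auto
    then show ?thesis by (simp add: hc_diff T(2))
  qed
  have additive: "T (a + b) - T a - T b \<in> I" if ab: "a \<in> B 1" "b \<in> B 1" for a b
  proof -
    \<comment> \<open>The aim is a base vector \<open>c\<close> that is independent of the span
      \<open>U\<close> of \<open>a\<close> and \<open>b\<close>.\<close>
    obtain t1 where "indep (E - {t1}) (adjoin Z a)" using indep_exchange[OF subgroup_Z E_indep] .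
    then obtain t2 where t2: "indep (E - {t1} - {t2}) (adjoin (adjoin Z a) b)"
      using indep_exchange[OF subgroup_adjoin[OF subgroup_Z]] by blast
    define U where "U = adjoin (adjoin Z a) b"
    have U: "subgroup_over_Z U" by (simp add: U_def)
    have "1 \<le> card (E - {t1} - {t2})" by (intro card_remove finite_Diff E_finite) (simp add: card_E)
    then obtain c where c: "c \<in> E - {t1} - {t2}" by (metis card.empty equals0I not_one_le_zero)
    have cU: "p dvd k" if "k *s c \<in> U" for k
    proof -
      have "indep {c} U" using t2 unfolding U_def by (rule indep_subset) (use c in auto)
      then show ?thesis using indepD[of "{c}" U "\<lambda>_. k" c] that by simp
    qed
    have aU: "a \<in> U" "b \<in> U"
      by (simp_all add: U_def self_in_adjoin base_in_adjoin)
    have cB: "c \<in> B 1" using c E_B by auto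
    \<comment> \<open>For \<open>v\<close> in \<open>U\<close> and \<open>w\<close> in the coset of
      \<open>c\<close>, either \<open>v = 0\<close> or the pair is independent.\<close>
    have *: "T (v + w) - T v - T w \<in> I" if v: "v \<in> U" "v \<in> B 2" and w: "w - c \<in> U" "w \<in> B 2" for v w
    proof (cases "v \<in> Z")
      case True
      have "4 * 1 \<le> 4 * q" using q_pos by (intro mult_le_mono) auto
      then have "v = 0" using B_proper[OF B_le[OF v(2)] True] by simp
      then show ?thesis using T(1) is_ideal_0[OF ideal_I] by simp
    next
      case False
      have "v \<noteq> w"
      proof
        assume "v = w"
        then have "1 *s c \<in> U" using subgroup_over_Z_diff[OF U v(1) w(1)] by simp
        then have "p dvd 1" by (rule cU)
        then show False using prime_p by auto
      qed
      have "indep {v, w} Z"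
        unfolding indep_def
      proof (intro conjI allI impI)
        fix x assume "(\<Sum>u\<in>{v, w}. x u *s u) \<in> Z"
        then have *: "x v *s v + x w *s w \<in> Z" using \<open>v \<noteq> w\<close> by simp
        have "x w *s c = (x v *s v + x w *s w) - x v *s v - x w *s (w - c)"
          by (simp add: scale_right_diff_distrib)
        also have "\<dots> \<in> U"
          by (rule subgroup_over_Z_diff[OF U subgroup_over_Z_diff[OF U
                subgroup_over_Z_closed(3)[OF U *] subgroup_over_Z_closed(2)[OF U v(1)]]
                subgroup_over_Z_closed(2)[OF U w(1)]])
        finally have xw: "p dvd x w" by (rule cU)
        have "(x v *s v + x w *s w) - x w *s w \<in> Z"
          by (rule subgroup_over_Z_diff[OF subgroup_Z * Z_dvd[OF xw]])
        then have "x v *s v \<in> Z" by simp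
        then have "p dvd x v" using subgroup_cancel[OF subgroup_Z] False by blast
        with xw show "\<forall>u\<in>{v, w}. p dvd x u" by simp
      qed simp
      then show ?thesis using generic[OF v(2) w(2)] \<open>v \<noteq> w\<close> by blast
    qed
    have B2: "u \<in> B 2" if "u \<in> B 1" for u using that by (rule B_le) simp
    \<comment> \<open>The defect is a 2-cocycle: its value at \<open>(a, b)\<close> is that at
      \<open>(a, b + c)\<close> plus that at \<open>(b, c)\<close> minus that at
      \<open>(a + b, c)\<close>.\<close>
    have e1: "T (a + (b + c)) - T a - T (b + c) \<in> I"
      using aU B2[OF ab(1)] B_add[OF ab(2) cB] by (intro *) (simp_all add: numeral_2_eq_2)
    have e2: "T (b + c) - T b - T c \<in> I"
      using aU B2[OF ab(2)] B2[OF cB] subgroup_over_Z_closed(4)[OF U] by (intro *) simp_all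
    have e3: "T ((a + b) + c) - T (a + b) - T c \<in> I"
      using subgroup_over_Z_closed(1)[OF U aU] B_add[OF ab] B2[OF cB] subgroup_over_Z_closed(4)[OF U]
      by (intro *) (simp_all add: numeral_2_eq_2)
    from is_ideal_diff[OF ideal_I is_ideal_add[OF ideal_I e1 e2] e3]
    show ?thesis by (simp add: algebra_simps)
  qed
  show ?thesis
  proof (rule that[of T])
    show "T h - X h \<in> J [h]" if "h \<in> B 1" for h
    proof -
      have "compatible T h 0" using B_le[OF that] by (intro T(3) B_0) simp
      then show ?thesis by (simp add: compatible_def T(1) del: J.simps)
    qed
  qed (use T(1,2) additive in auto)
qed

end

section \<open>Polynomials over the prime field\<close>

lemma lookup_of_int_mult: "Poly_Mapping.lookup (of_int k * f :: mpoly) m = k * Poly_Mapping.lookup f m"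
proof -
  have "(of_int k :: mpoly) = Poly_Mapping.single 0 (of_int k)" by (simp only: single_of_int)
  then have "(of_int k * f :: mpoly) = Poly_Mapping.map ((*) k) f"
    by (simp add: mult_map_scale_conv_mult)
  then show ?thesis by (simp add: Poly_Mapping.map.rep_eq when_def)
qed

lemma of_int_dvd_iff: "(of_int k :: mpoly) dvd f \<longleftrightarrow> (\<forall>m. k dvd Poly_Mapping.lookup f m)"
proof
  assume "of_int k dvd f"
  then show "\<forall>m. k dvd Poly_Mapping.lookup f m" by (auto simp: dvd_def lookup_of_int_mult)
next
  assume *: "\<forall>m. k dvd Poly_Mapping.lookup f m"
  have "f = of_int k * Poly_Mapping.map (\<lambda>c. c div k) f"
    by (rule poly_mapping_eqI) (use * in \<open>auto simp: lookup_of_int_mult Poly_Mapping.map.rep_eq when_def\<close>)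
  then show "of_int k dvd f" by (metis dvd_triv_left)
qed

lemma congp_iff_dvd: "congp p f g \<longleftrightarrow> of_int (int p) dvd f - g"
  by (simp add: congp_def of_int_dvd_iff del: of_int_of_nat_eq)

text \<open>Polynomials over the prime field form a domain: once the terms divisible by
  \<open>p\<close> are discarded, the product of the terms with largest monomials cannot cancel, the
  order on monomials being compatible with addition.\<close>

lemma prime_of_int_dvd_mult:
  fixes f g :: mpoly
  assumes "prime p" and dvd: "(of_int p :: mpoly) dvd f * g"
  shows "(of_int p :: mpoly) dvd f \<or> (of_int p :: mpoly) dvd g"
proof (rule ccontr)
  assume nd: "\<not> ?thesis"
  define supp where "supp h = {m \<in> Poly_Mapping.keys h. \<not> p dvd Poly_Mapping.lookup h m}" for h :: mpoly
  define red where "red h = (\<Sum>m\<in>supp h. Poly_Mapping.single m (Poly_Mapping.lookup h m))" for h :: mpoly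
  have fin: "finite (supp h)" for h by (simp add: supp_def)
  have ne: "supp h \<noteq> {}" if "\<not> (of_int p :: mpoly) dvd h" for h
    using that by (auto simp: of_int_dvd_iff supp_def in_keys_iff) (metis dvd_0_right)
  have lookup_red: "Poly_Mapping.lookup (red h) m = (if m \<in> supp h then Poly_Mapping.lookup h m else 0)" for h m
    by (simp add: red_def lookup_sum lookup_single when_def fin)
  have red: "(of_int p :: mpoly) dvd h - red h" for h
    unfolding of_int_dvd_iff by (auto simp: lookup_minus lookup_red supp_def in_keys_iff)
  have "f * g - red f * red g = (f - red f) * g + red f * (g - red g)" by (simp add: algebra_simps)
  then have "(of_int p :: mpoly) dvd f * g - red f * red g" using red by (metis dvd_add dvd_mult dvd_mult2)
  then have "(of_int p :: mpoly) dvd f * g - (f * g - red f * red g)" using dvd by (rule_tac dvd_diff)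
  then have pd: "(of_int p :: mpoly) dvd red f * red g" by simp
  define a b where "a = Max (supp f)" and "b = Max (supp g)"
  have a: "a \<in> supp f" and b: "b \<in> supp g"
    using nd fin ne by (auto simp: a_def b_def intro!: Max_in)
  have "red f * red g = (\<Sum>m\<in>supp f. \<Sum>n\<in>supp g.
      Poly_Mapping.single (m + n) (Poly_Mapping.lookup f m * Poly_Mapping.lookup g n))"
    by (simp add: red_def sum_product mult_single)
  then have "Poly_Mapping.lookup (red f * red g) (a + b) = (\<Sum>m\<in>supp f. \<Sum>n\<in>supp g.
      if m + n = a + b then Poly_Mapping.lookup f m * Poly_Mapping.lookup g n else 0)"
    by (simp add: lookup_sum lookup_single when_def)
  also have "\<dots> = (\<Sum>m\<in>supp f. \<Sum>n\<in>supp g.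
      if n = b then (if m = a then Poly_Mapping.lookup f m * Poly_Mapping.lookup g n else 0) else 0)"
  proof (intro sum.cong refl)
    fix m n assume "m \<in> supp f" "n \<in> supp g"
    then have "m \<le> a" "n \<le> b" by (auto simp: a_def b_def fin)
    then have "m + n = a + b \<longleftrightarrow> m = a \<and> n = b"
      by (metis add_less_le_mono add_le_less_mono le_less order_less_irrefl)
    then show "(if m + n = a + b then Poly_Mapping.lookup f m * Poly_Mapping.lookup g n else 0)
      = (if n = b then (if m = a then Poly_Mapping.lookup f m * Poly_Mapping.lookup g n else 0) else 0)"
      by auto
  qed
  also have "\<dots> = Poly_Mapping.lookup f a * Poly_Mapping.lookup g b"
    using a b by (simp add: fin)
  finally have "p dvd Poly_Mapping.lookup f a * Poly_Mapping.lookup g b"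
    using pd unfolding of_int_dvd_iff by metis
  then show False using a b assms(1) by (auto simp: supp_def prime_dvd_mult_iff)
qed

section \<open>Substitution homomorphisms\<close>

definition mon_eval :: "(nat \<Rightarrow> 'a::comm_ring_1) \<Rightarrow> (nat \<Rightarrow>\<^sub>0 nat) \<Rightarrow> 'a" where
  "mon_eval g m = (\<Prod>i\<in>Poly_Mapping.keys m. g i ^ Poly_Mapping.lookup m i)"

text \<open>Values lie in an arbitrary commutative ring, to cover both substitution of polynomials
  for variables and evaluation at integer points.\<close>

definition poly_eval :: "(nat \<Rightarrow> 'a::comm_ring_1) \<Rightarrow> mpoly \<Rightarrow> 'a" where
  "poly_eval g f = (\<Sum>m\<in>Poly_Mapping.keys f. of_int (Poly_Mapping.lookup f m) * mon_eval g m)"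

lemma mon_eval_superset:
  assumes "finite S" "Poly_Mapping.keys m \<subseteq> S"
  shows "mon_eval g m = (\<Prod>i\<in>S. g i ^ Poly_Mapping.lookup m i)"
  unfolding mon_eval_def using assms by (intro prod.mono_neutral_left) (auto simp: in_keys_iff)

lemma mon_eval_add: "mon_eval g (m + n) = mon_eval g m * mon_eval g n"
proof -
  define S where "S = Poly_Mapping.keys m \<union> Poly_Mapping.keys n"
  have S: "finite S" "Poly_Mapping.keys m \<subseteq> S" "Poly_Mapping.keys n \<subseteq> S" "Poly_Mapping.keys (m + n) \<subseteq> S"
    using keys_add[of m n] by (auto simp: S_def)
  show ?thesis
    by (simp add: mon_eval_superset[OF S(1,2)] mon_eval_superset[OF S(1,3)] mon_eval_superset[OF S(1,4)]
        lookup_add power_add prod.distrib)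
qed

lemma mon_eval_0 [simp]: "mon_eval g 0 = 1"
  by (simp add: mon_eval_def)

lemma mon_eval_single [simp]: "mon_eval g (Poly_Mapping.single i k) = g i ^ k"
  by (simp add: mon_eval_def)

lemma poly_eval_single: "poly_eval g (Poly_Mapping.single m c) = of_int c * mon_eval g m"
  by (simp add: poly_eval_def)

lemma poly_eval_0 [simp]: "poly_eval g 0 = 0"
  by (simp add: poly_eval_def)

lemma poly_eval_add: "poly_eval g (f + h) = poly_eval g f + poly_eval g h"
  unfolding poly_eval_def
  by (rule setsum_keys_plus_distrib[where f = "\<lambda>m c. of_int c * mon_eval g m"]) (auto simp: algebra_simps)

lemma poly_eval_uminus: "poly_eval g (- f) = - poly_eval g f"
  using poly_eval_add[of g f "- f"] by (simp add: eq_neg_iff_add_eq_0 add.commute)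

lemma poly_eval_diff: "poly_eval g (f - h) = poly_eval g f - poly_eval g h"
  using poly_eval_add[of g f "- h"] by (simp add: poly_eval_uminus)

lemma poly_eval_sum: "poly_eval g (sum f S) = (\<Sum>i\<in>S. poly_eval g (f i))"
  by (induction S rule: infinite_finite_induct) (auto simp: poly_eval_add)

text \<open>Integer polynomials are the free abelian group on the monomials, so
  \<open>frag_induction\<close> reduces both factors to monomials.\<close>

lemma poly_eval_mult: "poly_eval g (f * h) = poly_eval g f * poly_eval g h"
proof -
  have "poly_eval g (Poly_Mapping.single m 1 * h) = mon_eval g m * poly_eval g h" for m
  proof (rule frag_induction[of h UNIV])
    fix n show "poly_eval g (Poly_Mapping.single m 1 * Poly_Mapping.single n 1)
        = mon_eval g m * poly_eval g (Poly_Mapping.single n 1)"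
      by (simp add: mult_single poly_eval_single mon_eval_add)
  qed (auto simp: poly_eval_diff right_diff_distrib)
  note mon = this
  show ?thesis
  proof (rule frag_induction[of f UNIV])
    fix n show "poly_eval g (Poly_Mapping.single n 1 * h)
        = poly_eval g (Poly_Mapping.single n 1) * poly_eval g h"
      by (simp add: mon poly_eval_single)
  qed (auto simp: poly_eval_diff left_diff_distrib)
qed

lemma poly_eval_of_int [simp]: "poly_eval g (of_int k) = of_int k"
  by (simp add: poly_eval_single flip: single_of_int)

lemma poly_eval_Var [simp]: "poly_eval g (Var i) = g i"
  by (simp add: Var_def poly_eval_single)

lemma poly_eval_dvd: "of_int k dvd f \<Longrightarrow> of_int k dvd poly_eval g f"
  by (auto simp: dvd_def poly_eval_mult)

lemma mon_eval_Var: "mon_eval Var m = Poly_Mapping.single m 1"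
proof -
  have pow: "Var i ^ k = Poly_Mapping.single (Poly_Mapping.single i k) 1" for i k
  proof (induction k)
    case (Suc k)
    have "Poly_Mapping.single i 1 + Poly_Mapping.single i k = Poly_Mapping.single i (Suc k)"
      by (simp flip: single_add)
    with Suc show ?case by (simp add: Var_def mult_single)
  qed simp
  have "(\<Prod>i\<in>S. Poly_Mapping.single (w i) (1::int)) = Poly_Mapping.single (\<Sum>i\<in>S. w i) 1"
    if "finite S" for S and w :: "nat \<Rightarrow> nat \<Rightarrow>\<^sub>0 nat"
    using that by (induction rule: finite_induct) (auto simp: mult_single)
  moreover have "(\<Sum>i\<in>Poly_Mapping.keys m. Poly_Mapping.single i (Poly_Mapping.lookup m i)) = m"
    by (rule poly_mapping_eqI) (auto simp: lookup_sum lookup_single when_def in_keys_iff)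
  ultimately show ?thesis by (simp add: mon_eval_def pow)
qed

text \<open>Powers and products respect congruence modulo \<open>K\<close>, which settles monomials;
  additivity does the rest.\<close>

lemma poly_eval_cong_ideal:
  assumes K: "is_ideal K" and g: "\<And>i. g i - Var i \<in> K"
  shows "poly_eval g f - f \<in> K"
proof (rule frag_induction[of f UNIV])
  fix m
  have "mon_eval g m - mon_eval Var m \<in> K"
    unfolding mon_eval_def by (intro is_ideal_prod_cong is_ideal_power_cong K g)
  then show "poly_eval g (Poly_Mapping.single m 1) - Poly_Mapping.single m 1 \<in> K"
    by (simp add: poly_eval_single mon_eval_Var)
next
  fix a b assume "poly_eval g a - a \<in> K" "poly_eval g b - b \<in> K"
  from is_ideal_diff[OF K this] show "poly_eval g (a - b) - (a - b) \<in> K"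
    by (simp add: poly_eval_diff algebra_simps)
qed (auto simp: is_ideal_0[OF K])

lemma poly_eval_poly_eval:
  fixes h :: "nat \<Rightarrow> 'a::comm_ring_1"
  shows "poly_eval h (poly_eval g f) = poly_eval (\<lambda>i. poly_eval h (g i)) f"
proof (rule frag_induction[of f UNIV])
  fix m
  have pow: "poly_eval h (a ^ k) = poly_eval h a ^ k" for a k
  proof (induction k)
    case 0
    show ?case using poly_eval_of_int[of h 1] by simp
  qed (simp add: poly_eval_mult)
  have "poly_eval h (\<Prod>i\<in>S. a i) = (\<Prod>i\<in>S. poly_eval h (a i))" for a :: "nat \<Rightarrow> mpoly" and S
    using pow[of _ 0] by (induction S rule: infinite_finite_induct) (auto simp: poly_eval_mult)
  then show "poly_eval h (poly_eval g (Poly_Mapping.single m 1))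
      = poly_eval (\<lambda>i. poly_eval h (g i)) (Poly_Mapping.single m 1)"
    by (simp add: poly_eval_single mon_eval_def pow)
qed (auto simp: poly_eval_diff)

text \<open>Discarding the variables \<open>x\<^sub>d, x\<^sub>d\<^sub>+\<^sub>1, \<dots>\<close> relates ideals of the full ring to \<open>zideal d\<close>.\<close>
definition hcomp :: "nat \<Rightarrow> nat \<Rightarrow> mpoly \<Rightarrow> mpoly" where
  "hcomp d n f = Poly_Mapping.mapp (\<lambda>m c. if Poly_Mapping.keys m \<subseteq> {..<d} \<and> mdeg m = n then c else 0) f"

lemma lookup_hcomp: "Poly_Mapping.lookup (hcomp d n f) m
    = (if Poly_Mapping.keys m \<subseteq> {..<d} \<and> mdeg m = n then Poly_Mapping.lookup f m else 0)"
  by (auto simp: hcomp_def lookup_mapp when_def in_keys_iff)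

lemma hcomp_add: "hcomp d n (f + g) = hcomp d n f + hcomp d n g"
  by (rule poly_mapping_eqI) (simp add: lookup_hcomp lookup_add)

lemma hcomp_diff: "hcomp d n (f - g) = hcomp d n f - hcomp d n g"
  by (rule poly_mapping_eqI) (simp add: lookup_hcomp lookup_minus)

lemma hcomp_0 [simp]: "hcomp d n 0 = 0"
  by (rule poly_mapping_eqI) (simp add: lookup_hcomp)

lemma hcomp_hcomp: "hcomp d n (hcomp d n f) = hcomp d n f"
  by (rule poly_mapping_eqI) (simp add: lookup_hcomp)

lemma hcomp_of_int: "hcomp d n (of_int k * f) = of_int k * hcomp d n f"
  by (rule poly_mapping_eqI) (simp add: lookup_hcomp lookup_of_int_mult)

lemma hcomp_sum: "hcomp d n (sum f S) = (\<Sum>i\<in>S. hcomp d n (f i))"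
  by (induction S rule: infinite_finite_induct) (auto simp: hcomp_add)

section \<open>Homogeneous components of products\<close>

lemma mdeg_superset:
  assumes "finite S" "Poly_Mapping.keys m \<subseteq> S" shows "mdeg m = (\<Sum>i\<in>S. Poly_Mapping.lookup m i)"
  unfolding mdeg_def using assms by (intro sum.mono_neutral_left) (auto simp: in_keys_iff)

lemma mdeg_single_add: "mdeg (Poly_Mapping.single i 1 + m) = Suc (mdeg m)"
proof -
  define S where "S = insert i (Poly_Mapping.keys m)"
  have S: "finite S" "Poly_Mapping.keys m \<subseteq> S" "Poly_Mapping.keys (Poly_Mapping.single i 1 + m) \<subseteq> S"
    using keys_add[of "Poly_Mapping.single i 1" m] by (auto simp: S_def)
  have "(\<Sum>j\<in>S. Poly_Mapping.lookup (Poly_Mapping.single i 1) j) = (1::nat)"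
    using S(1) by (simp add: lookup_single when_def S_def)
  then show ?thesis
    by (simp add: mdeg_superset[OF S(1,2)] mdeg_superset[OF S(1,3)] lookup_add sum.distrib
        del: One_nat_def)
qed

lemma hcomp_frag: "hcomp d n (Poly_Mapping.single m 1)
    = (if Poly_Mapping.keys m \<subseteq> {..<d} \<and> mdeg m = n then Poly_Mapping.single m 1 else 0)"
  by (rule poly_mapping_eqI) (auto simp: lookup_hcomp lookup_single when_def)

lemma keys_single_add: "Poly_Mapping.keys (Poly_Mapping.single i 1 + m) = insert i (Poly_Mapping.keys (m :: nat \<Rightarrow>\<^sub>0 nat))"
  by (auto simp: in_keys_iff lookup_add lookup_single when_def split: if_splits)

lemma hcomp_Var_0: "hcomp d 0 (Var i * f) = 0"
proof (rule frag_induction[of f UNIV])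
  fix m show "hcomp d 0 (Var i * Poly_Mapping.single m 1) = 0"
    by (simp add: Var_def mult_single hcomp_frag mdeg_single_add[simplified])
qed (auto simp: hcomp_diff right_diff_distrib)

lemma hcomp_Var_Suc: "i < d \<Longrightarrow> hcomp d (Suc n) (Var i * f) = Var i * hcomp d n f"
proof (rule frag_induction[of f UNIV])
  fix m assume "i < d"
  then show "hcomp d (Suc n) (Var i * Poly_Mapping.single m 1) = Var i * hcomp d n (Poly_Mapping.single m 1)"
    by (simp add: Var_def mult_single hcomp_frag mdeg_single_add[simplified] keys_single_add[simplified])
qed (auto simp: hcomp_diff right_diff_distrib)

lemma hcomp_Lform_0: "hcomp d 0 (Lform d A h * f) = 0"
  by (simp add: Lform_def sum_distrib_right hcomp_sum hcomp_of_int hcomp_Var_0 mult.assoc del: of_int_sum)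

lemma hcomp_Lform_Suc: "hcomp d (Suc n) (Lform d A h * f) = Lform d A h * hcomp d n f"
  by (simp add: Lform_def sum_distrib_right hcomp_sum hcomp_of_int hcomp_Var_Suc mult.assoc del: of_int_sum)

lemma hcomp_Qform: "hcomp d n (Qform d A * f) = Qform d A * (case n of Suc (Suc k) \<Rightarrow> hcomp d k f | _ \<Rightarrow> 0)"
proof -
  have "hcomp d n (Var i * (Var j * f)) = Var i * (Var j * (case n of Suc (Suc k) \<Rightarrow> hcomp d k f | _ \<Rightarrow> 0))"
    if "i < d" "j < d" for i j
    using that by (auto simp: hcomp_Var_0 hcomp_Var_Suc split: nat.splits)
  then show ?thesis
    by (simp add: Qform_def sum_distrib_right hcomp_sum hcomp_of_int mult.assoc)
qed

section \<open>Regularity of linear forms on a quadric\<close>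

lemma det_int_eq_det: "det_int d A = Determinant.det (Matrix.mat d d (\<lambda>(i, j). A i j))"
proof -
  have "(\<Prod>i<d. A i (\<pi> i)) = (\<Prod>i<d. Matrix.mat d d (\<lambda>(i, j). A i j) $$ (i, \<pi> i))"
    if "\<pi> permutes {..<d}" for \<pi>
    using that permutes_in_image[OF that] by (intro prod.cong) auto
  then show ?thesis
    by (auto simp: det_int_def Determinant.det_def atLeast0LessThan intro!: sum.cong)
qed

text \<open>Multiplying the system by the adjugate gives \<open>det_int d A * y k\<close>, and the
  determinant is prime to \<open>p\<close>.\<close>

lemma kernel_mod_prime_trivial:
  assumes "prime (p :: int)" "\<not> p dvd det_int d A" "k < d"
    and "\<And>i. i < d \<Longrightarrow> p dvd (\<Sum>j<d. A i j * y j)"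
  shows "p dvd y k"
proof -
  define M where "M = Matrix.mat d d (\<lambda>(i, j). A i j)"
  have M: "M \<in> carrier_mat d d" by (simp add: M_def)
  have entry: "(\<Sum>i<d. adj_mat M $$ (k, i) * A i j) = (if k = j then Determinant.det M else 0)" if "j < d" for j
  proof -
    have "(\<Sum>i<d. adj_mat M $$ (k, i) * A i j) = (adj_mat M * M) $$ (k, j)"
      using adj_mat(1)[OF M] M assms(3) that by (auto simp: M_def scalar_prod_def atLeast0LessThan intro!: sum.cong)
    also have "\<dots> = (if k = j then Determinant.det M else 0)"
      unfolding adj_mat(3)[OF M] using assms(3) that by simp
    finally show ?thesis .
  qed
  have "(\<Sum>i<d. adj_mat M $$ (k, i) * (\<Sum>j<d. A i j * y j)) = (\<Sum>j<d. (\<Sum>i<d. adj_mat M $$ (k, i) * A i j) * y j)"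
    unfolding sum_distrib_left sum_distrib_right mult.assoc by (rule sum.swap)
  also have "\<dots> = (\<Sum>j<d. if k = j then Determinant.det M * y j else 0)"
    by (intro sum.cong) (auto simp: entry)
  also have "\<dots> = det_int d A * y k"
    using assms(3) by (simp add: det_int_eq_det M_def)
  finally have "p dvd det_int d A * y k"
    using assms(4) by (metis (no_types, lifting) dvd_mult dvd_sum lessThan_iff)
  then show ?thesis using assms(1,2) by (simp add: prime_dvd_mult_iff)
qed

section \<open>Linear polynomials and the two base ideals\<close>

definition vscale :: "int \<Rightarrow> (nat \<Rightarrow> int) \<Rightarrow> nat \<Rightarrow> int" where
  "vscale n v = (\<lambda>i. n * v i)"

definition dot :: "nat \<Rightarrow> (nat \<Rightarrow> int) \<Rightarrow> (nat \<Rightarrow> int) \<Rightarrow> int" where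
  "dot d a z = (\<Sum>i<d. a i * z i)"

definition zero_mod :: "int \<Rightarrow> nat \<Rightarrow> (nat \<Rightarrow> int) set" where
  "zero_mod p d = {v. \<forall>i<d. p dvd v i}"

definition multiples :: "int \<Rightarrow> mpoly set" where
  "multiples p = {f. of_int p dvd f}"

text \<open>Generated by \<open>p\<close> and the quadratic form, with cofactors from the polynomial
  ring in all variables.\<close>

definition quadric_ideal :: "int \<Rightarrow> nat \<Rightarrow> (nat \<Rightarrow> nat \<Rightarrow> int) \<Rightarrow> mpoly set" where
  "quadric_ideal p d A = {f. \<exists>b. of_int p dvd f - Qform d A * b}"

definition linear_poly :: "nat \<Rightarrow> (nat \<Rightarrow> int) \<Rightarrow> mpoly" where
  "linear_poly d a = (\<Sum>i<d. of_int (a i) * Var i)"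

lemma module_vscale: "Modules.module vscale"
  by unfold_locales (auto simp: vscale_def fun_eq_iff algebra_simps)

lemma in_multiples: "f \<in> multiples p \<longleftrightarrow> of_int p dvd f"
  by (simp add: multiples_def)

lemma in_quadric_ideal: "f \<in> quadric_ideal p d A \<longleftrightarrow> (\<exists>b. of_int p dvd f - Qform d A * b)"
  by (simp add: quadric_ideal_def)

lemma is_ideal_multiples: "is_ideal (multiples p)"
  by (auto simp: multiples_def intro!: is_idealI)

lemma is_ideal_quadric_ideal: "is_ideal (quadric_ideal p d A)"
proof (rule is_idealI)
  show "0 \<in> quadric_ideal p d A" by (auto simp: quadric_ideal_def intro!: exI[of _ 0])
next
  fix f g assume "f \<in> quadric_ideal p d A" "g \<in> quadric_ideal p d A"
  then obtain b c where "of_int p dvd f - Qform d A * b" "of_int p dvd g - Qform d A * c"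
    by (auto simp: quadric_ideal_def)
  then have "of_int p dvd (f - Qform d A * b) + (g - Qform d A * c)" by (rule dvd_add)
  then have "of_int p dvd f + g - Qform d A * (b + c)" by (simp add: algebra_simps)
  then show "f + g \<in> quadric_ideal p d A" unfolding quadric_ideal_def by blast
next
  fix a f assume "f \<in> quadric_ideal p d A"
  then obtain b where "of_int p dvd f - Qform d A * b" by (auto simp: quadric_ideal_def)
  then have "of_int p dvd a * (f - Qform d A * b)" by (rule dvd_mult)
  then have "of_int p dvd a * f - Qform d A * (a * b)" by (simp add: algebra_simps)
  then show "a * f \<in> quadric_ideal p d A" unfolding quadric_ideal_def by blast
qed

lemma Lform_eq_linear_poly: "Lform d A h = linear_poly d (\<lambda>j. \<Sum>i<d. h i * A i j)"
  by (simp add: Lform_def linear_poly_def)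

lemma linear_poly_add: "linear_poly d (a + b) = linear_poly d a + linear_poly d b"
  by (simp add: linear_poly_def algebra_simps sum.distrib)

lemma linear_poly_scale: "of_int k * linear_poly d a = linear_poly d (\<lambda>i. k * a i)"
  by (simp add: linear_poly_def sum_distrib_left mult.assoc)

lemma Lform_add: "Lform d A (u + v) = Lform d A u + Lform d A v"
proof -
  have "(\<lambda>j. \<Sum>i<d. (u + v) i * A i j) = (\<lambda>j. \<Sum>i<d. u i * A i j) + (\<lambda>j. \<Sum>i<d. v i * A i j)"
    by (auto simp: fun_eq_iff algebra_simps sum.distrib)
  then show ?thesis by (simp add: Lform_eq_linear_poly linear_poly_add)
qed

lemma single_one_eq_iff [simp]:
  "Poly_Mapping.single i (Suc 0) = Poly_Mapping.single j (Suc 0) \<longleftrightarrow> i = j"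
proof
  assume "Poly_Mapping.single i (Suc 0) = Poly_Mapping.single j (Suc 0)"
  then have "Poly_Mapping.keys (Poly_Mapping.single i (Suc 0)) = Poly_Mapping.keys (Poly_Mapping.single j (Suc 0))"
    by simp
  then show "i = j" by simp
qed simp

lemma linear_poly_lookup:
  "Poly_Mapping.lookup (linear_poly d a) (Poly_Mapping.single j 1) = (if j < d then a j else 0)"
proof -
  have "Poly_Mapping.lookup (linear_poly d a) (Poly_Mapping.single j 1) = (\<Sum>i<d. if i = j then a i else 0)"
    unfolding linear_poly_def lookup_sum
    by (intro sum.cong refl) (auto simp: lookup_of_int_mult Var_def lookup_single when_def)
  then show ?thesis by simp
qed

lemma linear_poly_dvd_iff: "of_int p dvd linear_poly d a \<longleftrightarrow> (\<forall>i<d. p dvd a i)"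
proof
  assume "of_int p dvd linear_poly d a"
  then show "\<forall>i<d. p dvd a i" unfolding of_int_dvd_iff using linear_poly_lookup by metis
next
  assume "\<forall>i<d. p dvd a i"
  then show "of_int p dvd linear_poly d a" unfolding linear_poly_def
    by (intro dvd_sum dvd_mult2) (auto simp: dvd_def)
qed

lemma hcomp_one: "hcomp d 0 1 = 1"
  using hcomp_frag[of d 0 0] by (simp add: mdeg_def)

lemma hcomp_Lform: "hcomp d 1 (Lform d A h) = Lform d A h"
  using hcomp_Lform_Suc[of d 0 A h 1] by (simp add: hcomp_one)

lemma hcomp_dvd: "of_int p dvd f \<Longrightarrow> of_int p dvd hcomp d n f"
  by (auto simp: of_int_dvd_iff lookup_hcomp)

lemma hcomp_zero_const: "hcomp d 0 f = of_int (Poly_Mapping.lookup f 0)"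
proof (rule poly_mapping_eqI)
  fix m :: "nat \<Rightarrow>\<^sub>0 nat"
  have "m = 0" if "mdeg m = 0"
    using that by (intro poly_mapping_eqI) (auto simp: mdeg_def in_keys_iff)
  moreover have "mdeg 0 = 0" by (simp add: mdeg_def)
  ultimately show "Poly_Mapping.lookup (hcomp d 0 f) m = Poly_Mapping.lookup (of_int (Poly_Mapping.lookup f 0)) m"
    by (auto simp: lookup_hcomp lookup_of_int when_def)
qed

lemma hcomp_one_linear: "hcomp d 1 f = linear_poly d (\<lambda>j. Poly_Mapping.lookup f (Poly_Mapping.single j 1))"
proof (rule poly_mapping_eqI)
  fix m :: "nat \<Rightarrow>\<^sub>0 nat"
  let ?l = "linear_poly d (\<lambda>j. Poly_Mapping.lookup f (Poly_Mapping.single j 1))"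
  show "Poly_Mapping.lookup (hcomp d 1 f) m = Poly_Mapping.lookup ?l m"
  proof (cases "\<exists>j. m = Poly_Mapping.single j 1")
    case True
    then obtain j where m: "m = Poly_Mapping.single j 1" by auto
    have "mdeg m = 1" by (simp add: m mdeg_def)
    then show ?thesis unfolding m linear_poly_lookup by (simp add: lookup_hcomp)
  next
    case False
    have "mdeg m \<noteq> 1"
    proof
      assume "mdeg m = 1"
      then have "\<exists>j\<in>Poly_Mapping.keys m. Poly_Mapping.lookup m j = 1
          \<and> (\<forall>i\<in>Poly_Mapping.keys m. j \<noteq> i \<longrightarrow> Poly_Mapping.lookup m i = 0)"
        unfolding mdeg_def by (subst (asm) sum_eq_1_iff) auto
      then obtain j where j: "j \<in> Poly_Mapping.keys m" "Poly_Mapping.lookup m j = 1"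
        "\<And>i. i \<in> Poly_Mapping.keys m \<Longrightarrow> j \<noteq> i \<Longrightarrow> Poly_Mapping.lookup m i = 0"
        by blast
      then have "m = Poly_Mapping.single j 1"
        by (intro poly_mapping_eqI) (auto simp: lookup_single when_def in_keys_iff)
      with False show False by blast
    qed
    moreover have "Poly_Mapping.lookup ?l m = 0"
      using False unfolding linear_poly_def lookup_sum
      by (intro sum.neutral) (auto simp: lookup_of_int_mult Var_def lookup_single when_def)
    ultimately show ?thesis by (simp add: lookup_hcomp)
  qed
qed

lemma poly_eval_linear_poly: "poly_eval z (linear_poly d a) = dot d a z"
  by (simp add: linear_poly_def dot_def poly_eval_sum poly_eval_mult)

lemma poly_eval_Qform: "poly_eval z (Qform d A) = (\<Sum>i<d. z i * (\<Sum>j<d. A i j * z j))"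
  by (simp add: Qform_def poly_eval_sum poly_eval_mult sum_distrib_left mult_ac)

lemma dot_add: "dot d a (y + z) = dot d a y + dot d a z"
  by (simp add: dot_def algebra_simps sum.distrib)

text \<open>Pigeonhole: fewer than \<open>d\<close> forms have fewer than \<open>p ^ d\<close>
  tuples of values modulo \<open>p\<close>, so two points of the cube share their values and their
  difference is a common zero.\<close>

lemma exists_common_zero_mod:
  fixes p :: int
  assumes "prime p" "length \<phi>s < d"
  obtains y i where "i < d" "\<not> p dvd y i" "\<And>\<phi>. \<phi> \<in> set \<phi>s \<Longrightarrow> p dvd dot d \<phi> y"
proof -
  define F where "F = PiE {..<d} (\<lambda>_. {0..<p})"
  define G where "G y = map (\<lambda>\<phi>. dot d \<phi> y mod p) \<phi>s" for y
  define C where "C = {xs. set xs \<subseteq> {0..<p} \<and> length xs = length \<phi>s}"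
  have p: "p > 1" using assms(1) by (simp add: prime_gt_1_int)
  have "card F = nat p ^ d" by (simp add: F_def card_PiE)
  moreover have "card C = nat p ^ length \<phi>s" by (simp add: C_def card_lists_length_eq)
  moreover have "nat p ^ length \<phi>s < nat p ^ d" using p assms(2) by (intro power_strict_increasing) auto
  ultimately have less: "card C < card F" by simp
  have "finite C" by (simp add: C_def finite_lists_length_eq)
  moreover have "G ` F \<subseteq> C" using p by (auto simp: G_def C_def)
  ultimately have "\<not> inj_on G F" using less card_inj_on_le[of G F C] by linarith
  then obtain y y' where y: "y \<in> F" "y' \<in> F" "G y = G y'" "y \<noteq> y'" by (auto simp: inj_on_def)
  then obtain i where i: "i < d" "y i \<noteq> y' i"
    using PiE_ext[of y "{..<d}" "\<lambda>_. {0..<p}" y'] by (auto simp: F_def)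
  then have b: "y i \<in> {0..<p}" "y' i \<in> {0..<p}" using y PiE_mem by (fastforce simp: F_def)+
  show ?thesis
  proof (rule that[of i "y - y'"])
    have "\<bar>y i - y' i\<bar> < p" using b by auto
    then show "\<not> p dvd (y - y') i" using i zdvd_imp_le[of p "\<bar>y i - y' i\<bar>"] by auto
    fix \<phi> assume "\<phi> \<in> set \<phi>s"
    then have "dot d \<phi> y mod p = dot d \<phi> y' mod p" using y(3) by (auto simp: G_def)
    moreover have "dot d \<phi> (y - y') = dot d \<phi> y - dot d \<phi> y'"
      using dot_add[of d \<phi> "y - y'" y'] by simp
    ultimately show "p dvd dot d \<phi> (y - y')" by (simp add: mod_eq_dvd_iff)
  qed (rule i)
qed

text \<open>The bound \<open>7 \<le> d\<close> exceeds the six linear factors that occur in three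
  products, and odd \<open>p\<close> permits polarisation. Nondegeneracy enters as triviality of the
  kernel.\<close>

locale quadric =
  fixes p :: int and d :: nat and A :: "nat \<Rightarrow> nat \<Rightarrow> int"
  assumes prime_p': "prime p" and p_odd: "p > 2" and d_large: "7 \<le> d"
    and A_sym: "i < d \<Longrightarrow> j < d \<Longrightarrow> A i j = A j i"
    and A_nondeg: "\<lbrakk>\<And>i. i < d \<Longrightarrow> p dvd (\<Sum>j<d. A i j * y j); k < d\<rbrakk> \<Longrightarrow> p dvd y k"
begin

text \<open>Ideals of linear forms alone, whose primality comes from eliminating variables.\<close>

sublocale P: linear_forms vscale p "multiples p" "Lform d A" "zero_mod p d" "hcomp d"
proof -
  interpret Modules.module vscale by (rule module_vscale)
  show "linear_forms vscale p (multiples p) (Lform d A) (zero_mod p d) (hcomp d)"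
    by unfold_locales
      (auto simp: prime_p' is_ideal_multiples Lform_add hcomp_add hcomp_hcomp hcomp_Lform_0
        hcomp_Lform_Suc hcomp_dvd zero_mod_def vscale_def in_multiples)
qed

text \<open>The same forms with the quadratic form adjoined, the setting of the cocycle
  argument.\<close>

sublocale Q: linear_forms vscale p "quadric_ideal p d A" "Lform d A" "zero_mod p d" "hcomp d"
proof -
  interpret Modules.module vscale by (rule module_vscale)
  have "hcomp d n f \<in> quadric_ideal p d A" if f: "f \<in> quadric_ideal p d A" for n f
  proof -
    obtain b where "of_int p dvd f - Qform d A * b" using f by (auto simp: in_quadric_ideal)
    then have "of_int p dvd hcomp d n f - Qform d A * (case n of Suc (Suc k) \<Rightarrow> hcomp d k b | _ \<Rightarrow> 0)"
      using hcomp_dvd[of p "f - Qform d A * b" d n] by (simp add: hcomp_diff hcomp_Qform)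
    then show ?thesis unfolding in_quadric_ideal by blast
  qed
  moreover have "of_int p \<in> quadric_ideal p d A" by (auto simp: in_quadric_ideal intro!: exI[of _ 0])
  ultimately show "linear_forms vscale p (quadric_ideal p d A) (Lform d A) (zero_mod p d) (hcomp d)"
    by unfold_locales
      (auto simp: prime_p' is_ideal_quadric_ideal Lform_add hcomp_add hcomp_hcomp hcomp_Lform_0
        hcomp_Lform_Suc zero_mod_def vscale_def)
qed

lemma Q_J_iff: "f \<in> Q.J us \<longleftrightarrow> (\<exists>b. f - Qform d A * b \<in> P.J us)"
proof (induction us arbitrary: f)
  case Nil
  show ?case by (simp add: in_quadric_ideal in_multiples)
next
  case (Cons u us)
  show ?case
  proof
    assume "f \<in> Q.J (u # us)"
    then obtain a g where f: "f = Lform d A u * a + g" and "g \<in> Q.J us" by (rule Q.J_ConsE)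
    then obtain b where "g - Qform d A * b \<in> P.J us" using Cons by auto
    then have "f - Qform d A * b \<in> P.J (u # us)"
      by (rule P.J_ConsI[where a = a]) (simp add: f)
    then show "\<exists>b. f - Qform d A * b \<in> P.J (u # us)" ..
  next
    assume "\<exists>b. f - Qform d A * b \<in> P.J (u # us)"
    then obtain b where "f - Qform d A * b \<in> P.J (u # us)" ..
    then obtain a g where f: "f - Qform d A * b = Lform d A u * a + g" and g: "g \<in> P.J us"
      by (rule P.J_ConsE)
    have "(g + Qform d A * b) - Qform d A * b \<in> P.J us" using g by simp
    then have "g + Qform d A * b \<in> Q.J us" using Cons by blast
    then show "f \<in> Q.J (u # us)" by (rule Q.J_ConsI[where a = a]) (use f in \<open>simp add: algebra_simps\<close>)
  qed
qed

lemma Lform_dvd: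
  assumes "of_int p dvd Lform d A z" shows "z \<in> zero_mod p d"
proof -
  have "p dvd (\<Sum>j<d. A i j * z j)" if "i < d" for i
  proof -
    have "p dvd (\<Sum>j<d. z j * A j i)"
      using assms that unfolding Lform_eq_linear_poly linear_poly_dvd_iff by blast
    also have "(\<Sum>j<d. z j * A j i) = (\<Sum>j<d. A i j * z j)"
      using that by (intro sum.cong) (auto simp: A_sym mult.commute)
    finally show ?thesis .
  qed
  then show ?thesis using A_nondeg by (auto simp: zero_mod_def)
qed

primrec lin_span :: "(nat \<Rightarrow> int) list \<Rightarrow> (nat \<Rightarrow> int) set" where
  "lin_span [] = {0}"
| "lin_span (u # us) = {vscale k u + v | k v. v \<in> lin_span us}"

text \<open>In degree one a cofactor contributes only its constant term.\<close>

lemma linear_part_in_span: "f \<in> P.J us \<Longrightarrow> \<exists>v\<in>lin_span us. of_int p dvd hcomp d 1 f - Lform d A v"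
proof (induction us arbitrary: f)
  case Nil
  then have "of_int p dvd f" by (simp add: in_multiples)
  then have "of_int p dvd hcomp d 1 f - Lform d A 0" unfolding P.Lam_0 diff_0_right by (rule hcomp_dvd)
  moreover have "0 \<in> lin_span []" by simp
  ultimately show ?case by blast
next
  case (Cons u us)
  then obtain a g where f: "f = Lform d A u * a + g" and "g \<in> P.J us" by (auto elim: P.J_ConsE)
  then obtain v where v: "v \<in> lin_span us" "of_int p dvd hcomp d 1 g - Lform d A v" using Cons by blast
  have "hcomp d 1 f = of_int (Poly_Mapping.lookup a 0) * Lform d A u + hcomp d 1 g"
    using hcomp_Lform_Suc[of d 0 A u a] by (simp add: f hcomp_add hcomp_zero_const mult.commute)
  then have "hcomp d 1 f - Lform d A (vscale (Poly_Mapping.lookup a 0) u + v) = hcomp d 1 g - Lform d A v"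
    by (simp add: P.Lam_add P.Lam_scale)
  then have "of_int p dvd hcomp d 1 f - Lform d A (vscale (Poly_Mapping.lookup a 0) u + v)"
    using v(2) by simp
  moreover have "vscale (Poly_Mapping.lookup a 0) u + v \<in> lin_span (u # us)" using v(1) by auto
  ultimately show ?case by blast
qed

lemma Lform_in_J_dependent:
  assumes "Lform d A w \<in> P.J us" obtains v where "v \<in> lin_span us" "w - v \<in> zero_mod p d"
proof -
  obtain v where "v \<in> lin_span us" "of_int p dvd hcomp d 1 (Lform d A w) - Lform d A v"
    using linear_part_in_span[OF assms] by blast
  then show ?thesis using that[of v] Lform_dvd[of "w - v"] unfolding hcomp_Lform P.Lam_diff by blast
qed

text \<open>In degree two a cofactor contributes only its linear part, hence one product of linear
  forms per generator.\<close>

lemma quadratic_part_bilinear: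
  "f \<in> P.J us \<Longrightarrow> \<exists>ps. length ps = length us \<and>
    (\<forall>z. p dvd poly_eval z (hcomp d 2 f) - (\<Sum>(a, b)\<leftarrow>ps. dot d a z * dot d b z))"
proof (induction us arbitrary: f)
  case Nil
  then have "p dvd poly_eval z (hcomp d 2 f)" for z :: "nat \<Rightarrow> int"
    using poly_eval_dvd[OF hcomp_dvd, of p f z d 2] by (simp add: in_multiples)
  then show ?case by simp
next
  case (Cons u us)
  then obtain a g where f: "f = Lform d A u * a + g" and "g \<in> P.J us" by (auto elim: P.J_ConsE)
  then obtain ps where ps: "length ps = length us"
    "\<And>z. p dvd poly_eval z (hcomp d 2 g) - (\<Sum>(a, b)\<leftarrow>ps. dot d a z * dot d b z)"
    using Cons.IH by blast
  define a' where "a' = (\<lambda>j. \<Sum>i<d. u i * A i j)"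
  define b' where "b' = (\<lambda>j. Poly_Mapping.lookup a (Poly_Mapping.single j 1))"
  have "hcomp d 2 f = linear_poly d a' * linear_poly d b' + hcomp d 2 g"
    using hcomp_Lform_Suc[of d 1 A u a]
    by (simp add: f hcomp_add hcomp_one_linear[simplified] Lform_eq_linear_poly a'_def b'_def numeral_2_eq_2)
  then have eq: "poly_eval z (hcomp d 2 f) - (\<Sum>(a, b)\<leftarrow>(a', b') # ps. dot d a z * dot d b z)
      = poly_eval z (hcomp d 2 g) - (\<Sum>(a, b)\<leftarrow>ps. dot d a z * dot d b z)" for z :: "nat \<Rightarrow> int"
    by (simp add: poly_eval_add poly_eval_mult poly_eval_linear_poly)
  show ?case using ps by (intro exI[of _ "(a', b') # ps"] conjI allI) (simp, simp only: eq)
qed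

text \<open>If \<open>M = \<Sum>\<^sub>k a\<^sub>k b\<^sub>k\<close> with fewer than \<open>d / 2\<close> products of linear forms, then a common zero of all
  \<open>a\<^sub>k, b\<^sub>k\<close> lies in the radical of \<open>M\<close>.\<close>
lemma Qform_notin_J:
  assumes "length us \<le> 3" shows "Qform d A \<notin> P.J us"
proof
  assume "Qform d A \<in> P.J us"
  moreover have "hcomp d 2 (Qform d A) = Qform d A"
    using hcomp_Qform[of d 2 A 1] by (simp add: hcomp_one numeral_2_eq_2)
  ultimately obtain ps where ps: "length ps = length us"
    "\<And>z. p dvd poly_eval z (Qform d A) - (\<Sum>(a, b)\<leftarrow>ps. dot d a z * dot d b z)"
    using quadratic_part_bilinear by metis
  \<comment> \<open>At most three products give at most six forms, fewer than
    \<open>d\<close>.\<close>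
  have "length (map fst ps @ map snd ps) < d" using ps(1) assms d_large by simp
  then obtain y i where y: "i < d" "\<not> p dvd y i"
    "\<And>\<phi>. \<phi> \<in> set (map fst ps @ map snd ps) \<Longrightarrow> p dvd dot d \<phi> y"
    by (rule exists_common_zero_mod[OF prime_p']) blast
  have "p dvd (\<Sum>j<d. A k j * y j)" if k: "k < d" for k
  proof -
    \<comment> \<open>Polarising at this unit vector and \<open>y\<close> reads off twice the
      \<open>k\<close>-th coordinate of the matrix applied to \<open>y\<close>.\<close>
    define z where "z = (\<lambda>i. if i = k then 1 else 0 :: int)"
    let ?S = "\<lambda>z. \<Sum>(a, b)\<leftarrow>ps. dot d a z * dot d b z"
    let ?q = "\<lambda>z. poly_eval z (Qform d A)"
    define x where "x = z + y"
    have x: "dot d \<phi> x = dot d \<phi> z + dot d \<phi> y" for \<phi> by (simp only: x_def dot_add)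
    \<comment> \<open>Every cross term contains a factor evaluated at \<open>y\<close>, which is
      divisible by \<open>p\<close>.\<close>
    have "p dvd ?S x - ?S z - ?S y"
      using y(3)
    proof (induction ps)
      case (Cons ab ps)
      obtain a b where ab: "ab = (a, b)" by force
      have "p dvd dot d a y" "p dvd dot d b y" using Cons.prems by (auto simp: ab)
      then have "p dvd dot d a z * dot d b y + dot d a y * dot d b z" by simp
      moreover have "p dvd (\<Sum>(a, b)\<leftarrow>ps. dot d a x * dot d b x)
          - (\<Sum>(a, b)\<leftarrow>ps. dot d a z * dot d b z) - (\<Sum>(a, b)\<leftarrow>ps. dot d a y * dot d b y)"
        using Cons by auto
      ultimately have "p dvd (dot d a z * dot d b y + dot d a y * dot d b z)
          + ((\<Sum>(a, b)\<leftarrow>ps. dot d a x * dot d b x)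
          - (\<Sum>(a, b)\<leftarrow>ps. dot d a z * dot d b z) - (\<Sum>(a, b)\<leftarrow>ps. dot d a y * dot d b y))"
        by (rule dvd_add)
      then show ?case by (simp add: ab x[of a] x[of b] algebra_simps)
    qed simp
    moreover have "p dvd (?q x - ?S x) - (?q z - ?S z) - (?q y - ?S y)"
      by (intro dvd_diff ps)
    ultimately have "p dvd (?S x - ?S z - ?S y)
        + ((?q x - ?S x) - (?q z - ?S z) - (?q y - ?S y))"
      by (rule dvd_add)
    then have "p dvd ?q x - ?q z - ?q y" by (simp add: algebra_simps)
    also have "?q x - ?q z - ?q y
        = (\<Sum>i<d. \<Sum>j<d. z i * (A i j * y j)) + (\<Sum>i<d. \<Sum>j<d. y i * (A i j * z j))"
      by (simp add: x_def poly_eval_Qform sum_distrib_left algebra_simps sum.distrib)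
    also have "(\<Sum>i<d. \<Sum>j<d. y i * (A i j * z j)) = (\<Sum>j<d. \<Sum>i<d. z j * (A j i * y i))"
      by (subst sum.swap) (intro sum.cong refl, simp add: A_sym mult_ac)
    also have "(\<Sum>i<d. \<Sum>j<d. z i * (A i j * y j)) = (\<Sum>i<d. if i = k then \<Sum>j<d. A i j * y j else 0)"
      by (intro sum.cong refl) (simp add: z_def)
    also have "\<dots> = (\<Sum>j<d. A k j * y j)" using k by simp
    finally have "p dvd 2 * (\<Sum>j<d. A k j * y j)" by simp
    moreover have "\<not> p dvd 2" using p_odd zdvd_imp_le[of p 2] by auto
    ultimately show ?thesis using prime_p' by (simp add: prime_dvd_mult_iff)
  qed
  then show False using A_nondeg y(1,2) by blast
qed

section \<open>Elimination of variables\<close>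

text \<open>\<open>g\<close> solves the equations of \<open>us\<close> for some of the variables. It
  kills \<open>P.J us\<close> modulo \<open>p\<close> and is the identity modulo
  \<open>P.J us\<close>, so this ideal is the kernel of a homomorphism. Linear images allow a
  further form to be eliminated.\<close>

definition eliminates :: "(nat \<Rightarrow> int) list \<Rightarrow> (nat \<Rightarrow> mpoly) \<Rightarrow> bool" where
  "eliminates us g \<longleftrightarrow> (\<forall>f\<in>P.J us. of_int p dvd poly_eval g f)
    \<and> (\<forall>i. g i - Var i \<in> P.J us) \<and> (\<forall>i<d. \<exists>a. g i = linear_poly d a)"

lemma eliminates_iff:
  assumes "eliminates us g" shows "f \<in> P.J us \<longleftrightarrow> of_int p dvd poly_eval g f"
proof
  assume "of_int p dvd poly_eval g f"
  then have "poly_eval g f \<in> P.J us" by (intro P.I_subset_J) (simp add: in_multiples)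
  moreover have "poly_eval g f - f \<in> P.J us"
    using assms by (intro poly_eval_cong_ideal P.ideal_J) (auto simp: eliminates_def)
  ultimately have "poly_eval g f - (poly_eval g f - f) \<in> P.J us" by (rule is_ideal_diff[OF P.ideal_J])
  then show "f \<in> P.J us" by simp
qed (use assms in \<open>auto simp: eliminates_def\<close>)

text \<open>The kernel of a homomorphism into a domain is prime.\<close>

lemma eliminates_prime:
  assumes "eliminates us g" "f * h \<in> P.J us" shows "f \<in> P.J us \<or> h \<in> P.J us"
  using assms(2) prime_of_int_dvd_mult[OF prime_p'] unfolding eliminates_iff[OF assms(1)]
  by (simp add: poly_eval_mult)

lemma eliminates_Nil: "eliminates [] Var"
proof -
  have "poly_eval Var f = f" for f
    using poly_eval_cong_ideal[of "{0}" Var f] by (auto simp: is_ideal_def)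
  moreover have "Var i = linear_poly d (\<lambda>j. if j = i then 1 else 0)" if "i < d" for i
  proof -
    have "linear_poly d (\<lambda>j. if j = i then 1 else 0) = (\<Sum>j<d. if j = i then Var j else 0)"
      unfolding linear_poly_def by (intro sum.cong) auto
    then show ?thesis using that by simp
  qed
  ultimately show ?thesis by (auto simp: eliminates_def in_multiples)
qed

lemma poly_eval_linear_poly_sum: "poly_eval g (linear_poly d a) = (\<Sum>i<d. of_int (a i) * g i)"
  by (simp add: linear_poly_def poly_eval_sum poly_eval_mult)

lemma sum_linear_poly:
  assumes "\<And>i. i < d \<Longrightarrow> \<exists>a. g i = linear_poly d a"
  shows "\<exists>a. (\<Sum>i<d. of_int (c i) * g i) = linear_poly d a"
proof -
  have "\<exists>a. (\<Sum>i<n. of_int (c i) * g i) = linear_poly d a" if "n \<le> d" for n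
    using that
  proof (induction n)
    case 0
    show ?case by (rule exI[of _ "\<lambda>_. 0"]) (simp add: linear_poly_def)
  next
    case (Suc n)
    then obtain a where "(\<Sum>i<n. of_int (c i) * g i) = linear_poly d a" by auto
    moreover obtain b where "g n = linear_poly d b" using assms[of n] Suc.prems by auto
    ultimately have "(\<Sum>i<Suc n. of_int (c i) * g i) = linear_poly d (a + (\<lambda>i. c n * b i))"
      by (simp add: linear_poly_scale linear_poly_add)
    then show ?case by blast
  qed
  then show ?thesis by blast
qed

text \<open>The image of the new form under \<open>g\<close> has a coefficient \<open>a k\<close>
  prime to \<open>p\<close>, so \<open>g\<close> can be followed by the substitution that solves it
  for the variable of index \<open>k\<close>.\<close>

lemma eliminates_Cons:
  assumes el: "eliminates us g" and w: "Lform d A w \<notin> P.J us"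
  shows "\<exists>g'. eliminates (w # us) g'"
proof -
  have "\<exists>a. poly_eval g (Lform d A w) = linear_poly d a"
    unfolding Lform_eq_linear_poly poly_eval_linear_poly_sum
    by (rule sum_linear_poly) (use el in \<open>simp add: eliminates_def\<close>)
  then obtain a where a: "poly_eval g (Lform d A w) = linear_poly d a" ..
  have "\<not> of_int p dvd linear_poly d a" using w unfolding eliminates_iff[OF el] a .
  then obtain k where k: "k < d" "\<not> p dvd a k" by (auto simp: linear_poly_dvd_iff)
  then have "coprime p (a k)" using prime_p' by (simp add: prime_imp_coprime)
  then obtain e b where eb: "e * p + b * a k = 1" by (metis bezout_int coprime_imp_gcd_eq_1)
  \<comment> \<open>\<open>b\<close> inverts \<open>a k\<close> modulo \<open>p\<close>, so
    \<open>\<tau>\<close> multiplies the linear form by \<open>1 - a k * b\<close>, a multiple of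
    \<open>p\<close>.\<close>
  define \<tau> where "\<tau> = Var(k := Var k - of_int b * linear_poly d a)"
  define g' where "g' i = poly_eval \<tau> (g i)" for i
  have sub: "f \<in> P.J us \<Longrightarrow> f \<in> P.J (w # us)" for f by (rule P.J_tail)
  have "poly_eval g (Lform d A w) - Lform d A w \<in> P.J us"
    using el by (intro poly_eval_cong_ideal P.ideal_J) (auto simp: eliminates_def)
  then have "poly_eval g (Lform d A w) - Lform d A w + Lform d A w \<in> P.J (w # us)"
    by (intro is_ideal_add[OF P.ideal_J] sub P.Lam_in_J) auto
  then have lin: "linear_poly d a \<in> P.J (w # us)" by (simp add: a)
  have \<tau>: "\<tau> i - Var i \<in> P.J (w # us)" for i
    using is_ideal_mult[OF P.ideal_J lin, of "- of_int b"] is_ideal_0[OF P.ideal_J, of "w # us"]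
    by (simp add: \<tau>_def del: P.J.simps)
  have "poly_eval \<tau> (linear_poly d a) = (\<Sum>i<d. of_int (a i) * Var i - (if i = k then of_int (a k * b) * linear_poly d a else 0))"
    unfolding poly_eval_linear_poly_sum by (intro sum.cong refl) (simp add: \<tau>_def algebra_simps)
  also have "\<dots> = linear_poly d a - of_int (a k * b) * linear_poly d a"
    using k(1) by (simp add: sum_subtractf linear_poly_def)
  also have "\<dots> = of_int (1 - a k * b) * linear_poly d a" by (simp add: algebra_simps)
  also have "1 - a k * b = e * p" using eb by (simp add: algebra_simps)
  finally have \<tau>_lin: "of_int p dvd poly_eval \<tau> (linear_poly d a)" by simp
  have "of_int p dvd poly_eval g' f" if f: "f \<in> P.J (w # us)" for f
  proof -
    obtain c h where ch: "f = Lform d A w * c + h" "h \<in> P.J us" using f by (rule P.J_ConsE)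
    have "poly_eval g' f = poly_eval \<tau> (poly_eval g f)"
      unfolding g'_def by (rule poly_eval_poly_eval[symmetric])
    also have "\<dots> = poly_eval \<tau> (linear_poly d a) * poly_eval \<tau> (poly_eval g c) + poly_eval \<tau> (poly_eval g h)"
      by (simp add: ch poly_eval_add poly_eval_mult a)
    also have "of_int p dvd \<dots>"
      by (rule dvd_add[OF dvd_mult2[OF \<tau>_lin] poly_eval_dvd])
        (use el ch(2) in \<open>auto simp: eliminates_def\<close>)
    finally show ?thesis .
  qed
  moreover have "g' i - Var i \<in> P.J (w # us)" for i
  proof -
    have "poly_eval \<tau> (g i) - g i \<in> P.J (w # us)" by (rule poly_eval_cong_ideal[OF P.ideal_J \<tau>])
    moreover have "g i - Var i \<in> P.J (w # us)" using el by (intro sub) (auto simp: eliminates_def)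
    ultimately show ?thesis unfolding g'_def by (rule is_ideal_diff_trans[OF P.ideal_J])
  qed
  moreover have "\<exists>a. g' i = linear_poly d a" if "i < d" for i
  proof -
    obtain c where c: "g i = linear_poly d c" using el \<open>i < d\<close> by (auto simp: eliminates_def)
    have "\<exists>a. \<tau> j = linear_poly d a" if j: "j < d" for j
    proof -
      obtain v where v: "Var j = linear_poly d v" using eliminates_Nil j by (auto simp: eliminates_def)
      have "Var j - of_int b * linear_poly d a = linear_poly d (v + (\<lambda>i. - b * a i))"
        unfolding linear_poly_add linear_poly_scale[symmetric] v by simp
      then show ?thesis using v by (auto simp: \<tau>_def)
    qed
    then show ?thesis unfolding g'_def c poly_eval_linear_poly_sum by (rule sum_linear_poly)
  qed
  ultimately show ?thesis unfolding eliminates_def by blast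
qed

text \<open>\<open>Qform d A * b\<close> lies in the ideal of \<open>w # us\<close>, which is prime
  and, having at most three linear generators, misses the quadratic form. So
  \<open>b = Lform d A w * c + h\<close>, and \<open>Lform d A w\<close> can be cancelled from its
  product with \<open>f - Qform d A * c\<close> in the prime ideal of \<open>us\<close>.\<close>

lemma nzd_if_chain:
  assumes "eliminates us g" "Lform d A w \<notin> P.J us" "length us \<le> 2"
  shows "Q.nzd w us"
  unfolding Q.nzd_def
proof (intro allI impI)
  fix f assume "Lform d A w * f \<in> Q.J us"
  then obtain b where b: "Lform d A w * f - Qform d A * b \<in> P.J us" using Q_J_iff by blast
  have "Lform d A w * f - (Lform d A w * f - Qform d A * b) \<in> P.J (w # us)"
    by (intro is_ideal_diff[OF P.ideal_J P.Lam_mult_in_J] P.J_tail b)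
  then have "Qform d A * b \<in> P.J (w # us)" by simp
  then have "b \<in> P.J (w # us)"
    using eliminates_Cons[OF assms(1,2)] eliminates_prime Qform_notin_J[of "w # us"] assms(3) by fastforce
  then obtain c h where b_eq: "b = Lform d A w * c + h" and h: "h \<in> P.J us" by (rule P.J_ConsE)
  have "(Lform d A w * f - Qform d A * b) + Qform d A * h \<in> P.J us"
    by (intro is_ideal_add[OF P.ideal_J b] is_ideal_mult[OF P.ideal_J h])
  then have "Lform d A w * (f - Qform d A * c) \<in> P.J us" by (simp add: b_eq algebra_simps)
  then have "f - Qform d A * c \<in> P.J us" using eliminates_prime[OF assms(1)] assms(2) by blast
  then show "f \<in> Q.J us" unfolding Q_J_iff by blast
qed

text \<open>Independence places each form outside the linear ideal of those already eliminated, so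
  elimination proceeds from the end of the list.\<close>

sublocale Q: regular_linear_forms vscale p "quadric_ideal p d A" "Lform d A" "zero_mod p d" "hcomp d"
proof unfold_locales
  have not_one: "\<not> p dvd 1" using prime_p' by (auto simp: prime_int_iff)
  fix u w
  assume ind: "\<And>a b. vscale a u + vscale b w \<in> zero_mod p d \<Longrightarrow> p dvd a \<and> p dvd b"
  have "Lform d A u \<notin> P.J []"
  proof
    assume "Lform d A u \<in> P.J []"
    then obtain v where "v \<in> lin_span []" "u - v \<in> zero_mod p d" by (rule Lform_in_J_dependent)
    then have "vscale 1 u + vscale 0 w \<in> zero_mod p d" by (simp add: vscale_def zero_mod_def)
    then show False using ind not_one by blast
  qed
  then obtain g where g: "eliminates [u] g" using eliminates_Cons[OF eliminates_Nil] by blast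
  have "Lform d A w \<notin> P.J [u]"
  proof
    assume "Lform d A w \<in> P.J [u]"
    then obtain v where "v \<in> lin_span [u]" "w - v \<in> zero_mod p d" by (rule Lform_in_J_dependent)
    then obtain k where "w - vscale k u \<in> zero_mod p d" by auto
    then have "vscale (- k) u + vscale 1 w \<in> zero_mod p d" by (simp add: vscale_def zero_mod_def)
    then show False using ind not_one by blast
  qed
  then show "Q.nzd w [u]" using g by (intro nzd_if_chain) auto
next
  have not_one: "\<not> p dvd 1" using prime_p' by (auto simp: prime_int_iff)
  fix u v w
  assume ind: "\<And>a b c. vscale a u + vscale b v + vscale c w \<in> zero_mod p d \<Longrightarrow> p dvd a \<and> p dvd b \<and> p dvd c"
  have "Lform d A v \<notin> P.J []"
  proof
    assume "Lform d A v \<in> P.J []"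
    then obtain x where "x \<in> lin_span []" "v - x \<in> zero_mod p d" by (rule Lform_in_J_dependent)
    then have "vscale 0 u + vscale 1 v + vscale 0 w \<in> zero_mod p d" by (simp add: vscale_def zero_mod_def)
    then show False using ind not_one by blast
  qed
  then obtain g where g: "eliminates [v] g" using eliminates_Cons[OF eliminates_Nil] by blast
  have "Lform d A u \<notin> P.J [v]"
  proof
    assume "Lform d A u \<in> P.J [v]"
    then obtain x where "x \<in> lin_span [v]" "u - x \<in> zero_mod p d" by (rule Lform_in_J_dependent)
    then obtain k where "u - vscale k v \<in> zero_mod p d" by auto
    then have "vscale 1 u + vscale (- k) v + vscale 0 w \<in> zero_mod p d" by (simp add: vscale_def zero_mod_def)
    then show False using ind not_one by blast
  qed
  then obtain g where g: "eliminates [u, v] g" using eliminates_Cons[OF g] by blast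
  have "Lform d A w \<notin> P.J [u, v]"
  proof
    assume "Lform d A w \<in> P.J [u, v]"
    then obtain x where "x \<in> lin_span [u, v]" and x: "w - x \<in> zero_mod p d" by (rule Lform_in_J_dependent)
    then obtain k l where "x = vscale k u + (vscale l v + 0)" by (simp only: lin_span.simps) blast
    with x have "w - (vscale k u + vscale l v) \<in> zero_mod p d" by (simp only: add_0_right)
    then have "vscale (- k) u + vscale (- l) v + vscale 1 w \<in> zero_mod p d"
      by (simp add: vscale_def zero_mod_def algebra_simps)
    then show False using ind not_one by blast
  qed
  then show "Q.nzd w [u, v]" using g by (intro nzd_if_chain) auto
qed

end

section \<open>Progressions of positive density\<close>

text \<open>Turns the condition on coefficients into a congruence with the degree \<open>s\<close>
  component, which is linear in \<open>f\<close>.\<close>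

lemma HP_iff: "HP p d s f \<longleftrightarrow> of_int (int p) dvd f - hcomp d s f"
proof -
  have "int p dvd Poly_Mapping.lookup (f - hcomp d s f) m \<longleftrightarrow>
      (\<not> int p dvd Poly_Mapping.lookup f m \<longrightarrow> Poly_Mapping.keys m \<subseteq> {..<d} \<and> mdeg m = s)" for m
    by (auto simp: lookup_minus lookup_hcomp)
  then show ?thesis
    unfolding HP_def of_int_dvd_iff by (metis dvd_0_right in_keys_iff)
qed

lemma HP_add: "HP p d s f \<Longrightarrow> HP p d s g \<Longrightarrow> HP p d s (f + g)"
  unfolding HP_iff hcomp_add by (drule (1) dvd_add) (simp add: algebra_simps)

lemma HP_of_int_mult: "HP p d s f \<Longrightarrow> HP p d s (of_int k * f)"
  unfolding HP_iff hcomp_of_int right_diff_distrib[symmetric] by (rule dvd_mult)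

lemma HP_diff: "HP p d s f \<Longrightarrow> HP p d s g \<Longrightarrow> HP p d s (f - g)"
  using HP_add[of p d s f "of_int (-1) * g"] HP_of_int_mult[of p d s g "-1"] by simp

lemma HP_hcomp: "hcomp d s f = f \<Longrightarrow> HP p d s f"
  by (simp add: HP_iff)

lemma HP_sum: "(\<And>i. i \<in> S \<Longrightarrow> HP p d s (f i)) \<Longrightarrow> HP p d s (sum f S)"
  by (induction S rule: infinite_finite_induct) (auto intro: HP_add HP_hcomp)

lemma vars_in_hcomp: "vars_in d (hcomp d n f)"
  by (auto simp: vars_in_def in_keys_iff lookup_hcomp split: if_splits)

text \<open>Chooses representatives in the prime field. The cocycle argument itself runs on
  unreduced integer vectors, where sums are exact.\<close>

definition reduce :: "nat \<Rightarrow> nat \<Rightarrow> (nat \<Rightarrow> int) \<Rightarrow> nat \<Rightarrow> int" where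
  "reduce p d v = (\<lambda>i. if i < d then v i mod int p else 0)"

lemma Lform_reduce: "of_int (int p) dvd Lform d A (reduce p d v) - Lform d A v"
proof -
  have "Lform d A (reduce p d v) - Lform d A v = Lform d A (reduce p d v - v)"
    using Lform_add[of d A "reduce p d v - v" v] by simp
  also have "of_int (int p) dvd \<dots>"
    unfolding Lform_eq_linear_poly linear_poly_dvd_iff
    by (auto simp: reduce_def mod_eq_dvd_iff[symmetric] intro!: dvd_sum dvd_mult2)
  finally show ?thesis .
qed

locale prime_quadric = quadric "int p" d A for p :: nat and d A
begin

section \<open>Passing between \<open>Jmem\<close> and the abstract ideals\<close>

lemma Jmem_imp_J:
  assumes f: "Jmem p d A H f" and H: "\<And>h. h \<in> H \<Longrightarrow> Lform d A h \<in> Q.J us"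
  shows "f \<in> Q.J us"
proof -
  have Qf: "Qform d A \<in> Q.J us"
    by (rule Q.I_subset_J) (auto simp: in_quadric_ideal intro!: exI[of _ 1])
  obtain g where g: "g \<in> zideal d (insert (Qform d A) (Lform d A ` H))" and fg: "congp p f g"
    using f by (auto simp: Jmem_def)
  have "g \<in> Q.J us" using g
  proof induction
    case zero
    show ?case by (rule is_ideal_0[OF Q.ideal_J])
  next
    case (step g a f)
    then have "g \<in> Q.J us" using H Qf by auto
    then show ?case using step.IH by (intro is_ideal_add[OF Q.ideal_J] is_ideal_mult[OF Q.ideal_J])
  qed
  moreover have "f - g \<in> Q.J us"
    by (rule Q.I_subset_J) (use fg in \<open>auto simp: in_quadric_ideal congp_iff_dvd intro!: exI[of _ 0]\<close>)
  ultimately have "(f - g) + g \<in> Q.J us" by (intro is_ideal_add[OF Q.ideal_J])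
  then show ?thesis by simp
qed

lemma Lform_reduce_in_J: "Lform d A u \<in> Q.J us \<Longrightarrow> Lform d A (reduce p d u) \<in> Q.J us"
proof -
  assume "Lform d A u \<in> Q.J us"
  moreover have "Lform d A (reduce p d u) - Lform d A u \<in> Q.J us"
    by (rule Q.I_subset_J) (use Lform_reduce[of p d A u] in \<open>auto simp: in_quadric_ideal intro!: exI[of _ 0]\<close>)
  ultimately have "(Lform d A (reduce p d u) - Lform d A u) + Lform d A u \<in> Q.J us"
    by (intro is_ideal_add[OF Q.ideal_J])
  then show ?thesis by simp
qed

text \<open>Taking degree \<open>s\<close> components of a representation of \<open>f\<close> also
  removes the variables of index at least \<open>d\<close>, which makes the cofactors admissible for
  \<open>zideal\<close>.\<close>

lemma J_imp_Jmem:
  assumes f: "f \<in> Q.J [u]" and HP: "HP p d s f" shows "Jmem p d A {reduce p d u} f"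
proof -
  obtain a g where fa: "f = Lform d A u * a + g" and "g \<in> Q.J []" using f by (rule Q.J_ConsE)
  then obtain b where b: "of_int (int p) dvd g - Qform d A * b" by (auto simp: in_quadric_ideal)
  \<comment> \<open>The linear form raises the degree by one and the quadratic form by two; for
    smaller \<open>s\<close> the cofactor becomes 0.\<close>
  define a' where "a' = (case s of 0 \<Rightarrow> 0 | Suc k \<Rightarrow> hcomp d k a)"
  define b' where "b' = (case s of Suc (Suc k) \<Rightarrow> hcomp d k b | _ \<Rightarrow> 0)"
  have vars: "vars_in d a'" "vars_in d b'"
    by (auto simp: a'_def b'_def vars_in_hcomp split: nat.splits) (auto simp: vars_in_def)
  have La: "hcomp d s (Lform d A u * a) = Lform d A u * a'"
    by (cases s) (simp_all add: a'_def hcomp_Lform_0 hcomp_Lform_Suc)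
  have Qb: "hcomp d s (Qform d A * b) = Qform d A * b'"
    unfolding hcomp_Qform b'_def ..
  let ?G = "a' * Lform d A (reduce p d u) + (b' * Qform d A + 0)"
  have "?G \<in> zideal d (insert (Qform d A) (Lform d A ` {reduce p d u}))"
    by (intro zideal.intros vars) auto
  moreover have "congp p f ?G"
  proof -
    have "of_int (int p) dvd hcomp d s (g - Qform d A * b)" using b by (rule hcomp_dvd)
    then have "of_int (int p) dvd hcomp d s f - Lform d A u * a' - Qform d A * b'"
      by (simp add: fa hcomp_add hcomp_diff La Qb)
    moreover have "of_int (int p) dvd f - hcomp d s f" using HP by (simp only: HP_iff)
    moreover have "of_int (int p) dvd (Lform d A (reduce p d u) - Lform d A u) * a'"
      using Lform_reduce by (rule dvd_mult2)
    ultimately have "of_int (int p) dvd (hcomp d s f - Lform d A u * a' - Qform d A * b')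
        + (f - hcomp d s f) - (Lform d A (reduce p d u) - Lform d A u) * a'"
      by (rule dvd_diff[OF dvd_add])
    then show ?thesis unfolding congp_iff_dvd by (simp add: algebra_simps)
  qed
  ultimately show ?thesis unfolding Jmem_def by blast
qed

section \<open>Independent vectors by counting\<close>

definition span_mod :: "(nat \<Rightarrow> int) set \<Rightarrow> (nat \<Rightarrow> int) set" where
  "span_mod S = {v. \<exists>c. v - (\<Sum>w\<in>S. vscale (c w) w) \<in> zero_mod p d}"

lemma subgroup_span_mod: "Q.subgroup_over_Z (span_mod S)"
  unfolding Q.subgroup_over_Z_def
proof (intro conjI ballI allI subsetI)
  fix u assume "u \<in> zero_mod p d"
  then show "u \<in> span_mod S" unfolding span_mod_def by (intro CollectI exI[of _ "\<lambda>_. 0"]) simp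
next
  fix u v assume "u \<in> span_mod S" "v \<in> span_mod S"
  then obtain b c where "u - (\<Sum>w\<in>S. vscale (b w) w) \<in> zero_mod p d" "v - (\<Sum>w\<in>S. vscale (c w) w) \<in> zero_mod p d"
    by (auto simp: span_mod_def)
  from Q.Z_add[OF this] show "u + v \<in> span_mod S"
    unfolding span_mod_def
    by (intro CollectI exI[of _ "\<lambda>w. b w + c w"]) (simp add: P.scale_left_distrib sum.distrib algebra_simps)
next
  fix u n assume "u \<in> span_mod S"
  then obtain b where "u - (\<Sum>w\<in>S. vscale (b w) w) \<in> zero_mod p d"
    by (auto simp: span_mod_def)
  from Q.Z_scale[OF this, of n] show "vscale n u \<in> span_mod S"
    unfolding span_mod_def
    by (intro CollectI exI[of _ "\<lambda>w. n * b w"]) (simp add: P.scale_right_diff_distrib P.scale_sum_right)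
qed

lemma indep_insert:
  assumes S: "Q.indep S (zero_mod p d)" and v: "v \<notin> span_mod S"
  shows "Q.indep (insert v S) (zero_mod p d)" "v \<notin> S"
proof -
  have fin: "finite S" using S by (simp add: Q.indep_def)
  show vS: "v \<notin> S"
  proof
    assume "v \<in> S"
    have "(\<Sum>w\<in>S. vscale (if w = v then 1 else 0) w) = (\<Sum>w\<in>S. if w = v then w else 0)"
      by (intro sum.cong) auto
    then have "v - (\<Sum>w\<in>S. vscale (if w = v then 1 else 0) w) = 0" using fin \<open>v \<in> S\<close> by simp
    then have "v - (\<Sum>w\<in>S. vscale (if w = v then 1 else 0) w) \<in> zero_mod p d" by (simp only: Q.Z_0)
    then have "v \<in> span_mod S" unfolding span_mod_def by (intro CollectI exI[of _ "\<lambda>w. if w = v then 1 else 0"])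
    with v show False by simp
  qed
  show "Q.indep (insert v S) (zero_mod p d)"
    unfolding Q.indep_def
  proof (intro conjI allI impI)
    fix c assume "(\<Sum>w\<in>insert v S. vscale (c w) w) \<in> zero_mod p d"
    then have *: "vscale (c v) v + (\<Sum>w\<in>S. vscale (c w) w) \<in> zero_mod p d" using fin vS by simp
    have "vscale (c v) v \<in> span_mod S"
      unfolding span_mod_def
      by (intro CollectI exI[of _ "\<lambda>w. - c w"]) (use * in \<open>simp add: sum_negf\<close>)
    then have cv: "int p dvd c v" using Q.subgroup_cancel[OF subgroup_span_mod] v by blast
    have "vscale (c v) v + (\<Sum>w\<in>S. vscale (c w) w) - vscale (c v) v \<in> zero_mod p d"
      by (rule Q.subgroup_over_Z_diff[OF Q.subgroup_Z * Q.Z_dvd[OF cv]])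
    then have "(\<Sum>w\<in>S. vscale (c w) w) \<in> zero_mod p d" by simp
    then show "\<forall>w\<in>insert v S. int p dvd c w" using Q.indepD[OF S] cv by blast
  qed (use fin in simp)
qed

text \<open>Coefficients can be reduced modulo \<open>p\<close>, so the span of \<open>S\<close> has
  at most \<open>p ^ card S\<close> classes.\<close>

lemma card_le_if_subset_span_mod:
  assumes "finite S" "X \<subseteq> span_mod S" "inj_on (reduce p d) X"
  shows "finite X \<and> card X \<le> p ^ card S"
proof -
  have p: "0 < int p" using p_odd by simp
  define C where "C = PiE S (\<lambda>_. {0..<int p})"
  have C: "finite C" "card C = p ^ card S"
    using assms(1) by (simp_all add: C_def card_PiE finite_PiE)
  have app: "(\<Sum>w\<in>S. vscale (b w) w) i = (\<Sum>w\<in>S. b w * w i)" for b i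
    using assms(1) by (induction S rule: finite_induct) (auto simp: vscale_def)
  have "reduce p d ` X \<subseteq> (\<lambda>c. reduce p d (\<Sum>w\<in>S. vscale (c w) w)) ` C"
  proof (intro subsetI, elim imageE)
    fix y v assume y: "y = reduce p d v" and "v \<in> X"
    then obtain c where c: "v - (\<Sum>w\<in>S. vscale (c w) w) \<in> zero_mod p d"
      using assms(2) by (auto simp: span_mod_def)
    define c' where "c' = restrict (\<lambda>w. c w mod int p) S"
    have "c' \<in> C" using p by (auto simp: C_def c'_def)
    have "v i mod int p = (\<Sum>w\<in>S. vscale (c' w) w) i mod int p" if "i < d" for i
    proof -
      have "v i mod int p = (\<Sum>w\<in>S. c w * w i) mod int p"
        using c that by (simp add: zero_mod_def mod_eq_dvd_iff app)
      also have "\<dots> = (\<Sum>w\<in>S. c' w * w i) mod int p"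
      proof -
        have "int p dvd (\<Sum>w\<in>S. c w * w i) - (\<Sum>w\<in>S. c' w * w i)"
          unfolding sum_subtractf[symmetric] left_diff_distrib[symmetric]
          by (intro dvd_sum dvd_mult2) (simp add: c'_def mod_eq_dvd_iff[symmetric])
        then show ?thesis by (simp add: mod_eq_dvd_iff)
      qed
      finally show ?thesis by (simp add: app)
    qed
    then have "y = reduce p d (\<Sum>w\<in>S. vscale (c' w) w)" by (auto simp: y reduce_def)
    with \<open>c' \<in> C\<close> show "y \<in> (\<lambda>c. reduce p d (\<Sum>w\<in>S. vscale (c w) w)) ` C" by blast
  qed
  then have "finite (reduce p d ` X)" "card (reduce p d ` X) \<le> card C"
    using C(1) finite_subset surj_card_le by blast+
  then show ?thesis using C(2) assms(3) by (simp add: card_image finite_image_iff)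
qed

text \<open>Greedy choice: \<open>X\<close> is too large for the span of fewer than \<open>n\<close>
  vectors. The factor \<open>p\<close> in the hypothesis expresses the exponent \<open>n - 1\<close>
  without subtraction.\<close>

lemma exists_indep:
  assumes "inj_on (reduce p d) X" "p ^ n < card X * p"
  shows "\<exists>S\<subseteq>X. Q.indep S (zero_mod p d) \<and> card S = n"
proof -
  have p: "0 < p" using p_odd by simp
  have "m \<le> n \<Longrightarrow> \<exists>S\<subseteq>X. Q.indep S (zero_mod p d) \<and> card S = m" for m
  proof (induction m)
    case 0
    show ?case by (intro exI[of _ "{}"]) (simp add: Q.indep_def)
  next
    case (Suc m)
    then obtain S where S: "S \<subseteq> X" "Q.indep S (zero_mod p d)" "card S = m" by auto
    have fin: "finite S" using S by (simp add: Q.indep_def)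
    have "\<not> X \<subseteq> span_mod S"
    proof
      assume "X \<subseteq> span_mod S"
      then have "card X \<le> p ^ m" using card_le_if_subset_span_mod[OF fin _ assms(1)] S(3) by blast
      then have "card X * p \<le> p ^ m * p" by (rule mult_le_mono1)
      also have "\<dots> = p ^ Suc m" by simp
      also have "\<dots> \<le> p ^ n" using Suc.prems p by (intro power_increasing) auto
      finally show False using assms(2) by simp
    qed
    then obtain v where v: "v \<in> X" "v \<notin> span_mod S" by blast
    with S fin show ?case using indep_insert[OF S(2) v(2)]
      by (intro exI[of _ "insert v S"]) auto
  qed
  then show ?thesis by blast
qed

end

section \<open>Boxes and their dilates\<close>

text \<open>The integer vector behind \<open>gp\<close> before reduction modulo \<open>p\<close>; it
  is exactly additive in the coordinates.\<close>

definition lincomb :: "nat \<Rightarrow> (nat \<Rightarrow> nat \<Rightarrow> int) \<Rightarrow> (nat \<Rightarrow> int) \<Rightarrow> nat \<Rightarrow> int" where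
  "lincomb D vs l = (\<lambda>i. \<Sum>j<D. l j * vs j i)"

lemma gp_eq_reduce: "gp p d D vs l = reduce p d (lincomb D vs l)"
  by (simp add: gp_def reduce_def lincomb_def fun_eq_iff)

lemma lincomb_add: "lincomb D vs (l + l') = lincomb D vs l + lincomb D vs l'"
  by (simp add: lincomb_def fun_eq_iff algebra_simps sum.distrib)

lemma lincomb_0 [simp]: "lincomb D vs 0 = 0"
  by (simp add: lincomb_def fun_eq_iff)

lemma lincomb_uminus: "lincomb D vs (- l) = - lincomb D vs l"
  by (simp add: lincomb_def fun_eq_iff sum_negf)

text \<open>The box scaled by \<open>m / K\<close>, except that the origin belongs to it even for \<open>m = 0\<close>.\<close>
definition sbox :: "nat \<Rightarrow> (nat \<Rightarrow> real) \<Rightarrow> nat \<Rightarrow> nat \<Rightarrow> (nat \<Rightarrow> int) set" where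
  "sbox D L K m = {l. (\<forall>j<D. l j = 0 \<or> real K * of_int \<bar>l j\<bar> < real m * L j) \<and> (\<forall>j\<ge>D. l j = 0)}"

lemma sbox_eq_box:
  assumes "\<And>j. j < D \<Longrightarrow> 0 < L j" "0 < m" "0 < K"
  shows "sbox D L K m = box D L (real m / real K)"
proof -
  have "(x = 0 \<or> real K * of_int \<bar>x\<bar> < real m * L j) \<longleftrightarrow> of_int \<bar>x\<bar> < real m / real K * L j"
    if "j < D" for x :: int and j
    using assms(1)[OF that] assms(2,3) by (auto simp: field_simps)
  then show ?thesis by (auto simp: sbox_def box_def)
qed

lemma sbox_0: "0 \<in> sbox D L K m"
  by (simp add: sbox_def)

lemma sbox_uminus: "l \<in> sbox D L K m \<Longrightarrow> - l \<in> sbox D L K m"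
  by (auto simp: sbox_def)

lemma sbox_mono:
  assumes "\<And>j. j < D \<Longrightarrow> 0 < L j" "m \<le> n" shows "sbox D L K m \<subseteq> sbox D L K n"
proof -
  have "real m * L j \<le> real n * L j" if "j < D" for j
    using assms(1)[OF that] assms(2) by (intro mult_right_mono) auto
  then show ?thesis by (fastforce simp: sbox_def)
qed

lemma sbox_add:
  assumes L: "\<And>j. j < D \<Longrightarrow> 0 < L j" and l: "l \<in> sbox D L K m" "l' \<in> sbox D L K n"
  shows "l + l' \<in> sbox D L K (m + n)"
proof -
  have "l j + l' j = 0 \<or> real K * of_int \<bar>l j + l' j\<bar> < real (m + n) * L j" if j: "j < D" for j
  proof (cases "l j = 0 \<or> l' j = 0")
    case True
    have "l \<in> sbox D L K (m + n)" "l' \<in> sbox D L K (m + n)"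
      using l sbox_mono[of D L m "m + n" K] sbox_mono[of D L n "m + n" K] L by auto
    then show ?thesis using True j by (auto simp: sbox_def)
  next
    case False
    then have "real K * of_int \<bar>l j\<bar> < real m * L j" "real K * of_int \<bar>l' j\<bar> < real n * L j"
      using l j by (auto simp: sbox_def)
    then have "real K * of_int \<bar>l j\<bar> + real K * of_int \<bar>l' j\<bar> < real (m + n) * L j"
      by (simp add: algebra_simps)
    moreover have "real K * of_int \<bar>l j + l' j\<bar> \<le> real K * (of_int \<bar>l j\<bar> + of_int \<bar>l' j\<bar>)"
      by (intro mult_left_mono) auto
    ultimately show ?thesis by (simp add: algebra_simps)
  qed
  then show ?thesis using l by (auto simp: sbox_def)
qed

text \<open>Division with remainder by \<open>K\<close> in each coordinate, applied to absolute
  values with signs restored: quotients lie in the smaller box and each remainder takes at most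
  \<open>2 * K\<close> values.\<close>

lemma card_box_le:
  assumes fin: "finite (sbox D L K K)" and "0 < K" and L: "\<And>j. j < D \<Longrightarrow> 0 < L j"
  shows "card (sbox D L K K) \<le> card (sbox D L K 1) * (2 * K) ^ D"
proof -
  define quot where "quot l = (\<lambda>j. sgn (l j) * (\<bar>l j\<bar> div int K))" for l :: "nat \<Rightarrow> int"
  define rem where "rem l = restrict (\<lambda>j. sgn (l j) * (\<bar>l j\<bar> mod int K)) {..<D}" for l :: "nat \<Rightarrow> int"
  define R where "R = PiE {..<D} (\<lambda>_. {- int K..<int K})"
  have R: "finite R" "card R = (2 * K) ^ D"
    by (simp_all add: R_def card_PiE finite_PiE nat_mult_distrib power_mult_distrib)
  have fin1: "finite (sbox D L K 1)"
    using finite_subset[OF sbox_mono[of D L 1 K K] fin] L \<open>0 < K\<close> by simp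
  have "inj_on (\<lambda>l. (quot l, rem l)) (sbox D L K K)"
  proof (rule inj_onI)
    fix l l' assume l: "l \<in> sbox D L K K" "l' \<in> sbox D L K K" and eq: "(quot l, rem l) = (quot l', rem l')"
    show "l = l'"
    proof
      fix j
      have dec: "x = int K * (sgn x * (\<bar>x\<bar> div int K)) + sgn x * (\<bar>x\<bar> mod int K)" for x
      proof -
        have "x = sgn x * \<bar>x\<bar>" by (simp add: sgn_mult_abs)
        also have "\<dots> = sgn x * (int K * (\<bar>x\<bar> div int K) + \<bar>x\<bar> mod int K)" by simp
        finally show ?thesis by (simp only: distrib_left mult_ac)
      qed
      show "l j = l' j"
      proof (cases "j < D")
        case True
        have "quot l j = quot l' j" "rem l j = rem l' j" using eq by auto
        then show ?thesis using dec[of "l j"] dec[of "l' j"] True by (simp add: quot_def rem_def)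
      qed (use l in \<open>auto simp: sbox_def\<close>)
    qed
  qed
  moreover have "(\<lambda>l. (quot l, rem l)) ` sbox D L K K \<subseteq> sbox D L K 1 \<times> R"
  proof (intro subsetI, elim imageE, simp only:, intro SigmaI)
    fix l assume l: "l \<in> sbox D L K K"
    have "quot l j = 0 \<or> real K * of_int \<bar>quot l j\<bar> < L j" if j: "j < D" for j
    proof (cases "l j = 0")
      case False
      then have lt: "real K * of_int \<bar>l j\<bar> < real K * L j" using l j by (auto simp: sbox_def)
      have "int K * \<bar>quot l j\<bar> = int K * (\<bar>l j\<bar> div int K)"
        using False \<open>0 < K\<close> by (simp add: quot_def abs_mult abs_sgn_eq pos_imp_zdiv_nonneg_iff)
      also have "\<dots> \<le> \<bar>l j\<bar>"
        using \<open>0 < K\<close> by (metis mult_div_mod_eq abs_ge_zero le_add_same_cancel1 of_nat_0_less_iff pos_mod_sign)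
      finally have "of_int (int K * \<bar>quot l j\<bar>) \<le> (of_int \<bar>l j\<bar> :: real)" by (simp only: of_int_le_iff)
      moreover have "of_int \<bar>l j\<bar> < L j" using lt \<open>0 < K\<close> by simp
      ultimately show ?thesis by simp
    qed (simp add: quot_def)
    then show "quot l \<in> sbox D L K 1" using l by (auto simp: sbox_def quot_def)
    have "\<bar>sgn x * (\<bar>x\<bar> mod int K)\<bar> < int K" for x
      using \<open>0 < K\<close> by (simp add: abs_mult abs_sgn_eq)
    then have "- int K \<le> sgn x * (\<bar>x\<bar> mod int K) \<and> sgn x * (\<bar>x\<bar> mod int K) < int K" for x
      by (smt (verit))
    then show "rem l \<in> R" by (simp add: R_def rem_def)
  qed
  ultimately have "card (sbox D L K K) \<le> card (sbox D L K 1 \<times> R)"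
    using fin1 R(1) by (intro card_inj_on_le) auto
  then show ?thesis using R(2) by (simp add: card_cartesian_product)
qed

section \<open>From cocycles to progressions\<close>

text \<open>The cocycle argument is applied to the integer vectors \<open>W l\<close>, with dilates
  of the box as \<open>B\<close> and the degree \<open>s\<close> part of \<open>\<xi>\<close> minus
  its value at 0 as \<open>X\<close>. The resulting additive \<open>T\<close> is determined modulo
  the quadric ideal by its values at the generators, which are the coefficients sought.\<close>

lemma (in prime_quadric) locally_linear_exists:
  fixes vs :: "nat \<Rightarrow> nat \<Rightarrow> int" and L :: "nat \<Rightarrow> real" and \<xi> :: "(nat \<Rightarrow> int) \<Rightarrow> mpoly"
    and D s q :: nat
  defines "q \<equiv> 4 * (s + 2) * 2 ^ (s + 5)"
  assumes L: "\<And>j. j < D \<Longrightarrow> 0 < L j"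
    and inj: "inj_on (gp p d D vs) (box D L 1)"
    and p: "2 ^ (s + 5) < p"
    and card: "p ^ (s + 5) < card (sbox D L (4 * q) 1) * p"
    and HP: "\<And>h. h \<in> GAP p d D vs L 1 \<Longrightarrow> HP p d s (\<xi> h)"
    and cocycle: "\<And>h1 h2 h3 h4. \<lbrakk>h1 \<in> GAP p d D vs L 1; h2 \<in> GAP p d D vs L 1;
        h3 \<in> GAP p d D vs L 1; h4 \<in> GAP p d D vs L 1; vadd p d h1 h2 = vadd p d h3 h4\<rbrakk>
        \<Longrightarrow> Jmem p d A {h1, h2, h3} (\<xi> h1 + \<xi> h2 - \<xi> h3 - \<xi> h4)"
  shows "\<exists>T f. (\<forall>h \<in> GAP p d D vs L (1 / real (4 * q)). HP p d s (T h))
    \<and> (\<forall>j\<le>D. HP p d s (f j))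
    \<and> (\<forall>l \<in> box D L (1 / real (4 * q)). congp p (T (gp p d D vs l))
          (f 0 + (\<Sum>j<D. of_int (l j) * f (Suc j))))
    \<and> (\<forall>h \<in> GAP p d D vs L (1 / real (4 * q)). Jmem p d A {h} (\<xi> h - T h))"
proof -
  define K where "K = 4 * q"
  have K: "0 < K" by (simp add: K_def q_def)
  define W where "W = lincomb D vs"
  define B where "B m = W ` sbox D L K m" for m
  \<comment> \<open>The projection makes \<open>X\<close> exactly homogeneous, whereas
    \<open>HP\<close> grants homogeneity only modulo \<open>p\<close>.\<close>
  define X where "X v = hcomp d s (\<xi> (reduce p d v) - \<xi> (reduce p d 0))" for v
  have box1: "box D L 1 = sbox D L K K" using sbox_eq_box[of D L K K] L K by simp
  have boxc: "box D L (1 / real K) = sbox D L K 1" using sbox_eq_box[of D L 1 K] L K by simp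
  have mono: "sbox D L K m \<subseteq> sbox D L K n" if "m \<le> n" for m n
    using L that by (rule sbox_mono)
  have gp: "gp p d D vs l = reduce p d (W l)" for l by (simp add: gp_eq_reduce W_def)
  have GAP1: "GAP p d D vs L 1 = reduce p d ` B K"
    by (simp add: GAP_def box1 B_def image_image gp)
  have inj_W: "inj_on (\<lambda>l. reduce p d (W l)) (sbox D L K K)" 
    using inj unfolding box1 gp[abs_def] .
  have inj_B: "inj_on (reduce p d) (B m)" if "m \<le> K" for m
    using inj_on_subset[OF inj_W mono[OF that]] by (auto simp: B_def inj_on_def)
  have card_B: "card (B 1) = card (sbox D L K 1)"
    unfolding B_def using inj_on_subset[OF inj_W mono[of 1 K]] K
    by (intro card_image) (auto simp: inj_on_def)
  obtain E where E: "E \<subseteq> B 1" "Q.indep E (zero_mod p d)" "card E = s + 5"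
  proof -
    have "p ^ (s + 5) < card (B 1) * p" using card by (simp only: card_B K_def)
    then show ?thesis using exists_indep[OF inj_B[of 1]] K that by auto
  qed
  have X_add: "X (u + v) - X u - X v \<in> Q.J [u, v]"
    if uv: "u \<in> B (4 * q)" "v \<in> B (4 * q)" "u + v \<in> B (4 * q)" for u v
  proof -
    have G: "reduce p d w \<in> GAP p d D vs L 1" if "w \<in> B (4 * q)" for w
      using that by (simp add: GAP1 K_def)
    have B0: "0 \<in> B (4 * q)" unfolding B_def W_def by (rule image_eqI[OF _ sbox_0]) simp
    \<comment> \<open>The hypothesis on \<open>\<xi>\<close> is applied with third vector 0 and
      fourth vector \<open>u + v\<close>.\<close>
    have "vadd p d (reduce p d u) (reduce p d v) = vadd p d (reduce p d 0) (reduce p d (u + v))"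
      by (simp add: vadd_def reduce_def fun_eq_iff mod_simps)
    from cocycle[OF G[OF uv(1)] G[OF uv(2)] G[OF B0] G[OF uv(3)] this]
    have "\<xi> (reduce p d u) + \<xi> (reduce p d v) - \<xi> (reduce p d 0) - \<xi> (reduce p d (u + v)) \<in> Q.J [u, v]"
    proof (rule Jmem_imp_J)
      fix h assume "h \<in> {reduce p d u, reduce p d v, reduce p d 0}"
      then obtain w where h: "h = reduce p d w" and w: "w = u \<or> w = v \<or> w = 0" by blast
      have "Lform d A w \<in> Q.J [u, v]"
        using w Q.Lam_in_J[of w "[u, v]"] is_ideal_0[OF Q.ideal_J, of "[u, v]"] Q.Lam_0 by (metis list.set_intros)
      then show "Lform d A h \<in> Q.J [u, v]" unfolding h by (rule Lform_reduce_in_J)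
    qed
    from is_ideal_uminus[OF Q.ideal_J Q.hc_J[OF this, of s]]
    show ?thesis by (simp add: X_def hcomp_add hcomp_diff algebra_simps)
  qed
  interpret cocycle vscale "int p" "quadric_ideal (int p) d A" "Lform d A" "zero_mod (int p) d" "hcomp d" B q s X E
  proof unfold_locales
    fix m n u v
    show "0 \<in> B m" unfolding B_def W_def by (rule image_eqI[OF _ sbox_0]) simp
    show "u + v \<in> B (m + n)" if "u \<in> B m" "v \<in> B n"
    proof -
      from that obtain l l' where l: "u = W l" "v = W l'" "l \<in> sbox D L K m" "l' \<in> sbox D L K n"
        by (auto simp: B_def)
      then have "l + l' \<in> sbox D L K (m + n)" by (intro sbox_add L)
      then show ?thesis unfolding B_def l W_def lincomb_add[symmetric] by (rule imageI)
    qed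
    show "- u \<in> B m" if "u \<in> B m"
    proof -
      from that obtain l where l: "u = W l" "l \<in> sbox D L K m" by (auto simp: B_def)
      then show ?thesis unfolding B_def l W_def lincomb_uminus[symmetric]
        by (intro imageI sbox_uminus)
    qed
    show "B m \<subseteq> B n" if "m \<le> n" unfolding B_def using mono[OF that] by (rule image_mono)
    show "u = 0" if u: "u \<in> B (4 * q)" "u \<in> zero_mod (int p) d"
    proof -
      obtain l where l: "u = W l" "l \<in> sbox D L K K" using u(1) by (auto simp: B_def K_def)
      have "reduce p d (W l) = reduce p d (W 0)"
        using u(2) by (auto simp: l reduce_def zero_mod_def W_def)
      then have "l = 0" using inj_onD[OF inj_W _ l(2) sbox_0] by simp
      then show ?thesis by (simp add: l W_def)
    qed
    show "X 0 = 0" by (simp add: X_def)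
    show "hcomp d s (X u) = X u" by (simp add: X_def hcomp_hcomp)
    show "2 ^ (s + 5) < int p" using p by (metis of_nat_less_iff of_nat_numeral of_nat_power)
  qed (use X_add E q_def in auto)
  obtain T where T: "T 0 = 0" "\<And>h. hcomp d s (T h) = T h"
    "\<And>h. h \<in> B 1 \<Longrightarrow> T h - X h \<in> Q.J [h]"
    "\<And>a b. a \<in> B 1 \<Longrightarrow> b \<in> B 1 \<Longrightarrow> T (a + b) - T a - T b \<in> quadric_ideal (int p) d A"
    by (rule additive_exists) blast
  note I = is_ideal_quadric_ideal[of "int p" d A]
  define e where "e j = (\<lambda>i. if i = j then 1 else 0 :: int)" for j :: nat
  \<comment> \<open>If \<open>e j\<close> is outside the small box, then every point of that box has
    \<open>j\<close>-th coordinate 0, so the default 0 is harmless.\<close>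
  define f where "f = case_nat (\<xi> (reduce p d 0)) (\<lambda>j. if e j \<in> sbox D L K 1 then T (W (e j)) else 0)"
  have T_lin: "T (W l) - (\<Sum>j<D. of_int (l j) * f (Suc j)) \<in> quadric_ideal (int p) d A"
    if "l \<in> sbox D L K 1" for l
    using that
  \<comment> \<open>The induction measure is the sum of the absolute values of the coordinates; one
    nonzero coordinate moves one step towards 0.\<close>
  proof (induction "\<Sum>j<D. nat \<bar>l j\<bar>" arbitrary: l rule: less_induct)
    case less
    show ?case
    proof (cases "\<exists>j<D. l j \<noteq> 0")
      case False
      then have "l = 0" using less.prems by (auto simp: sbox_def fun_eq_iff) (meson not_le)
      then show ?thesis by (simp add: W_def T(1) is_ideal_0[OF I])
    next
      case True
      then obtain j where j: "j < D" "l j \<noteq> 0" by blast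
      define l' where "l' = l(j := l j - sgn (l j))"
      have lt: "real K * of_int \<bar>l j\<bar> < L j" using less.prems j by (auto simp: sbox_def)
      have "(1::real) \<le> of_int \<bar>l j\<bar>" using j(2) by linarith
      then have "real K * 1 \<le> real K * of_int \<bar>l j\<bar>" by (intro mult_left_mono) auto
      then have "real K < L j" using lt by simp
      then have ej: "e j \<in> sbox D L K 1" using j(1) by (auto simp: sbox_def e_def)
      have abs: "\<bar>l j - sgn (l j)\<bar> = \<bar>l j\<bar> - 1" using j(2) by (simp add: sgn_if)
      have "real K * of_int (\<bar>l j\<bar> - 1) \<le> real K * of_int \<bar>l j\<bar>" by (intro mult_left_mono) auto
      then have "real K * of_int \<bar>l j - sgn (l j)\<bar> < L j" using lt unfolding abs by linarith
      then have l': "l' \<in> sbox D L K 1"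
        using less.prems by (auto simp: sbox_def l'_def)
      have "(\<Sum>i<D. nat \<bar>l' i\<bar>) < (\<Sum>i<D. nat \<bar>l i\<bar>)"
      proof (rule sum_strict_mono_ex1)
        show "\<forall>i\<in>{..<D}. nat \<bar>l' i\<bar> \<le> nat \<bar>l i\<bar>" using abs by (auto simp: l'_def intro!: nat_mono)
        show "\<exists>i\<in>{..<D}. nat \<bar>l' i\<bar> < nat \<bar>l i\<bar>"
          using j abs by (intro bexI[of _ j]) (auto simp: l'_def)
      qed simp
      then have IH: "T (W l') - (\<Sum>i<D. of_int (l' i) * f (Suc i)) \<in> quadric_ideal (int p) d A"
        using less.hyps l' by blast
      have "(\<Sum>i<D. of_int (l i) * f (Suc i)) - (\<Sum>i<D. of_int (l' i) * f (Suc i))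
          = (\<Sum>i<D. if i = j then of_int (sgn (l j)) * f (Suc j) else 0)"
        unfolding sum_subtractf[symmetric]
        by (intro sum.cong) (auto simp: l'_def simp flip: left_diff_distrib of_int_diff)
      also have "\<dots> = of_int (sgn (l j)) * T (W (e j))" using j(1) ej by (simp add: f_def)
      finally have sum: "(\<Sum>i<D. of_int (l i) * f (Suc i))
          = (\<Sum>i<D. of_int (l' i) * f (Suc i)) + of_int (sgn (l j)) * T (W (e j))" by (simp add: algebra_simps)
      have B1: "W l \<in> B 1" "W l' \<in> B 1" "W (e j) \<in> B 1"
        using less.prems l' ej by (auto simp: B_def)
      consider "sgn (l j) = 1" | "sgn (l j) = -1"
        using j(2) by (cases "l j" "0 :: int" rule: linorder_cases) auto
      then show ?thesis
      proof cases
        case 1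
        have "l = l' + e j" using 1 by (auto simp: l'_def e_def fun_eq_iff)
        then have "W l = W l' + W (e j)" by (simp add: W_def lincomb_add)
        then have "T (W l) - T (W l') - T (W (e j)) \<in> quadric_ideal (int p) d A"
          using T(4)[OF B1(2,3)] by simp
        from is_ideal_add[OF I this IH] show ?thesis unfolding sum 1 by (simp add: algebra_simps)
      next
        case 2
        \<comment> \<open>A negative coordinate is handled by reading the step backwards, so only
          \<open>T\<close> at \<open>e j\<close> itself occurs.\<close>
        have "l' = l + e j" using 2 by (auto simp: l'_def e_def fun_eq_iff)
        then have "W l' = W l + W (e j)" by (simp add: W_def lincomb_add)
        then have "T (W l') - T (W l) - T (W (e j)) \<in> quadric_ideal (int p) d A"
          using T(4)[OF B1(1,3)] by simp
        from is_ideal_diff[OF I IH this] show ?thesis unfolding sum 2 by (simp add: algebra_simps)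
      qed
    qed
  qed
  \<comment> \<open>Properness makes the coordinates of a point unique, so \<open>T'\<close> takes
    the intended values on the progression.\<close>
  define T' where "T' h = f 0 + (\<Sum>j<D. of_int (inv_into (box D L 1) (gp p d D vs) h j) * f (Suc j))" for h
  have T'_gp: "T' (gp p d D vs l) = f 0 + (\<Sum>j<D. of_int (l j) * f (Suc j))" if "l \<in> box D L (1 / real K)" for l
  proof -
    have "l \<in> box D L 1" using that mono[of 1 K] K by (auto simp: box1 boxc)
    then show ?thesis by (simp add: T'_def inv_into_f_f[OF inj])
  qed
  have HP_0: "HP p d s (\<xi> (reduce p d 0))"
    by (rule HP) (use imageI[OF sbox_0, of W] in \<open>auto simp: GAP1 B_def W_def\<close>)
  have HP_f: "HP p d s (f j)" for j
    using HP_0 by (cases j) (auto simp: f_def T(2) intro!: HP_hcomp)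
  have HP_T': "HP p d s (T' h)" for h
    unfolding T'_def by (intro HP_add HP_sum HP_of_int_mult HP_f)
  have main: "Jmem p d A {h} (\<xi> h - T' h)" if hG: "h \<in> GAP p d D vs L (1 / real K)" for h
  proof -
    obtain l where l: "h = gp p d D vs l" "l \<in> box D L (1 / real K)" using hG by (auto simp: GAP_def)
    have l1: "l \<in> sbox D L K 1" using l(2) by (simp only: boxc)
    then have WB: "W l \<in> B 1" by (auto simp: B_def)
    have h: "h = reduce p d (W l)" by (simp add: l(1) gp)
    have "W l \<in> B K" using WB K mono[of 1 K] by (auto simp: B_def)
    then have HP_h: "HP p d s (\<xi> h)" by (intro HP) (auto simp: GAP1 h)
    have "of_int (int p) dvd (\<xi> h - \<xi> (reduce p d 0)) - hcomp d s (\<xi> h - \<xi> (reduce p d 0))"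
      using HP_diff[OF HP_h HP_0] by (simp only: HP_iff)
    then have 1: "(\<xi> h - f 0) - X (W l) \<in> Q.J [W l]"
      by (intro Q.I_subset_J) (auto simp: in_quadric_ideal X_def h f_def intro!: exI[of _ 0])
    have 2: "T (W l) - (T' h - f 0) \<in> Q.J [W l]"
      using T_lin[OF l1] by (intro Q.I_subset_J) (simp add: l(1) T'_gp[OF l(2)])
    \<comment> \<open>The three congruences lead from \<open>\<xi>\<close> to \<open>X\<close>, from
      \<open>X\<close> to \<open>T\<close>, and from \<open>T\<close> to the locally linear
      map.\<close>
    have "((\<xi> h - f 0) - X (W l)) - (T (W l) - X (W l)) + (T (W l) - (T' h - f 0)) \<in> Q.J [W l]"
      by (rule is_ideal_add[OF Q.ideal_J is_ideal_diff[OF Q.ideal_J 1 T(3)[OF WB]] 2])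
    then have "\<xi> h - T' h \<in> Q.J [W l]" by (simp add: algebra_simps)
    then show ?thesis unfolding h by (rule J_imp_Jmem) (use HP_diff[OF HP_h HP_T'] in \<open>simp add: h\<close>)
  qed
  show ?thesis
    unfolding K_def[symmetric]
    by (rule exI[of _ T'], rule exI[of _ f]) (use HP_T' HP_f main T'_gp in \<open>auto simp: congp_def\<close>)
qed

text \<open>Shrinking the box by \<open>K\<close> loses a factor of at most
  \<open>(2 * K) ^ D\<close>, which for large \<open>p\<close> leaves more than
  \<open>p ^ (d - 1)\<close> points. As \<open>s + 5 \<le> d\<close>, these contain
  \<open>s + 5\<close> independent vectors.\<close>

lemma dense_progression_locally_linear:
  fixes A vs :: "nat \<Rightarrow> nat \<Rightarrow> int" and L :: "nat \<Rightarrow> real" and \<xi> :: "(nat \<Rightarrow> int) \<Rightarrow> mpoly"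
    and p d D s K :: nat and \<delta> :: real
  defines "K \<equiv> 4 * (4 * (s + 2) * 2 ^ (s + 5))"
  assumes d: "max (s + 10) 11 \<le> d" and \<delta>: "0 < \<delta>" and "prime p"
    and p: "2 ^ (s + 5) < p" "2 < p" "(2 * real K) ^ D / \<delta> < real p"
    and A: "nondeg_sym p d A" and L: "\<forall>j<D. 0 < L j"
    and inj: "inj_on (gp p d D vs) (box D L 1)"
    and card: "\<delta> * real p ^ d < real (card (GAP p d D vs L 1))"
    and HP: "\<forall>h \<in> GAP p d D vs L 1. HP p d s (\<xi> h)"
    and cocycle: "\<forall>h1 \<in> GAP p d D vs L 1. \<forall>h2 \<in> GAP p d D vs L 1.
      \<forall>h3 \<in> GAP p d D vs L 1. \<forall>h4 \<in> GAP p d D vs L 1. vadd p d h1 h2 = vadd p d h3 h4 \<longrightarrow>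
        Jmem p d A {h1, h2, h3} (\<xi> h1 + \<xi> h2 - \<xi> h3 - \<xi> h4)"
  shows "\<exists>T f. (\<forall>h \<in> GAP p d D vs L (1 / real K). HP p d s (T h))
    \<and> (\<forall>j\<le>D. HP p d s (f j))
    \<and> (\<forall>l \<in> box D L (1 / real K). congp p (T (gp p d D vs l))
          (f 0 + (\<Sum>j<D. of_int (l j) * f (Suc j))))
    \<and> (\<forall>h \<in> GAP p d D vs L (1 / real K). Jmem p d A {h} (\<xi> h - T h))"
proof -
  have K: "0 < K" by (simp add: K_def)
  interpret prime_quadric p d A
  proof
    show "prime (int p)" using \<open>prime p\<close> by simp
    show "2 < int p" using p(2) by simp
    show "7 \<le> d" using d by simp
    show "A i j = A j i" if "i < d" "j < d" for i j using A that by (auto simp: nondeg_sym_def)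
    show "int p dvd y k" if "\<And>i. i < d \<Longrightarrow> int p dvd (\<Sum>j<d. A i j * y j)" "k < d" for y k
      using kernel_mod_prime_trivial[of "int p" d A k y] that A \<open>prime p\<close> by (auto simp: nondeg_sym_def)
  qed
  have box1: "box D L 1 = sbox D L K K" using sbox_eq_box[of D L K K] L K by simp
  have card_GAP: "card (GAP p d D vs L 1) = card (sbox D L K K)"
    unfolding GAP_def using card_image[OF inj] by (simp add: box1)
  have pos: "0 < \<delta> * real p ^ d" using \<delta> p(2) by simp
  \<comment> \<open>An infinite set would have cardinality 0, contrary to the density.\<close>
  then have "finite (sbox D L K K)" using card unfolding card_GAP by (metis card.infinite less_asym of_nat_0)
  then have "card (sbox D L K K) \<le> card (sbox D L K 1) * (2 * K) ^ D"
    using K L by (intro card_box_le) auto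
  then have "real (card (sbox D L K K)) \<le> real (card (sbox D L K 1) * (2 * K) ^ D)" by (simp only: of_nat_le_iff)
  then have "\<delta> * real p ^ d < real (card (sbox D L K 1)) * (2 * real K) ^ D"
    using card unfolding card_GAP by simp
  also have "\<dots> \<le> real (card (sbox D L K 1)) * (\<delta> * real p)"
    using p(3) \<delta> by (intro mult_left_mono) (auto simp: field_simps)
  finally have "\<delta> * real p ^ d < \<delta> * (real (card (sbox D L K 1)) * real p)" by (simp add: mult_ac)
  then have "real p ^ d < real (card (sbox D L K 1)) * real p" using \<delta> by simp
  then have "p ^ d < card (sbox D L K 1) * p" by (metis of_nat_less_iff of_nat_mult of_nat_power)
  moreover have "p ^ (s + 5) \<le> p ^ d" using d p(2) by (intro power_increasing) auto
  ultimately have "p ^ (s + 5) < card (sbox D L (4 * (4 * (s + 2) * 2 ^ (s + 5))) 1) * p" by (simp add: K_def)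
  then show ?thesis
    unfolding K_def using locally_linear_exists[of D L vs s \<xi>] L inj p(1) HP cocycle by blast
qed

theorem theorem4p3:
  "\<forall>s::nat. \<exists>c::real. 0 < c \<and> c \<le> 1 \<and>
    (\<forall>(d::nat) (D::nat) (\<delta>::real). 0 < d \<longrightarrow> 0 < D \<longrightarrow> max (s + 10) 11 \<le> d \<longrightarrow> 0 < \<delta> \<longrightarrow>
      (\<exists>p0::nat. \<forall>p::nat. prime p \<and> p0 \<le> p \<longrightarrow>
        (\<forall>(A :: nat \<Rightarrow> nat \<Rightarrow> int) (vs :: nat \<Rightarrow> nat \<Rightarrow> int) (L :: nat \<Rightarrow> real)
           (\<xi> :: (nat \<Rightarrow> int) \<Rightarrow> mpoly).
          nondeg_sym p d A
          \<longrightarrow> (\<forall>j<D. vs j \<in> Fvec p d)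
          \<longrightarrow> (\<forall>j<D. 0 < L j)
          \<longrightarrow> inj_on (gp p d D vs) (box D L 1)
          \<longrightarrow> real (card (GAP p d D vs L 1)) > \<delta> * real p ^ d
          \<longrightarrow> (\<forall>h \<in> GAP p d D vs L 1. HP p d s (\<xi> h))
          \<longrightarrow> (\<forall>h1 \<in> GAP p d D vs L 1. \<forall>h2 \<in> GAP p d D vs L 1.
               \<forall>h3 \<in> GAP p d D vs L 1. \<forall>h4 \<in> GAP p d D vs L 1.
                 vadd p d h1 h2 = vadd p d h3 h4 \<longrightarrow>
                 Jmem p d A {h1, h2, h3} (\<xi> h1 + \<xi> h2 - \<xi> h3 - \<xi> h4))
          \<longrightarrow> (\<exists>(T :: (nat \<Rightarrow> int) \<Rightarrow> mpoly) (f :: nat \<Rightarrow> mpoly).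
                (\<forall>h \<in> GAP p d D vs L c. HP p d s (T h))
              \<and> (\<forall>j\<le>D. HP p d s (f j))
              \<and> (\<forall>l \<in> box D L c. congp p (T (gp p d D vs l))
                    (f 0 + (\<Sum>j<D. of_int (l j) * f (Suc j))))
              \<and> (\<forall>h \<in> GAP p d D vs L c. Jmem p d A {h} (\<xi> h - T h))))))"
proof (rule allI, goal_cases)
  case (1 s)
  define K :: nat where "K = 4 * (4 * (s + 2) * 2 ^ (s + 5))"
  have K: "0 < K" by (simp add: K_def)
  show ?case
  \<comment> \<open>\<open>K\<close> is the number \<open>4 * q\<close> of the cocycle argument, so
    the constant depends on \<open>s\<close> alone.\<close>
  proof (rule exI[of _ "1 / real K"], intro conjI allI impI, goal_cases)
    case (3 d D \<delta>)
    show ?case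
    \<comment> \<open>The sum meets three demands at once: enough points in the shrunk box, the
      bound \<open>2 ^ (s + 5) < p\<close>, and \<open>p\<close> odd.\<close>
    proof (rule exI[of _ "nat \<lceil>(2 * real K) ^ D / \<delta>\<rceil> + 2 ^ (s + 5) + 3"], intro allI impI, goal_cases)
      case (1 p A vs L \<xi>)
      then have p: "prime p" "nat \<lceil>(2 * real K) ^ D / \<delta>\<rceil> + 2 ^ (s + 5) + 3 \<le> p" by simp_all
      then have "2 ^ (s + 5) < p" "2 < p" "(2 * real K) ^ D / \<delta> < real p" by (simp_all, linarith)
      then show ?case
        using 1(2-8) 3(3,4) p(1) unfolding K_def by (intro dense_progression_locally_linear) auto
    qed
  qed (use K in simp_all)
qed

end
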